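(* Let $H$ and $H'$ be cubic graphs, each on at least $6$ vertices, where $H$ is non-hamiltonian and $H'$ is hypohamiltonian. Let $ab, cd \in E(H)$ be independent edges and put $J = H - \{ab, cd\}$. Suppose that each of $(a,c)$, $(a,d)$, $(b,c)$, $(b,d)$ is good in $J$, that $((a,b),(c,d))$ is good in $J$, and that for each vertex $t \in V(H)$ at least one of $(a,b)$ or $(c,d)$ is good in $H - \{t, ab, cd\}$ (the graph obtained from $H$ by deleting the vertex $t$ and the edges $ab$, $cd$). Let $x,y$ be adjacent vertices of $H'$, let $a',b'$ be the neighbours of $x$ other than $y$, let $c',d'$ be the neighbours of $y$ other than $x$, and put $J' = H' - \{x,y\}$. Then the dot product $$H \cdot H' = \big(V(H) \cup V(J'),\ E(J) \cup E(J') \cup \{aa', bb', cc', dd'\}\big)$$ is a cubic hypohamiltonian graph. Moreover, if $H$ and $H'$ are planar and $ab$ and $cd$ lie on the same facial cycle of a plane embedding of $H$, then the labelling $a',b',c',d'$ can be chosen so that $H \cdot H'$ is planar. Finally, if $g$ and $g'$ are the girths of $H$ and $H'$ respectively, then the girth of $H \cdot H'$ is at least $\min\{g, g'\}$.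
   Context: All graphs are finite, undirected, without loops or multiple edges. A graph is hamiltonian if it has a cycle through all its vertices; a graph $G$ is hypohamiltonian if $G$ is non-hamiltonian but $G - v$ is hamiltonian for every vertex $v$. Two edges are independent if they share no vertex. For a graph $G$ and vertices $v,w,x,y$: the pair $(v,w)$ is good in $G$ if $G$ has a hamiltonian path with end-vertices $v$ and $w$; the pair of pairs $((v,w),(x,y))$ is good in $G$ if there are two vertex-disjoint paths which together span (cover all vertices of) $G$, one with end-vertices $v$ and $w$ and the other with end-vertices $x$ and $y$. The girth of a graph is the length of its shortest cycle. *)

theory Defs
  imports "HOL-Analysis.Analysis"
begin

definition graph :: "'v set \<Rightarrow> 'v set set \<Rightarrow> bool" where
  "graph V E \<longleftrightarrow> finite V \<and> (\<forall>e\<in>E. \<exists>u v. e = {u, v} \<and> u \<noteq> v \<and> u \<in> V \<and> v \<in> V)"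

definition degree :: "'v set set \<Rightarrow> 'v \<Rightarrow> nat" where
  "degree E v = card {e \<in> E. v \<in> e}"

definition cubic :: "'v set \<Rightarrow> 'v set set \<Rightarrow> bool" where
  "cubic V E \<longleftrightarrow> graph V E \<and> (\<forall>v\<in>V. degree E v = 3)"

definition neighbours :: "'v set set \<Rightarrow> 'v \<Rightarrow> 'v set" where
  "neighbours E v = {u. {v, u} \<in> E}"

definition del_verts_edges :: "'v set set \<Rightarrow> 'v set \<Rightarrow> 'v set set" where
  "del_verts_edges E S = {e \<in> E. e \<inter> S = {}}"

definition is_path :: "'v set \<Rightarrow> 'v set set \<Rightarrow> 'v list \<Rightarrow> bool" where
  "is_path V E p \<longleftrightarrow> p \<noteq> [] \<and> distinct p \<and> set p \<subseteq> V \<and>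
     (\<forall>i. Suc i < length p \<longrightarrow> {p ! i, p ! Suc i} \<in> E)"

definition is_cycle :: "'v set \<Rightarrow> 'v set set \<Rightarrow> 'v list \<Rightarrow> bool" where
  "is_cycle V E c \<longleftrightarrow> is_path V E c \<and> length c \<ge> 3 \<and> {last c, hd c} \<in> E"

definition hamiltonian :: "'v set \<Rightarrow> 'v set set \<Rightarrow> bool" where
  "hamiltonian V E \<longleftrightarrow> (\<exists>c. is_cycle V E c \<and> set c = V)"

definition hypohamiltonian :: "'v set \<Rightarrow> 'v set set \<Rightarrow> bool" where
  "hypohamiltonian V E \<longleftrightarrow> \<not> hamiltonian V E \<and>
     (\<forall>v\<in>V. hamiltonian (V - {v}) (del_verts_edges E {v}))"

definition good_pair :: "'v set \<Rightarrow> 'v set set \<Rightarrow> 'v \<Rightarrow> 'v \<Rightarrow> bool" where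
  "good_pair V E v w \<longleftrightarrow> (\<exists>p. is_path V E p \<and> set p = V \<and> hd p = v \<and> last p = w)"

definition good_pairs :: "'v set \<Rightarrow> 'v set set \<Rightarrow> 'v \<Rightarrow> 'v \<Rightarrow> 'v \<Rightarrow> 'v \<Rightarrow> bool" where
  "good_pairs V E v w x y \<longleftrightarrow> (\<exists>p q. is_path V E p \<and> is_path V E q \<and>
     set p \<inter> set q = {} \<and> set p \<union> set q = V \<and>
     hd p = v \<and> last p = w \<and> hd q = x \<and> last q = y)"

definition girth :: "'v set \<Rightarrow> 'v set set \<Rightarrow> nat" where
  "girth V E = Min {length c | c. is_cycle V E c}"

definition dot_verts :: "'a set \<Rightarrow> 'b set \<Rightarrow> 'b \<Rightarrow> 'b \<Rightarrow> ('a + 'b) set" where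
  "dot_verts V V' x y = Inl ` V \<union> Inr ` (V' - {x, y})"

definition dot_edges ::
  "'a set set \<Rightarrow> 'b set set \<Rightarrow> 'a \<Rightarrow> 'a \<Rightarrow> 'a \<Rightarrow> 'a \<Rightarrow> 'b \<Rightarrow> 'b
     \<Rightarrow> 'b \<Rightarrow> 'b \<Rightarrow> 'b \<Rightarrow> 'b \<Rightarrow> ('a + 'b) set set" where
  "dot_edges E E' a b c d x y a' b' c' d' =
     (image Inl) ` (E - {{a, b}, {c, d}}) \<union> (image Inr) ` (del_verts_edges E' {x, y}) \<union>
     {{Inl a, Inr a'}, {Inl b, Inr b'}, {Inl c, Inr c'}, {Inl d, Inr d'}}"

definition plane_embedding ::
  "'v set \<Rightarrow> 'v set set \<Rightarrow> ('v \<Rightarrow> complex) \<Rightarrow> ('v set \<Rightarrow> real \<Rightarrow> complex) \<Rightarrow> bool" where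
  "plane_embedding V E pos \<gamma> \<longleftrightarrow> inj_on pos V \<and>
     (\<forall>e\<in>E. \<exists>u v. e = {u, v} \<and> arc (\<gamma> e) \<and> pathstart (\<gamma> e) = pos u \<and>
        pathfinish (\<gamma> e) = pos v \<and> path_image (\<gamma> e) \<inter> pos ` V = {pos u, pos v}) \<and>
     (\<forall>e1\<in>E. \<forall>e2\<in>E. e1 \<noteq> e2 \<longrightarrow>
        path_image (\<gamma> e1) \<inter> path_image (\<gamma> e2) = pos ` (e1 \<inter> e2))"

definition planar :: "'v set \<Rightarrow> 'v set set \<Rightarrow> bool" where
  "planar V E \<longleftrightarrow> (\<exists>pos \<gamma>. plane_embedding V E pos \<gamma>)"

definition drawing :: "'v set \<Rightarrow> 'v set set \<Rightarrow> ('v \<Rightarrow> complex) \<Rightarrow> ('v set \<Rightarrow> real \<Rightarrow> complex)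
     \<Rightarrow> complex set" where
  "drawing V E pos \<gamma> = pos ` V \<union> (\<Union>e\<in>E. path_image (\<gamma> e))"

definition faces :: "'v set \<Rightarrow> 'v set set \<Rightarrow> ('v \<Rightarrow> complex) \<Rightarrow> ('v set \<Rightarrow> real \<Rightarrow> complex)
     \<Rightarrow> complex set set" where
  "faces V E pos \<gamma> = components (- drawing V E pos \<gamma>)"

definition on_common_face ::
  "'v set \<Rightarrow> 'v set set \<Rightarrow> ('v \<Rightarrow> complex) \<Rightarrow> ('v set \<Rightarrow> real \<Rightarrow> complex) \<Rightarrow> 'v set \<Rightarrow> 'v set \<Rightarrow> bool" where
  "on_common_face V E pos \<gamma> e1 e2 \<longleftrightarrow> (\<exists>F\<in>faces V E pos \<gamma>.
     path_image (\<gamma> e1) \<subseteq> frontier F \<and> path_image (\<gamma> e2) \<subseteq> frontier F)"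

end

theory Submission
  imports Defs
begin

text \<open>
  A cycle of the dot product uses two or four of the edges \<open>aa'\<close>, \<open>bb'\<close>, \<open>cc'\<close>, \<open>dd'\<close>, so it splits
  into at most two paths on either side, and closing these up through \<open>ab\<close>, \<open>cd\<close> or through \<open>x\<close>,
  \<open>y\<close> gives a cycle of \<open>H\<close> or of \<open>H'\<close>; this settles non-hamiltonicity and girth. Conversely the good
  pairs are glued to pieces of hamiltonian cycles of the graphs \<open>H' - v\<close>.

  For planarity, consider in \<open>H\<close> the arcs \<open>ab\<close> and \<open>cd\<close>, and in \<open>H'\<close> the arcs \<open>a'xb'\<close> and \<open>c'yd'\<close>.
  In both drawings a homeomorphism of the plane moves the second arc, inside a face of the rest, so
  close to the first one that a round disc meets both arcs but nothing else. Cutting the arcs at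
  the disc leaves four legs ending on its boundary circle, those of the first arc not separated by
  those of the second. One drawing is inverted into a smaller concentric disc, and the legs are
  joined across the annulus by disjoint spirals, after choosing the labelling that makes the cyclic
  orders agree. No smoothness of the arcs is needed.
\<close>

section \<open>Paths and cycles as vertex lists\<close>

text \<open>Call \<open>a\<close>, \<open>b\<close>, \<open>c\<close>, \<open>d\<close> terminals,
  with hub \<open>x\<close> for the first two and hub \<open>y\<close> for the last two. Hubs alone
  decide how a cycle is closed: two terminals with the same hub are joined in \<open>H\<close> by
  \<open>ab\<close> or \<open>cd\<close>, and for two with different hubs the edge \<open>xy\<close>
  of \<open>H'\<close> joins the hubs. For the girth, a cycle meeting both sides is always closed on
  the side of \<open>H'\<close>: its run in \<open>H\<close> has at least two vertices and is
  exchanged for at most two hubs. That \<open>a'\<close>, \<open>b'\<close>, \<open>c'\<close>,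
  \<open>d'\<close> are four vertices has to be derived: hypohamiltonicity excludes a triangle on
  \<open>xy\<close>. In the planar part the obstacle is to know the cyclic order of the leg ends
  although an arc need not have a direction anywhere. Distances supply it: the disc touches the
  first arc in a single point, the legs of that arc end within \<epsilon> of this point, and the
  second arc keeps more than \<open>2 * \<epsilon>\<close> away from the first. In \<open>H\<close>
  the room for moving the second arc comes from the common face; in \<open>H'\<close> it comes from
  the edge \<open>xy\<close>, which is itself absent from the product.\<close>

definition walk :: "'v set set \<Rightarrow> 'v list \<Rightarrow> bool" where
  "walk E p \<longleftrightarrow> successively (\<lambda>u v. {u, v} \<in> E) p"

lemma walk_simps [simp]:
  "walk E []" "walk E [v]" "walk E (u # v # p) \<longleftrightarrow> {u, v} \<in> E \<and> walk E (v # p)"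
  by (simp_all add: walk_def)

lemma walk_append:
  "walk E (p @ q) \<longleftrightarrow> walk E p \<and> walk E q \<and> (p = [] \<or> q = [] \<or> {last p, hd q} \<in> E)"
  by (simp add: walk_def successively_append_iff)

lemma walk_Cons: "walk E (v # p) \<longleftrightarrow> p = [] \<or> {v, hd p} \<in> E \<and> walk E p"
  by (simp add: walk_def successively_Cons)

lemma walk_rev [simp]: "walk E (rev p) \<longleftrightarrow> walk E p"
  by (simp add: walk_def insert_commute)

lemma walk_transfer:
  assumes "walk E p" "\<And>u v. u \<in> set p \<Longrightarrow> v \<in> set p \<Longrightarrow> {u, v} \<in> E \<Longrightarrow> {u, v} \<in> E'"
  shows "walk E' p"
  using assms unfolding walk_def by (rule successively_mono)

lemma walk_map: "walk E (map f p) \<longleftrightarrow> successively (\<lambda>u v. {f u, f v} \<in> E) p"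
  by (simp add: walk_def successively_map)

text \<open>Trades the index condition of \<open>is_path\<close> for \<open>walk\<close>, which
  splits over append and is invariant under reversal; all later cutting and gluing relies on
  that.\<close>

lemma is_path_iff: "is_path V E p \<longleftrightarrow> p \<noteq> [] \<and> distinct p \<and> set p \<subseteq> V \<and> walk E p"
  by (simp add: is_path_def walk_def successively_conv_nth)

lemma is_cycle_iff:
  "is_cycle V E c \<longleftrightarrow> distinct c \<and> set c \<subseteq> V \<and> walk E c \<and> 3 \<le> length c \<and> {last c, hd c} \<in> E"
  by (auto simp: is_cycle_def is_path_iff)

lemma is_cycle_rotate: "is_cycle V E (p @ q) \<Longrightarrow> is_cycle V E (q @ p)"
  by (cases "p = []"; cases "q = []") (auto simp: is_cycle_iff walk_append)

lemma is_cycle_rev: "is_cycle V E p \<Longrightarrow> is_cycle V E (rev p)"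
  by (cases "p = []") (auto simp: is_cycle_iff hd_rev last_rev insert_commute)

text \<open>Singles out one vertex of a cycle: its two cycle neighbours are the ends of
  \<open>p\<close>. This is the form in which a hub is inserted or removed.\<close>

lemma is_cycle_Cons:
  "is_cycle V E (v # p) \<longleftrightarrow> v \<in> V \<and> v \<notin> set p \<and> distinct p \<and> set p \<subseteq> V \<and> walk E p \<and>
     2 \<le> length p \<and> {v, hd p} \<in> E \<and> {v, last p} \<in> E"
  by (cases "p = []") (auto simp: is_cycle_iff walk_Cons insert_commute)

lemma is_cycle_Cons_rev: "is_cycle V E (v # p) \<Longrightarrow> is_cycle V E (v # rev p)"
  by (cases "p = []") (auto simp: is_cycle_Cons hd_rev last_rev)

lemma is_cycle_start_at:
  assumes "is_cycle V E c" "v \<in> set c"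
  obtains p where "is_cycle V E (v # p)" "set (v # p) = set c"
proof -
  obtain q r where "c = q @ v # r"
    using assms(2) by (meson split_list)
  then show ?thesis
    using that[of "r @ q"] is_cycle_rotate[of V E q "v # r"] assms(1) by auto
qed

lemma distinct_hd_last: "distinct p \<Longrightarrow> 2 \<le> length p \<Longrightarrow> hd p \<noteq> last p"
  by (cases p) auto

section \<open>Vertex deletion, girth and neighbourhoods\<close>

text \<open>Edges of a cycle that avoids \<open>t\<close> survive the deletion of \<open>t\<close>,
  so hamiltonian cycles of vertex-deleted graphs can be treated as cycles of the original edge
  set.\<close>

lemma hamiltonian_del_vertex:
  "hamiltonian (V - {t}) (del_verts_edges E {t}) \<longleftrightarrow> (\<exists>c. is_cycle V E c \<and> set c = V - {t})"
proof
  assume "hamiltonian (V - {t}) (del_verts_edges E {t})"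
  then obtain c where c: "is_cycle (V - {t}) (del_verts_edges E {t}) c" "set c = V - {t}"
    unfolding hamiltonian_def by blast
  then have "is_cycle V E c"
    unfolding is_cycle_iff del_verts_edges_def using walk_transfer by blast
  then show "\<exists>c. is_cycle V E c \<and> set c = V - {t}"
    using c(2) by blast
next
  assume "\<exists>c. is_cycle V E c \<and> set c = V - {t}"
  then obtain c where c: "is_cycle V E c" "set c = V - {t}" by blast
  have "walk (del_verts_edges E {t}) c"
    by (rule walk_transfer[of E]) (use c in \<open>auto simp: is_cycle_iff del_verts_edges_def\<close>)
  moreover have "last c \<in> set c" "hd c \<in> set c"
    using c(1) unfolding is_cycle_iff by (cases c; auto)+
  ultimately have "is_cycle (V - {t}) (del_verts_edges E {t}) c"
    using c by (auto simp: is_cycle_iff del_verts_edges_def)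
  then show "hamiltonian (V - {t}) (del_verts_edges E {t})"
    using c(2) unfolding hamiltonian_def by blast
qed

lemma finite_cycle_lengths:
  assumes "finite V"
  shows "finite {length c | c. is_cycle V E c}"
proof (rule finite_subset)
  show "{length c | c. is_cycle V E c} \<subseteq> {..card V}"
    using assms by (auto simp: is_cycle_iff) (metis card_mono distinct_card)
qed simp

lemma girth_le: "finite V \<Longrightarrow> is_cycle V E c \<Longrightarrow> girth V E \<le> length c"
  unfolding girth_def by (rule Min_le) (use finite_cycle_lengths in auto)

text \<open>\<open>Min\<close> says nothing about an empty set, so an actual cycle has to be
  exhibited before a lower bound for all cycles bounds the girth.\<close>

lemma girth_ge:
  assumes "finite V" "is_cycle V E c" "\<And>c. is_cycle V E c \<Longrightarrow> k \<le> length c"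
  shows "k \<le> girth V E"
  unfolding girth_def using assms finite_cycle_lengths[OF assms(1), of E] by (subst Min_ge_iff) auto

lemma graph_no_loop: "graph V E \<Longrightarrow> {v, v} \<notin> E"
  unfolding graph_def by (auto simp: doubleton_eq_iff)

lemma graph_edge_vertices: "graph V E \<Longrightarrow> {u, v} \<in> E \<Longrightarrow> u \<in> V \<and> v \<in> V"
  unfolding graph_def by (fastforce simp: doubleton_eq_iff)

lemma degree_eq_card_neighbours:
  assumes "graph V E"
  shows "degree E v = card (neighbours E v)"
proof -
  have "bij_betw (\<lambda>u. {v, u}) (neighbours E v) {e \<in> E. v \<in> e}"
  proof (rule bij_betw_imageI)
    show "inj_on (\<lambda>u. {v, u}) (neighbours E v)"
      by (auto simp: inj_on_def doubleton_eq_iff)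
    show "(\<lambda>u. {v, u}) ` neighbours E v = {e \<in> E. v \<in> e}"
    proof (intro equalityI subsetI)
      fix e assume e: "e \<in> {e \<in> E. v \<in> e}"
      then obtain s t where "e = {s, t}"
        using assms unfolding graph_def by blast
      then have "e = {v, s} \<or> e = {v, t}" using e by auto
      then show "e \<in> (\<lambda>u. {v, u}) ` neighbours E v"
        using e by (auto simp: neighbours_def)
    qed (auto simp: neighbours_def)
  qed
  then show ?thesis
    unfolding degree_def by (metis bij_betw_same_card)
qed

lemma finite_neighbours:
  assumes "graph V E"
  shows "finite (neighbours E v)"
proof (rule finite_subset)
  show "neighbours E v \<subseteq> V"
    using graph_edge_vertices[OF assms, of v] by (auto simp: neighbours_def)
  show "finite V"
    using assms by (simp add: graph_def)
qed

text \<open>A hamiltonian cycle of the graph without \<open>x\<close> uses the edge \<open>yt\<close>, and \<open>x\<close> could be inserted there.\<close>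

lemma hypohamiltonian_no_triangle:
  assumes hypo: "hypohamiltonian V E" and "graph V E" and "{x, y} \<in> E" "{x, t} \<in> E"
    and ny: "\<And>v. {y, v} \<in> E \<Longrightarrow> v \<in> {x, t, z}"
  shows False
proof -
  have xV: "x \<in> V" "y \<in> V" "x \<noteq> y"
    using assms(2,3) graph_edge_vertices graph_no_loop by metis+
  then obtain c where c: "is_cycle V E c" "set c = V - {x}"
    using hypo hamiltonian_del_vertex[of V x E] unfolding hypohamiltonian_def by blast
  then obtain p where p: "is_cycle V E (y # p)" "set (y # p) = V - {x}"
    using xV by (metis DiffI is_cycle_start_at singletonD)
  have insert_x: False if q: "is_cycle V E (y # q)" "set (y # q) = V - {x}" "hd q = t" for q
  proof -
    have "is_cycle V E (y # x # q)"
      using q assms(3,4) xV by (cases q) (auto simp: is_cycle_Cons walk_Cons insert_commute)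
    moreover have "set (y # x # q) = V"
      using q(2) xV by auto
    ultimately show False
      using hypo unfolding hypohamiltonian_def hamiltonian_def by blast
  qed
  have len: "distinct p" "2 \<le> length p" "{y, hd p} \<in> E" "{y, last p} \<in> E"
    using p(1) unfolding is_cycle_Cons by auto
  then have "hd p \<in> set p" "last p \<in> set p" by (cases p; simp)+
  then have "hd p \<noteq> x" "last p \<noteq> x" using p(2) by auto
  \<comment> \<open>Without \<open>x\<close>, only \<open>t\<close> and \<open>z\<close> are left as
    neighbours of \<open>y\<close>; its two cycle neighbours are distinct, so one of them is
    \<open>t\<close>.\<close>
  then have "hd p \<in> {t, z}" "last p \<in> {t, z}" using ny len by auto
  then have "hd p = t \<or> last p = t"
    using distinct_hd_last[OF len(1,2)] by auto
  then show False
    using insert_x[of p] insert_x[of "rev p"] p is_cycle_Cons_rev[OF p(1)] by (auto simp: hd_rev)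
qed

section \<open>Cutting a cycle over a disjoint sum into runs\<close>

text \<open>\<open>L\<close> and \<open>R\<close> are the maximal first runs on either side. What is
  known about \<open>rest\<close> has the shape of the assumptions, so a nonempty
  \<open>rest\<close> can be split again.\<close>

lemma list_split_sum:
  assumes "xs \<noteq> []" "isl (hd xs)" "\<not> isl (last xs)"
  obtains L R rest where "xs = map Inl L @ map Inr R @ rest" "L \<noteq> []" "R \<noteq> []"
    "rest = [] \<or> isl (hd rest) \<and> \<not> isl (last rest)"
proof -
  define A where "A = takeWhile isl xs"
  define B where "B = dropWhile isl xs"
  define C where "C = takeWhile (\<lambda>z. \<not> isl z) B"
  define D where "D = dropWhile (\<lambda>z. \<not> isl z) B"
  have split: "xs = A @ B" "B = C @ D"
    by (simp_all add: A_def B_def C_def D_def)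
  have "A \<noteq> []"
    using assms by (cases xs) (auto simp: A_def)
  have "B \<noteq> []"
    using assms by (auto simp: B_def dropWhile_eq_Nil_conv)
  then have "\<not> isl (hd B)"
    unfolding B_def by (rule hd_dropWhile)
  then have "C \<noteq> []"
    using \<open>B \<noteq> []\<close> by (cases B) (auto simp: C_def)
  have "\<forall>z\<in>set A. isl z" "\<forall>z\<in>set C. \<not> isl z"
    by (auto simp: A_def C_def dest: set_takeWhileD)
  then have "A = map Inl (map projl A)" "C = map Inr (map projr C)"
    by (simp_all add: map_idI sum.collapse)
  moreover have "D = [] \<or> isl (hd D) \<and> \<not> isl (last D)"
  proof (cases "D = []")
    case False
    then have "isl (hd D)"
      using hd_dropWhile[of "\<lambda>z. \<not> isl z" B] by (auto simp: D_def)
    moreover have "last D = last xs"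
      using False by (simp add: split)
    ultimately show ?thesis using assms(3) by simp
  qed simp
  ultimately show ?thesis
    using that[of "map projl A" "map projr C" D] split \<open>A \<noteq> []\<close> \<open>C \<noteq> []\<close> by (metis append.assoc map_is_Nil_conv)
qed

text \<open>Rotated to start at a left vertex, the cycle is \<open>A @ B\<close> with
  \<open>A\<close> a left run and \<open>B\<close> starting on the right. Exchanging the two puts
  the cut at this crossing, and reversal brings the left vertex to the front.\<close>

lemma is_cycle_split_sum:
  assumes "is_cycle V E c" "Inl u \<in> set c" "Inr w \<in> set c"
  obtains c' where "is_cycle V E c'" "set c' = set c" "length c' = length c" "isl (hd c')" "\<not> isl (last c')"
proof -
  obtain q r where qr: "c = q @ Inl u # r"
    using assms(2) by (meson split_list)
  define xs where "xs = Inl u # r @ q"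
  have xs: "is_cycle V E xs" "set xs = set c" "length xs = length c"
    using is_cycle_rotate[of V E q "Inl u # r"] assms(1) by (auto simp: xs_def qr)
  define A where "A = takeWhile isl xs"
  define B where "B = dropWhile isl xs"
  have AB: "xs = A @ B" by (simp add: A_def B_def)
  have "A \<noteq> []" by (simp add: A_def xs_def)
  have "\<exists>z\<in>set xs. \<not> isl z"
    using assms(3) unfolding xs(2) by (rule bexI[rotated]) simp
  then have "B \<noteq> []"
    by (auto simp: B_def dropWhile_eq_Nil_conv)
  have "\<not> isl (hd B)"
    using \<open>B \<noteq> []\<close> unfolding B_def by (rule hd_dropWhile)
  moreover have "isl (last A)"
    using \<open>A \<noteq> []\<close> unfolding A_def by (meson last_in_set set_takeWhileD)
  moreover have "hd (rev (B @ A)) = last A" "last (rev (B @ A)) = hd B"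
    using \<open>A \<noteq> []\<close> \<open>B \<noteq> []\<close> by (simp_all add: hd_rev last_rev del: rev_append)
  moreover have "is_cycle V E (rev (B @ A))"
    by (rule is_cycle_rev[OF is_cycle_rotate[OF xs(1)[unfolded AB]]])
  moreover have "set (rev (B @ A)) = set c" "length (rev (B @ A)) = length c"
    unfolding xs(2,3)[symmetric] AB by auto
  ultimately show ?thesis
    using that[of "rev (B @ A)"] by metis
qed

section \<open>Cycles in the dot product\<close>

lemma hd_neq_last_length: "p \<noteq> [] \<Longrightarrow> hd p \<noteq> last p \<Longrightarrow> 2 \<le> length p"
  by (induction p) (auto simp: Suc_le_eq)

text \<open>The equivalences list the full neighbourhoods of \<open>x\<close> and \<open>y\<close>.
  The distinctness of the six vertices of \<open>H'\<close> contains the absence of a triangle on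
  \<open>xy\<close>.\<close>

locale dot_product =
  fixes V :: "'a set" and E and V' :: "'b set" and E' and a b c d :: 'a and x y a' b' c' d' :: 'b
  assumes G: "graph V E" and G': "graph V' E'"
    and ab: "{a, b} \<in> E" and cd: "{c, d} \<in> E" and abcd: "distinct [a, b, c, d]"
    and nbr_x: "\<And>v. {x, v} \<in> E' \<longleftrightarrow> v \<in> {y, a', b'}"
    and nbr_y: "\<And>v. {y, v} \<in> E' \<longleftrightarrow> v \<in> {x, c', d'}"
    and abcd': "distinct [a', b', c', d', x, y]"
begin

abbreviation "J \<equiv> E - {{a, b}, {c, d}}"
abbreviation "J' \<equiv> del_verts_edges E' {x, y}"
abbreviation "D \<equiv> dot_edges E E' a b c d x y a' b' c' d'"
abbreviation "DV \<equiv> dot_verts V V' x y"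
abbreviation "S \<equiv> {a, b, c, d}"

text \<open>The default \<open>d'\<close> off \<open>S\<close> is harmless: \<open>partner\<close>
  is applied to terminals only.\<close>

definition "partner v = (if v = a then a' else if v = b then b' else if v = c then c' else d')"
text \<open>The deleted vertex of \<open>H'\<close> to which \<open>partner v\<close> was attached.
  Two distinct terminals share a hub exactly when they are the ends of one removed edge of
  \<open>H\<close>.\<close>

definition "hub v = (if v = a \<or> v = b then x else y)"

lemma partner_simps [simp]: "partner a = a'" "partner b = b'" "partner c = c'" "partner d = d'"
  and hub_simps [simp]: "hub a = x" "hub b = x" "hub c = y" "hub d = y"
  using abcd by (auto simp: partner_def hub_def)

lemma S_subset: "S \<subseteq> V"
  using graph_edge_vertices[OF G ab] graph_edge_vertices[OF G cd] by auto

lemma V'_mem: "x \<in> V'" "y \<in> V'" "v \<in> S \<Longrightarrow> partner v \<in> V' - {x, y}"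
proof -
  have *: "{x, y} \<in> E'" "{x, a'} \<in> E'" "{x, b'} \<in> E'" "{y, c'} \<in> E'" "{y, d'} \<in> E'"
    by (simp_all add: nbr_x nbr_y)
  show "x \<in> V'" "y \<in> V'"
    using graph_edge_vertices[OF G' *(1)] by auto
  show "v \<in> S \<Longrightarrow> partner v \<in> V' - {x, y}"
    using *[THEN graph_edge_vertices[OF G']] abcd' by auto
qed

lemma partner_inj: "u \<in> S \<Longrightarrow> v \<in> S \<Longrightarrow> partner u = partner v \<Longrightarrow> u = v"
  using abcd' by auto

lemma hub_partner: "v \<in> S \<Longrightarrow> {hub v, partner v} \<in> E'"
  by (auto simp: nbr_x nbr_y)

lemma hub_neq: "hub u \<noteq> hub v \<Longrightarrow> {hub u, hub v} = {x, y}"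
  by (auto simp: hub_def)

lemma same_hub_edge: "u \<in> S \<Longrightarrow> v \<in> S \<Longrightarrow> u \<noteq> v \<Longrightarrow> hub u = hub v \<Longrightarrow> {u, v} \<in> {{a, b}, {c, d}}"
  using abcd' by auto

lemma xy_edge: "{x, y} \<in> E'"
  by (simp add: nbr_x)

lemma D_Inl: "{Inl u, Inl v} \<in> D \<longleftrightarrow> {u, v} \<in> J"
proof -
  have *: "{Inl u, Inl v} = Inl ` e \<longleftrightarrow> {u, v} = e" for e :: "'a set"
    using inj_image_eq_iff[OF inj_Inl, of "{u, v}" e] by simp
  have "{Inl u, Inl v} \<in> image Inl ` J \<longleftrightarrow> {u, v} \<in> J"
    unfolding image_iff * by simp
  moreover have "{Inl u, Inl v} \<noteq> Inr ` e" for e :: "'b set"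
    by blast
  then have "{Inl u, Inl v} \<notin> image Inr ` A" for A :: "'b set set"
    by (simp add: image_iff)
  moreover have "{Inl u, Inl v} \<noteq> {Inl s, Inr t}" for s :: 'a and t :: 'b
    by blast
  ultimately show ?thesis
    unfolding dot_edges_def by simp
qed

lemma D_Inr: "{Inr u, Inr v} \<in> D \<longleftrightarrow> {u, v} \<in> J'"
proof -
  have *: "{Inr u, Inr v} = Inr ` e \<longleftrightarrow> {u, v} = e" for e :: "'b set"
    using inj_image_eq_iff[OF inj_Inr, of "{u, v}" e] by simp
  have "{Inr u, Inr v} \<in> image Inr ` J' \<longleftrightarrow> {u, v} \<in> J'"
    unfolding image_iff * by simp
  moreover have "{Inr u, Inr v} \<noteq> Inl ` e" for e :: "'a set"
    by blast
  then have "{Inr u, Inr v} \<notin> image Inl ` A" for A :: "'a set set"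
    by (simp add: image_iff)
  moreover have "{Inr u, Inr v} \<noteq> {Inl s, Inr t}" for s :: 'a and t :: 'b
    by blast
  ultimately show ?thesis
    unfolding dot_edges_def by simp
qed

lemma D_cross: "{Inl u, Inr w} \<in> D \<longleftrightarrow> u \<in> S \<and> w = partner u"
proof -
  have "{Inl u, Inr w} \<noteq> Inl ` e" for e :: "'a set" by blast
  moreover have "{Inl u, Inr w} \<noteq> Inr ` e" for e :: "'b set" by blast
  ultimately show ?thesis
    unfolding dot_edges_def by (auto simp: doubleton_eq_iff image_iff)
qed

lemma D_cross': "{Inr w, Inl u} \<in> D \<longleftrightarrow> u \<in> S \<and> w = partner u"
  using D_cross by (simp only: insert_commute)

lemma walk_Inl: "walk D (map Inl p) \<longleftrightarrow> walk J p" and walk_Inr: "walk D (map Inr q) \<longleftrightarrow> walk J' q"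
  unfolding walk_map D_Inl D_Inr by (simp_all add: walk_def)

lemma J'_walk: "walk E' q \<Longrightarrow> x \<notin> set q \<Longrightarrow> y \<notin> set q \<Longrightarrow> walk J' q"
  by (erule walk_transfer) (auto simp: del_verts_edges_def)

lemma walk_J: "walk J p \<Longrightarrow> walk E p" and walk_J': "walk J' q \<Longrightarrow> walk E' q"
  by (erule walk_transfer, auto simp: del_verts_edges_def)+

section \<open>From a cycle of the dot product back to the factors\<close>

text \<open>Reads off the crossing edges around the first two runs: the cycle enters
  \<open>L\<close> at \<open>u\<close>, leaves it at \<open>w\<close>, and leaves \<open>R\<close>
  towards \<open>v\<close>, where the next left run starts. If there is no further run, this is
  \<open>L\<close> again and \<open>v\<close> equals \<open>u\<close>.\<close>

lemma cross_runs:
  assumes c: "is_cycle DV D (map Inl L @ map Inr R @ rest)" and ne: "L \<noteq> []" "R \<noteq> []"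
    and rest: "rest = [] \<or> isl (hd rest) \<and> \<not> isl (last rest)"
  obtains u w v where "{u, w, v} \<subseteq> S" "u \<noteq> w" "w \<noteq> v" "hd L = u" "last L = w" "hd R = partner w" "last R = partner v"
    "rest = [] \<Longrightarrow> u = v" "rest \<noteq> [] \<Longrightarrow> u \<noteq> v \<and> hd rest = Inl v \<and> last rest = Inr (partner u)"
    "distinct L" "distinct R" "walk J L" "walk J' R" "set L \<subseteq> V" "set R \<subseteq> V' - {x, y}"
proof -
  have dist: "distinct (map Inl L @ map Inr R @ rest)" and sub: "set (map Inl L @ map Inr R @ rest) \<subseteq> DV"
    and wk: "walk D (map Inl L @ map Inr R @ rest)" and len: "3 \<le> length (map Inl L @ map Inr R @ rest)"
    and close: "{last (map Inl L @ map Inr R @ rest), hd (map Inl L @ map Inr R @ rest)} \<in> D"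
    using c unfolding is_cycle_iff by blast+
  have wk': "walk D (map Inl L)" "walk D (map Inr R)" "walk D rest" "{Inl (last L), Inr (hd R)} \<in> D"
    "rest = [] \<or> {Inr (last R), hd rest} \<in> D"
    using wk ne by (auto simp: walk_append hd_append hd_map last_map)
  define u w where "u = hd L" and "w = last L"
  have hL: "hd L = u" "last L = w" by (simp_all add: u_def w_def)
  have w: "w \<in> S" "hd R = partner w"
    using wk'(4) unfolding D_cross w_def by auto
  have props: "distinct L" "distinct R" "walk J L" "walk J' R" "set L \<subseteq> V" "set R \<subseteq> V' - {x, y}"
    using dist sub wk'(1,2) unfolding walk_Inl walk_Inr
    by (auto simp: distinct_map dot_verts_def)
  have ends: "hd L \<in> set L" "last L \<in> set L" "hd R \<in> set R" "last R \<in> set R"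
    using ne by auto
  show ?thesis
  proof (cases "rest = []")
    case True
    then have "{Inr (last R), Inl u} \<in> D"
      using close ne by (simp add: last_map hd_append hd_map u_def)
    then have u: "u \<in> S" "last R = partner u"
      unfolding D_cross' by auto
    \<comment> \<open>Otherwise both runs are single vertices and the cycle has length two.\<close>
    have "u \<noteq> w"
    proof
      assume "u = w"
      then have "hd L = last L" "hd R = last R"
        using u w by (auto simp: u_def w_def)
      then have "\<not> 2 \<le> length L" "\<not> 2 \<le> length R"
        using distinct_hd_last props(1,2) by blast+
      then show False using len True by simp
    qed
    then show ?thesis
      by (intro that[of u w u]) (use u w props True hL in simp_all)
  next
    case False
    then obtain v s where v: "hd rest = Inl v" and s: "last rest = Inr s"
      using rest by (metis isl_def sum.exhaust_sel)
    have "{Inr (last R), Inl v} \<in> D" "{Inr s, Inl u} \<in> D"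
      using wk'(5) close False ne v s by (simp_all add: hd_append hd_map u_def)
    then have uv: "u \<in> S" "s = partner u" "v \<in> S" "last R = partner v"
      unfolding D_cross' by auto
    have mem: "Inl v \<in> set rest" "Inr s \<in> set rest"
      using False v s by (metis hd_in_set, metis last_in_set)
    \<comment> \<open>\<open>v\<close> starts a later left run, so it differs from the ends
      \<open>u\<close>, \<open>w\<close> of \<open>L\<close>; \<open>partner u\<close> ends a later
      right run, so it differs from \<open>partner w\<close>, the head of \<open>R\<close>.\<close>
    then have "v \<notin> set L" "s \<notin> set R"
      using dist by auto
    then have "v \<noteq> w" "v \<noteq> u" "u \<noteq> w"
      using ends w(2) uv(2) by (auto simp: u_def w_def)
    then show ?thesis
      by (intro that[of u w v]) (use uv w props False v s hL in simp_all)
  qed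
qed

text \<open>Four distinct terminals are all of \<open>S\<close>, two for each hub.\<close>

lemma same_hub_sides:
  assumes "{u, w, v, t} \<subseteq> S" "distinct [u, w, v, t]"
  shows "hub u = hub w \<Longrightarrow> hub v = hub t \<and> hub v \<noteq> hub u"
    "hub u \<noteq> hub w \<Longrightarrow> hub v = hub u \<and> hub t = hub w \<or> hub v = hub w \<and> hub t = hub u"
  using assms abcd' by (auto simp: hub_def)

text \<open>With two crossings, equal hubs of \<open>u\<close> and \<open>w\<close> close the run
  \<open>L\<close> in \<open>H\<close>, and different hubs close the run \<open>R\<close> in
  \<open>H'\<close>. With four crossings it is the other way round: equal hubs at the ends of
  \<open>L\<close> close both right runs in \<open>H'\<close>, and different hubs close both left
  runs in \<open>H\<close>.\<close>

lemma not_hamiltonian: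
  assumes H: "\<not> hamiltonian V E" "3 \<le> card V" and H': "\<not> hamiltonian V' E'" "3 \<le> card V'"
  shows "\<not> hamiltonian DV D"
proof
  assume "hamiltonian DV D"
  then obtain c0 where c0: "is_cycle DV D c0" "set c0 = DV"
    unfolding hamiltonian_def by blast
  have no: "\<not> is_cycle V E p" if "set p = V" for p
    using H(1) that unfolding hamiltonian_def by blast
  have no': "\<not> is_cycle V' E' p" if "set p = V'" for p
    using H'(1) that unfolding hamiltonian_def by blast
  have "Inl a \<in> set c0" "Inr a' \<in> set c0"
    using S_subset V'_mem(3)[of a] unfolding c0(2) dot_verts_def by auto
  then obtain c1 where c1: "is_cycle DV D c1" "set c1 = DV" "isl (hd c1)" "\<not> isl (last c1)"
    using is_cycle_split_sum[OF c0(1)] c0(2) by metis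
  then have "c1 \<noteq> []" by (auto simp: is_cycle_iff)
  then obtain L R rest where c1_eq: "c1 = map Inl L @ map Inr R @ rest" and ne: "L \<noteq> []" "R \<noteq> []"
    and rest: "rest = [] \<or> isl (hd rest) \<and> \<not> isl (last rest)"
    using list_split_sum c1(3,4) by metis
  obtain u w v where u: "{u, w, v} \<subseteq> S" "u \<noteq> w" "w \<noteq> v" "hd L = u" "last L = w" "hd R = partner w" "last R = partner v"
    "rest = [] \<Longrightarrow> u = v" "rest \<noteq> [] \<Longrightarrow> u \<noteq> v \<and> hd rest = Inl v \<and> last rest = Inr (partner u)"
    "distinct L" "distinct R" "walk J L" "walk J' R" "set L \<subseteq> V" "set R \<subseteq> V' - {x, y}"
    by (rule cross_runs[OF c1(1)[unfolded c1_eq] ne rest]) blast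
  show False
  proof (cases "rest = []")
    case True
    have "Inl ` set L \<union> Inr ` set R = Inl ` V \<union> Inr ` (V' - {x, y})"
      using c1(2) True unfolding c1_eq dot_verts_def by simp
    then have sets: "set L = V" "set R = V' - {x, y}"
      by (auto simp: set_eq_iff)
    have "u = v" using u(8) True by simp
    show False
    proof (cases "hub u = hub w")
      case same: True
      then have "{w, u} \<in> E"
        using same_hub_edge[of w u] u(1,2) ab cd by auto
      moreover have "3 \<le> length L"
        using H(2) sets(1) u(10) by (metis distinct_card)
      ultimately have "is_cycle V E L"
        using u sets walk_J by (auto simp: is_cycle_iff)
      then show False using no sets by blast
    next
      case False
      then have xy: "{hub u, hub w} = {x, y}" by (rule hub_neq)
      have "set (R @ [hub u, hub w]) = V'"
        using sets(2) xy V'_mem(1,2) by auto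
      moreover have "is_cycle V' E' (R @ [hub u, hub w])"
      proof -
        have "distinct (R @ [hub u, hub w])"
          using u(11,15) xy False by auto
        moreover have "walk E' (R @ [hub u, hub w])"
          using walk_J'[OF u(13)] hub_partner[of u] u(1,7) \<open>u = v\<close> xy xy_edge
          by (auto simp: walk_append insert_commute)
        moreover have "{hub w, hd R} \<in> E'"
          using hub_partner[of w] u(1,6) by auto
        moreover have "3 \<le> length (R @ [hub u, hub w])"
          using ne(2) by (cases R) auto
        ultimately show ?thesis
          using ne(2) \<open>set (R @ _) = V'\<close> by (auto simp: is_cycle_iff)
      qed
      ultimately show False using no' by blast
    qed
  next
    case False
    then have uv: "u \<noteq> v" "hd rest = Inl v" "last rest = Inr (partner u)" using u(9) by auto
    then obtain L2 R2 rest2 where rest_eq: "rest = map Inl L2 @ map Inr R2 @ rest2" and ne2: "L2 \<noteq> []" "R2 \<noteq> []"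
      and rest2: "rest2 = [] \<or> isl (hd rest2) \<and> \<not> isl (last rest2)"
      using list_split_sum[OF False, of thesis] rest False by blast
    \<comment> \<open>The runs already split off move to the end, so that \<open>cross_runs\<close>
      sees the second pair of runs as the first one.\<close>
    define rest3 where "rest3 = rest2 @ map Inl L @ map Inr R"
    have cyc2: "is_cycle DV D (map Inl L2 @ map Inr R2 @ rest3)"
      using is_cycle_rotate[of DV D "map Inl L @ map Inr R" "map Inl L2 @ map Inr R2 @ rest2"] c1(1)
      unfolding c1_eq rest_eq rest3_def by simp
    have ne3: "rest3 \<noteq> []" using ne by (simp add: rest3_def)
    have rest3: "rest3 = [] \<or> isl (hd rest3) \<and> \<not> isl (last rest3)"
      using rest2 ne by (cases "rest2 = []") (auto simp: rest3_def hd_append hd_map last_map)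
    obtain v1 w2 v2 where u2: "{v1, w2, v2} \<subseteq> S" "v1 \<noteq> w2" "w2 \<noteq> v2" "hd L2 = v1" "last L2 = w2" "hd R2 = partner w2"
      "last R2 = partner v2" "rest3 \<noteq> [] \<Longrightarrow> v1 \<noteq> v2 \<and> hd rest3 = Inl v2 \<and> last rest3 = Inr (partner v1)"
      "distinct L2" "distinct R2" "walk J L2" "walk J' R2" "set L2 \<subseteq> V" "set R2 \<subseteq> V' - {x, y}"
      by (rule cross_runs[OF cyc2 ne2 rest3]) blast
    have "v1 = v"
      using uv(2) u2(4) ne2 by (simp add: rest_eq hd_map)
    have dist: "distinct (map Inl L @ map Inr R @ map Inl L2 @ map Inr R2 @ rest2)"
      using c1(1) unfolding c1_eq rest_eq is_cycle_iff by blast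
    have mem: "u \<in> set L" "w \<in> set L" "v \<in> set L2" "w2 \<in> set L2"
      using u(4,5) u2(4,5) \<open>v1 = v\<close> ne(1) ne2(1) by (metis hd_in_set last_in_set)+
    then have four: "distinct [u, w, v, w2]"
      using dist u(2) u2(2) \<open>v1 = v\<close> by auto
    \<comment> \<open>A third left run would have to start at a fifth terminal.\<close>
    have "rest2 = []"
    proof (rule ccontr)
      assume r2: "rest2 \<noteq> []"
      then have "hd rest2 = Inl v2"
        using u2(8)[OF ne3] by (simp add: rest3_def hd_append)
      then have "v2 \<notin> set L" "v2 \<notin> set L2"
        using dist r2 hd_in_set[OF r2] by auto
      then have "v2 \<notin> {u, w, v, w2}" using mem by auto
      moreover have "card {u, w, v, w2} = 4" using four by simp
      then have "{u, w, v, w2} = S"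
        using u(1) u2(1) abcd by (intro card_subset_eq) auto
      ultimately show False using u2(1) by blast
    qed
    then have "v2 = u"
      using u2(8)[OF ne3] u(4) ne(1) by (simp add: rest3_def hd_append hd_map)
    have all: "set c1 = Inl ` (set L \<union> set L2) \<union> Inr ` (set R \<union> set R2)"
      unfolding c1_eq rest_eq \<open>rest2 = []\<close> by auto
    have sets: "set L \<union> set L2 = V" "set R \<union> set R2 = V' - {x, y}"
    proof -
      have "set L \<union> set L2 = Inl -` set c1" "set R \<union> set R2 = Inr -` set c1"
        unfolding all by auto
      moreover have "Inl -` DV = V" "Inr -` DV = V' - {x, y}"
        unfolding dot_verts_def by auto
      ultimately show "set L \<union> set L2 = V" "set R \<union> set R2 = V' - {x, y}"
        unfolding c1(2) by simp_all
    qed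
    have disj: "set L \<inter> set L2 = {}" "set R \<inter> set R2 = {}"
      using dist by auto
    have fourS: "{u, w, v, w2} \<subseteq> S" using u(1) u2(1) by blast
    then have memS: "u \<in> S" "w \<in> S" "v \<in> S" "w2 \<in> S" by blast+
    show False
    proof (cases "hub u = hub w")
      case True
      then have hubs: "hub v = hub w2" "hub v \<noteq> hub u"
        using same_hub_sides(1)[OF fourS four True] by blast+
      then have xy: "{hub v, hub u} = {x, y}" by (intro hub_neq)
      \<comment> \<open>\<open>R\<close> leads from a neighbour of \<open>hub u\<close> to a
        neighbour of \<open>hub v\<close>, and \<open>R2\<close> leads back; one hub fits at each
        junction.\<close>
      let ?c = "R @ hub v # R2 @ [hub u]"
      have "set ?c = {hub v, hub u} \<union> (set R \<union> set R2)" by auto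
      then have set: "set ?c = V'"
        unfolding xy sets(2) using V'_mem(1,2) by auto
      have out: "hub v \<notin> set R \<union> set R2" "hub u \<notin> set R \<union> set R2"
        unfolding sets(2) using xy by auto
      have "{hub v, partner v} \<in> E'" "{hub v, partner w2} \<in> E'" "{hub u, partner u} \<in> E'" "{hub u, partner w} \<in> E'"
        using memS[THEN hub_partner] hubs(1) True by simp_all
      then have "walk E' ?c" "{last ?c, hd ?c} \<in> E'"
        using walk_J'[OF u(13)] walk_J'[OF u2(12)] u(6,7) u2(6,7) ne ne2 \<open>v2 = u\<close>
        by (auto simp: walk_append walk_Cons insert_commute hd_append)
      moreover have "distinct ?c"
        using out u(11) u2(10) disj(2) hubs(2) by auto
      moreover have "3 \<le> length ?c"
        using ne(2) ne2(2) by (cases R; cases R2) auto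
      ultimately show False
        using no'[OF set] set by (auto simp: is_cycle_iff)
    next
      case False
      \<comment> \<open>Each of \<open>L\<close>, \<open>L2\<close> now has ends with different
        hubs, so \<open>ab\<close> and \<open>cd\<close> join the two runs into one cycle, after
        reversing \<open>L2\<close> if necessary.\<close>
      note sides = same_hub_sides(2)[OF fourS four False]
      have edge: "{s, t} \<in> E" if "s \<in> S" "t \<in> S" "s \<noteq> t" "hub s = hub t" for s t
        using same_hub_edge[OF that] ab cd by auto
      have walks: "walk E L" "walk E L2" using walk_J u(12) u2(11) by auto
      have "3 \<le> card (set L \<union> set L2)" using H(2) sets(1) by simp
      then have len: "3 \<le> length L + length L2"
        using card_Un_le[of "set L" "set L2"] card_length[of L] card_length[of L2] by linarith
      show False
      proof (cases "hub v = hub w")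
        case True
        then have "hub w2 = hub u"
          using sides False by metis
        then have "{w, v} \<in> E" "{w2, u} \<in> E"
          using edge[OF memS(2,3)] edge[OF memS(4,1)] True four by auto
        then have "is_cycle V E (L @ L2)"
          using u(4,5,10) u2(4,5,9) \<open>v1 = v\<close> walks ne ne2 sets disj len by (auto simp: is_cycle_iff walk_append)
        then show False using no[of "L @ L2"] sets by simp
      next
        case f: False
        then have "hub w2 = hub w" "hub v = hub u"
          using sides by metis+
        then have "{w, w2} \<in> E" "{v, u} \<in> E"
          using edge[OF memS(2,4)] edge[OF memS(3,1)] four by auto
        then have "is_cycle V E (L @ rev L2)"
          using u(4,5,10) u2(4,5,9) \<open>v1 = v\<close> walks ne ne2 sets disj len
          by (auto simp: is_cycle_iff walk_append hd_rev last_rev)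
        then show False using no[of "L @ rev L2"] sets by simp
      qed
    qed
  qed
qed

text \<open>A cycle inside one side is a cycle of that factor. For a mixed cycle only its first two
  runs are kept: \<open>R\<close> is closed through \<open>hub v\<close> and \<open>hub w\<close>,
  at most two vertices, and these are paid for by \<open>L\<close>, which has two different
  ends.\<close>

lemma girth_bound:
  assumes "is_cycle DV D c0"
  shows "min (girth V E) (girth V' E') \<le> length c0"
proof -
  have fin: "finite V" "finite V'" using G G' by (simp_all add: graph_def)
  consider (l) "\<forall>z\<in>set c0. isl z" | (r) "\<forall>z\<in>set c0. \<not> isl z" | (m) u w where "Inl u \<in> set c0" "Inr w \<in> set c0"
    by (metis isl_def sum.exhaust_sel)
  then show ?thesis
  proof cases
    case l
    then have "\<forall>z\<in>set c0. \<exists>v. z = Inl v"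
      by (metis isl_def sum.exhaust_sel)
    then obtain p where c: "c0 = map Inl p"
      unfolding ex_map_conv[symmetric] by blast
    have "p \<noteq> []" using assms unfolding c is_cycle_iff by auto
    then have "is_cycle V E p"
      using assms unfolding c is_cycle_iff walk_Inl
      by (auto simp: distinct_map dot_verts_def last_map hd_map D_Inl walk_J)
    then have "girth V E \<le> length c0" using girth_le[OF fin(1), of E p] unfolding c by simp
    then show ?thesis by simp
  next
    case r
    then have "\<forall>z\<in>set c0. \<exists>v. z = Inr v"
      by (metis isl_def sum.exhaust_sel)
    then obtain p where c: "c0 = map Inr p"
      unfolding ex_map_conv[symmetric] by blast
    have "p \<noteq> []" using assms unfolding c is_cycle_iff by auto
    then have "is_cycle V' E' p"
      using assms unfolding c is_cycle_iff walk_Inr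
      by (auto simp: distinct_map dot_verts_def last_map hd_map D_Inr walk_J' del_verts_edges_def)
    then have "girth V' E' \<le> length c0" using girth_le[OF fin(2), of E' p] unfolding c by simp
    then show ?thesis by simp
  next
    case m
    then obtain c1 where c1: "is_cycle DV D c1" "length c1 = length c0" "isl (hd c1)" "\<not> isl (last c1)"
      using is_cycle_split_sum[OF assms m] by metis
    then have "c1 \<noteq> []" by (auto simp: is_cycle_iff)
    then obtain L R rest where c1_eq: "c1 = map Inl L @ map Inr R @ rest" and ne: "L \<noteq> []" "R \<noteq> []"
      and rest: "rest = [] \<or> isl (hd rest) \<and> \<not> isl (last rest)"
      using list_split_sum c1(3,4) by metis
    obtain u w v where u: "{u, w, v} \<subseteq> S" "u \<noteq> w" "w \<noteq> v" "hd L = u" "last L = w" "hd R = partner w" "last R = partner v"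
      "distinct R" "walk J' R" "set R \<subseteq> V' - {x, y}"
      by (rule cross_runs[OF c1(1)[unfolded c1_eq] ne rest]) blast
    have L2: "2 \<le> length L"
      using u(2) by (intro hd_neq_last_length ne) (simp add: u)
    \<comment> \<open>\<open>partner\<close> is injective on terminals, so the ends of
      \<open>R\<close> differ as well; a cycle through a single hub needs two further
      vertices.\<close>
    have R2: "2 \<le> length R"
      using partner_inj[of w v] u(1,3) by (intro hd_neq_last_length ne) (simp add: u(6,7), blast)
    have memS: "w \<in> S" "v \<in> S" using u(1) by blast+
    have hubs: "{hub w, partner w} \<in> E'" "{hub v, partner v} \<in> E'" "hub v \<in> {x, y}" "hub w \<in> {x, y}"
      using memS[THEN hub_partner] by (simp_all add: hub_def)
    have "\<exists>c. is_cycle V' E' c \<and> length c \<le> length L + length R"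
    proof (cases "hub v = hub w")
      case True
      then have "is_cycle V' E' (hub w # R)"
        using u(6-10) hubs R2 walk_J'[OF u(9)] V'_mem(1,2) by (auto simp: is_cycle_Cons)
      then show ?thesis using L2 by fastforce
    next
      case False
      then have "{hub v, hub w} \<in> E'" using hub_neq[of v w] xy_edge by simp
      then have "is_cycle V' E' (hub v # hub w # R)"
        using u(6-10) hubs R2 walk_J'[OF u(9)] V'_mem(1,2) False ne by (auto simp: is_cycle_Cons walk_Cons)
      then show ?thesis using L2 by fastforce
    qed
    moreover have "length L + length R \<le> length c0"
      using c1(2) unfolding c1_eq by simp
    ultimately have "girth V' E' \<le> length c0"
      using girth_le[OF fin(2)] by (meson order_trans)
    then show ?thesis by simp
  qed
qed


section \<open>Building cycles of the dot product from paths in the factors\<close>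

lemma join_one_run:
  assumes uw: "u \<in> S" "w \<in> S" "u \<noteq> w"
    and p: "walk J p" "distinct p" "hd p = u" "last p = w" "set p \<subseteq> V"
    and q: "walk J' q" "distinct q" "hd q = partner u" "last q = partner w" "set q \<subseteq> V' - {x, y}"
    and ne: "p \<noteq> []" "q \<noteq> []"
  shows "is_cycle DV D (map Inl p @ map Inr (rev q))"
proof -
  have "2 \<le> length p"
    using p(3,4) uw(3) by (intro hd_neq_last_length ne) simp
  moreover have "1 \<le> length q"
    using ne(2) by (cases q) auto
  ultimately have len: "3 \<le> length (map Inl p @ map Inr (rev q))"
    by simp
  have "{Inl w, Inr (partner w)} \<in> D" "{Inr (partner u), Inl u} \<in> D"
    using uw unfolding D_cross D_cross' by blast+
  then have "walk D (map Inl p @ map Inr (rev q))"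
    using p(4) q(4) ne p(1) q(1) by (simp add: walk_append walk_Inl walk_Inr last_map hd_map hd_rev rev_map[symmetric])
  moreover have "{last (map Inl p @ map Inr (rev q)), hd (map Inl p @ map Inr (rev q))} \<in> D"
    using \<open>{Inr (partner u), Inl u} \<in> D\<close> ne p(3) q(3) by (simp add: last_map hd_map hd_append last_rev)
  moreover have "distinct (map Inl p @ map Inr (rev q))"
    using p(2) q(2) by (auto simp: distinct_map)
  moreover have "set (map Inl p @ map Inr (rev q)) \<subseteq> DV"
    using p(5) q(5) unfolding dot_verts_def by auto
  ultimately show ?thesis
    using len unfolding is_cycle_iff by blast
qed

lemma join_two_runs:
  assumes S: "u \<in> S" "w \<in> S" "v \<in> S" "t \<in> S"
    and p: "walk J p" "distinct p" "hd p = u" "last p = w" "set p \<subseteq> V" "p \<noteq> []"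
    and q: "walk J' q" "distinct q" "hd q = partner w" "last q = partner v" "set q \<subseteq> V' - {x, y}" "q \<noteq> []"
    and p': "walk J p'" "distinct p'" "hd p' = v" "last p' = t" "set p' \<subseteq> V" "p' \<noteq> []"
    and q': "walk J' q'" "distinct q'" "hd q' = partner t" "last q' = partner u" "set q' \<subseteq> V' - {x, y}" "q' \<noteq> []"
    and disj: "set p \<inter> set p' = {}" "set q \<inter> set q' = {}"
  shows "is_cycle DV D (map Inl p @ map Inr q @ map Inl p' @ map Inr q')"
proof -
  let ?c = "map Inl p @ map Inr q @ map Inl p' @ map Inr q'"
  have cross: "{Inl w, Inr (partner w)} \<in> D" "{Inr (partner v), Inl v} \<in> D" "{Inl t, Inr (partner t)} \<in> D" "{Inr (partner u), Inl u} \<in> D"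
    using S unfolding D_cross D_cross' by blast+
  have "walk D ?c"
    using p(1,3,4,6) q(1,3,4,6) p'(1,3,4,6) q'(1,3,4,6) cross
    by (simp add: walk_append walk_Inl walk_Inr last_map hd_map hd_append)
  moreover have "{last ?c, hd ?c} \<in> D"
    using cross(4) p(3,6) q'(4,6) by (simp add: last_map hd_map hd_append)
  moreover have "distinct ?c"
    using p(2) q(2) p'(2) q'(2) disj by (auto simp: distinct_map)
  moreover have "set ?c \<subseteq> DV"
    using p(5) q(5) p'(5) q'(5) unfolding dot_verts_def by auto
  moreover have "3 \<le> length ?c"
    using p(6) q(6) p'(6) q'(6) by (cases p; cases q; cases p') auto
  ultimately show ?thesis
    unfolding is_cycle_iff by blast
qed

lemma hub_neighbours:
  assumes "u \<in> S" "w \<in> S" "u \<noteq> w" "hub u = hub w" "{hub u, v} \<in> E'" "v \<notin> {x, y}"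
  shows "v \<in> {partner u, partner w}"
proof -
  have "(hub u = x \<and> {u, w} = {a, b}) \<or> (hub u = y \<and> {u, w} = {c, d})"
    using same_hub_edge[OF assms(1-4)] abcd' by (auto simp: doubleton_eq_iff)
  then show ?thesis
    using assms(5,6) by (auto simp: nbr_x nbr_y doubleton_eq_iff)
qed

text \<open>Let \<open>z\<close> be the hub other than \<open>hub u\<close>. In
  \<open>H' - z\<close> the vertex \<open>hub u\<close> keeps only the neighbours
  \<open>partner u\<close> and \<open>partner w\<close>; taking it out of the hamiltonian cycle
  leaves a spanning path of \<open>J'\<close> between them.\<close>

lemma J'_path:
  assumes hypo: "hypohamiltonian V' E'"
    and uw: "u \<in> S" "w \<in> S" "u \<noteq> w" "hub u = hub w"
  obtains q where "walk J' q" "distinct q" "hd q = partner u" "last q = partner w" "set q = V' - {x, y}" "q \<noteq> []"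
proof -
  define z where "z = (if hub u = x then y else x)"
  have z: "{hub u, z} = {x, y}" "hub u \<noteq> z" "z \<in> V'" "hub u \<in> V'"
    using V'_mem(1,2) abcd' by (auto simp: z_def hub_def)
  obtain c0 where "is_cycle V' E' c0" "set c0 = V' - {z}"
    using hypo z(3) unfolding hypohamiltonian_def hamiltonian_del_vertex by blast
  then obtain q where q: "is_cycle V' E' (hub u # q)" "set (hub u # q) = V' - {z}"
    using z by (metis DiffI is_cycle_start_at singletonD)
  have props: "hub u \<notin> set q" "distinct q" "walk E' q" "2 \<le> length q" "{hub u, hd q} \<in> E'" "{hub u, last q} \<in> E'"
    using q(1) unfolding is_cycle_Cons by blast+
  have "set q = (V' - {z}) - {hub u}"
    using q(2) props(1) by auto
  also have "\<dots> = V' - {hub u, z}" by blast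
  finally have set: "set q = V' - {x, y}" unfolding z(1) .
  have ne: "q \<noteq> []" using props(4) by auto
  then have mem: "hd q \<in> set q" "last q \<in> set q" by simp_all
  then have "hd q \<notin> {x, y}" "last q \<notin> {x, y}" unfolding set by blast+
  then have "hd q \<in> {partner u, partner w}" "last q \<in> {partner u, partner w}"
    using hub_neighbours[OF uw] props(5,6) by blast+
  then have ends: "hd q = partner u \<and> last q = partner w \<or> hd q = partner w \<and> last q = partner u"
    using distinct_hd_last[OF props(2,4)] by auto
  have "x \<notin> set q" "y \<notin> set q" unfolding set by blast+
  then have "walk J' q" using J'_walk props(3) by blast
  then show ?thesis
    using ends that[of q] that[of "rev q"] props(2) set ne by (metis distinct_rev hd_rev last_rev rev_is_Nil_conv set_rev walk_rev)
qed

lemma good_pairE: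
  assumes "good_pair W A u w"
  obtains p where "walk A p" "distinct p" "hd p = u" "last p = w" "set p = W" "p \<noteq> []"
  using assms unfolding good_pair_def is_path_iff by blast

lemma good_pair_sym: "good_pair W A u w \<Longrightarrow> good_pair W A w u"
proof -
  assume "good_pair W A u w"
  then obtain p where "walk A p" "distinct p" "hd p = u" "last p = w" "set p = W" "p \<noteq> []"
    by (rule good_pairE)
  then show ?thesis
    unfolding good_pair_def is_path_iff by (intro exI[of _ "rev p"]) (simp add: hd_rev last_rev)
qed

text \<open>The good pair in \<open>H - t\<close> consists of two terminals with the same hub, which
  is exactly the kind of pair for which \<open>J'_path\<close> supplies the other half.\<close>

lemma delete_Inl:
  assumes hypo: "hypohamiltonian V' E'" and "t \<in> V"
    and good: "good_pair (V - {t}) (del_verts_edges E {t} - {{a, b}, {c, d}}) a b \<or>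
               good_pair (V - {t}) (del_verts_edges E {t} - {{a, b}, {c, d}}) c d"
  shows "\<exists>c. is_cycle DV D c \<and> set c = DV - {Inl t}"
proof -
  obtain u w where uw: "u \<in> S" "w \<in> S" "u \<noteq> w" "hub u = hub w"
    and "good_pair (V - {t}) (del_verts_edges E {t} - {{a, b}, {c, d}}) u w"
  proof (cases "good_pair (V - {t}) (del_verts_edges E {t} - {{a, b}, {c, d}}) a b")
    case True
    then show ?thesis by (intro that[of a b]) (use abcd in simp_all)
  next
    case False
    then show ?thesis by (intro that[of c d]) (use abcd good in simp_all)
  qed
  then obtain p where p: "walk (del_verts_edges E {t} - {{a, b}, {c, d}}) p" "distinct p" "hd p = u" "last p = w"
    "set p = V - {t}" "p \<noteq> []" by (elim good_pairE)
  have wp: "walk J p"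
    by (rule walk_transfer[OF p(1)]) (simp add: del_verts_edges_def)
  obtain q where q: "walk J' q" "distinct q" "hd q = partner u" "last q = partner w" "set q = V' - {x, y}" "q \<noteq> []"
    by (rule J'_path[OF hypo uw])
  have "is_cycle DV D (map Inl p @ map Inr (rev q))"
    using p(5) q(5) by (intro join_one_run[OF uw(1-3) wp p(2-4) _ q(1-4) _ p(6) q(6)]) auto
  moreover have "set (map Inl p @ map Inr (rev q)) = DV - {Inl t}"
    using p(5) q(5) unfolding dot_verts_def by auto
  ultimately show ?thesis by blast
qed

lemma partner_pair:
  assumes "z1 \<in> {partner r, partner r2}" "z2 \<in> {partner r, partner r2}" "z1 \<noteq> z2"
  shows "\<exists>s s2. {s, s2} = {r, r2} \<and> z1 = partner s \<and> z2 = partner s2"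
proof (cases "z1 = partner r")
  case True
  then have "z2 = partner r2" using assms(2,3) by simp
  then show ?thesis using True by blast
next
  case False
  then have "z1 = partner r2" "z2 = partner r" using assms by simp_all
  then show ?thesis by (intro exI[of _ r2] exI[of _ r]) (simp add: insert_commute)
qed

text \<open>The hamiltonian cycle of \<open>H' - t\<close> decides which good pairs are used. If it
  contains \<open>xy\<close>, it leaves one path in \<open>J'\<close>, completed by a spanning path
  of \<open>J\<close> from \<open>a\<close> or \<open>b\<close> to \<open>c\<close> or
  \<open>d\<close>. If not, it leaves two paths, linked by the disjoint paths
  \<open>a\<close>-\<open>b\<close> and \<open>c\<close>-\<open>d\<close> of
  \<open>J\<close>.\<close>

lemma delete_Inr:
  assumes hypo: "hypohamiltonian V' E'" and t: "t \<in> V' - {x, y}"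
    and good: "good_pair V J a c" "good_pair V J a d" "good_pair V J b c" "good_pair V J b d" "good_pairs V J a b c d"
  shows "\<exists>c. is_cycle DV D c \<and> set c = DV - {Inr t}"
proof -
  have "x \<noteq> y" using abcd' by auto
  obtain c0 where "is_cycle V' E' c0" "set c0 = V' - {t}"
    using hypo t unfolding hypohamiltonian_def hamiltonian_del_vertex by blast
  then obtain p0 where p0: "is_cycle V' E' (x # p0)" "set (x # p0) = V' - {t}"
    using t V'_mem(1) by (metis DiffE DiffI insertI1 is_cycle_start_at singletonD)
  then have ne0: "p0 \<noteq> []" by (auto simp: is_cycle_Cons)
  have done1: ?thesis if cyc: "is_cycle V' E' (x # y # q)" "set (x # y # q) = V' - {t}" for q
  proof -
    have pr: "distinct q" "x \<notin> set q" "y \<notin> set q" "q \<noteq> []" "walk E' q" "{y, hd q} \<in> E'" "{x, last q} \<in> E'"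
      using cyc(1) by (auto simp: is_cycle_Cons walk_Cons split: if_splits)
    have set: "set q = V' - {x, y} - {t}"
      using cyc(2) pr(2,3) by auto
    have "hd q \<in> set q" "last q \<in> set q" using pr(4) by simp_all
    then have "hd q \<in> {c', d'}" "last q \<in> {a', b'}"
      using pr by (auto simp: nbr_x nbr_y)
    then have "hd q \<in> partner ` {c, d}" "last q \<in> partner ` {a, b}"
      by simp_all
    then obtain u v where u: "u \<in> {a, b}" "last q = partner u" and v: "v \<in> {c, d}" "hd q = partner v"
      by (elim imageE)
    have uv: "v \<in> S" "u \<in> S" "v \<noteq> u" using u(1) v(1) abcd by auto
    have "good_pair V J u v" using u(1) v(1) good(1-4) by blast
    then obtain p where p: "walk J p" "distinct p" "hd p = v" "last p = u" "set p = V" "p \<noteq> []"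
      using good_pair_sym by (elim good_pairE[OF good_pair_sym])
    have "is_cycle DV D (map Inl p @ map Inr (rev q))"
      by (rule join_one_run[OF uv p(1-4) _ J'_walk[OF pr(5,2,3)] pr(1) v(2) u(2) _ p(6) pr(4)]) (use p(5) set in auto)
    moreover have "set (map Inl p @ map Inr (rev q)) = DV - {Inr t}"
      using p(5) set unfolding dot_verts_def by auto
    ultimately show ?thesis by blast
  qed
  show ?thesis
  proof (cases "hd p0 = y \<or> last p0 = y")
    case True
    \<comment> \<open>Reversal arranges that \<open>y\<close> comes directly after
      \<open>x\<close>.\<close>
    have "\<exists>p1. is_cycle V' E' (x # p1) \<and> set (x # p1) = V' - {t} \<and> p1 \<noteq> [] \<and> hd p1 = y"
    proof (cases "hd p0 = y")
      case True then show ?thesis using p0 ne0 by blast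
    next
      case False
      then show ?thesis
        using \<open>hd p0 = y \<or> last p0 = y\<close> p0 ne0 is_cycle_Cons_rev[OF p0(1)] by (intro exI[of _ "rev p0"]) (simp add: hd_rev)
    qed
    then obtain q where "is_cycle V' E' (x # y # q)" "set (x # y # q) = V' - {t}"
      by (metis list.collapse)
    then show ?thesis by (rule done1)
  next
    case False
    have pr: "distinct p0" "x \<notin> set p0" "walk E' p0" "2 \<le> length p0" "{x, hd p0} \<in> E'" "{x, last p0} \<in> E'"
      using p0(1) unfolding is_cycle_Cons by blast+
    then have ends: "hd p0 \<in> {a', b'}" "last p0 \<in> {a', b'}" "hd p0 \<noteq> last p0"
      using False distinct_hd_last by (auto simp: nbr_x)
    have "y \<in> set (x # p0)"
      unfolding p0(2) using t V'_mem(2) by blast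
    then have "y \<in> set p0"
      using \<open>x \<noteq> y\<close> by simp
    \<comment> \<open>Without \<open>xy\<close> in the cycle, both pieces left by removing
      \<open>x\<close> and \<open>y\<close> are nonempty, and each joins a neighbour of
      \<open>x\<close> to a neighbour of \<open>y\<close>.\<close>
    then obtain q1 q2 where q12: "p0 = q1 @ y # q2" by (meson split_list)
    have ne: "q1 \<noteq> []" "q2 \<noteq> []" using False by (auto simp: q12)
    have pq: "walk E' q1" "walk E' q2" "{last q1, y} \<in> E'" "{y, hd q2} \<in> E'" "distinct q1" "distinct q2"
      "set q1 \<inter> set q2 = {}" "y \<notin> set q1" "y \<notin> set q2" "x \<notin> set q1" "x \<notin> set q2"
      using pr(1-3) ne by (auto simp: q12 walk_append walk_Cons)
    have "set q1 \<union> set q2 = set (x # p0) - {x, y}"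
      unfolding q12 using pq(8-11) by auto
    then have set12: "set q1 \<union> set q2 = V' - {x, y} - {t}"
      unfolding p0(2) by blast
    have mem: "last q1 \<in> set q1" "hd q2 \<in> set q2" using ne by simp_all
    have "{y, last q1} \<in> E'"
      using pq(3) by (simp only: insert_commute)
    then have "last q1 \<in> {x, c', d'}" "hd q2 \<in> {x, c', d'}"
      using pq(4) nbr_y by blast+
    then have "last q1 \<in> {c', d'}" "hd q2 \<in> {c', d'}"
      using pq(10,11) mem by auto
    moreover have "last q1 \<noteq> hd q2" using mem pq(7) by auto
    moreover have "hd q1 \<in> {a', b'}" "last q2 \<in> {a', b'}" "hd q1 \<noteq> last q2"
      using ends ne by (simp_all add: q12)
    ultimately obtain u v v2 u2 where u: "{u, u2} = {a, b}" "{v, v2} = {c, d}" 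
      "hd q1 = partner u" "last q1 = partner v" "hd q2 = partner v2" "last q2 = partner u2"
    proof -
      obtain u u2 where "{u, u2} = {a, b}" "hd q1 = partner u" "last q2 = partner u2"
        using partner_pair[of "hd q1" a b "last q2"] \<open>hd q1 \<in> {a', b'}\<close> \<open>last q2 \<in> {a', b'}\<close> \<open>hd q1 \<noteq> last q2\<close> unfolding partner_simps by blast
      moreover obtain v v2 where "{v, v2} = {c, d}" "last q1 = partner v" "hd q2 = partner v2"
        using partner_pair[of "last q1" c d "hd q2"] \<open>last q1 \<in> {c', d'}\<close> \<open>hd q2 \<in> {c', d'}\<close> \<open>last q1 \<noteq> hd q2\<close> unfolding partner_simps by blast
      ultimately show ?thesis using that by blast
    qed
    obtain P Q where PQ: "is_path V J P" "is_path V J Q" "set P \<inter> set Q = {}" "set P \<union> set Q = V"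
      "hd P = a" "last P = b" "hd Q = c" "last Q = d"
      using good(5) unfolding good_pairs_def by blast
    \<comment> \<open>The two paths of \<open>J\<close> come with fixed directions, whereas the
      cycle through \<open>t\<close>-free \<open>H'\<close> dictates in which direction each has to
      be traversed.\<close>
    have orient: "\<exists>P'. is_path V J P' \<and> set P' = set P \<and> hd P' = s \<and> last P' = s2"
      if "is_path V J P" "{s, s2} = {hd P, last P}" for P s s2
    proof (cases "s = hd P")
      case True
      then have "s2 = last P" using that(2) by (auto simp: doubleton_eq_iff)
      then show ?thesis using True that(1) by blast
    next
      case False
      then have "s = last P" "s2 = hd P" using that(2) by (auto simp: doubleton_eq_iff)
      then show ?thesis
        using that(1) by (intro exI[of _ "rev P"]) (simp add: is_path_iff hd_rev last_rev)
    qed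
    have "{u2, u} = {hd P, last P}" "{v, v2} = {hd Q, last Q}"
      unfolding PQ using u(1,2) by (simp_all only: insert_commute)
    then obtain P' Q' where P': "is_path V J P'" "set P' = set P" "hd P' = u2" "last P' = u"
      and Q': "is_path V J Q'" "set Q' = set Q" "hd Q' = v" "last Q' = v2"
      using orient[OF PQ(1), of u2 u] orient[OF PQ(2), of v v2] by blast
    have inS: "u2 \<in> S" "u \<in> S" "v \<in> S" "v2 \<in> S" using u(1,2) by blast+
    have P'': "walk J P'" "distinct P'" "set P' \<subseteq> V" "P' \<noteq> []" and Q'': "walk J Q'" "distinct Q'" "set Q' \<subseteq> V" "Q' \<noteq> []"
      using P'(1) Q'(1) by (simp_all add: is_path_iff)
    have sub: "set q1 \<subseteq> V' - {x, y}" "set q2 \<subseteq> V' - {x, y}" using set12 by blast+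
    have disj: "set P' \<inter> set Q' = {}" using P'(2) Q'(2) PQ(3) by simp
    have "is_cycle DV D (map Inl P' @ map Inr q1 @ map Inl Q' @ map Inr q2)"
      by (rule join_two_runs[OF inS P''(1,2) P'(3,4) P''(3,4) J'_walk[OF pq(1,10,8)] pq(5) u(3,4) sub(1) ne(1)
            Q''(1,2) Q'(3,4) Q''(3,4) J'_walk[OF pq(2,11,9)] pq(6) u(5,6) sub(2) ne(2) disj pq(7)])
    moreover have "set (map Inl P' @ map Inr q1 @ map Inl Q' @ map Inr q2) = DV - {Inr t}"
    proof -
      have "set (map Inl P' @ map Inr q1 @ map Inl Q' @ map Inr q2) = Inl ` (set P \<union> set Q) \<union> Inr ` (set q1 \<union> set q2)"
        unfolding set_append set_map P'(2) Q'(2) image_Un by blast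
      also have "\<dots> = DV - {Inr t}"
        unfolding PQ(4) set12 dot_verts_def by blast
      finally show ?thesis .
    qed
    ultimately show ?thesis by blast
  qed
qed

section \<open>Degrees in the dot product\<close>

lemma graph_dot: "graph DV D"
  unfolding graph_def
proof (intro conjI ballI)
  show "finite DV"
    using G G' by (simp add: graph_def dot_verts_def)
  fix e assume "e \<in> D"
  \<comment> \<open>As an image of \<open>S\<close> the cross edges make one case instead of
    four.\<close>
  then have "e \<in> image Inl ` J \<union> image Inr ` J' \<union> (\<lambda>u. {Inl u, Inr (partner u)}) ` S"
    unfolding dot_edges_def by simp
  then consider (1) f where "f \<in> J" "e = Inl ` f" | (2) f where "f \<in> J'" "e = Inr ` f"
    | (3) u where "u \<in> S" "e = {Inl u, Inr (partner u)}"
    by (elim UnE imageE) metis+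
  then show "\<exists>u v. e = {u, v} \<and> u \<noteq> v \<and> u \<in> DV \<and> v \<in> DV"
  proof cases
    case 1
    then obtain u v where "f = {u, v}" "u \<noteq> v" "u \<in> V" "v \<in> V"
      using G unfolding graph_def by blast
    then show ?thesis
      using 1(2) by (intro exI[of _ "Inl u"] exI[of _ "Inl v"]) (auto simp: dot_verts_def)
  next
    case 2
    then have "f \<in> E'" "f \<inter> {x, y} = {}" by (auto simp: del_verts_edges_def)
    then obtain u v where "f = {u, v}" "u \<noteq> v" "u \<in> V'" "v \<in> V'"
      using G' unfolding graph_def by blast
    then show ?thesis
      using 2(2) \<open>f \<inter> {x, y} = {}\<close> by (intro exI[of _ "Inr u"] exI[of _ "Inr v"]) (auto simp: dot_verts_def)
  next
    case 3
    then show ?thesis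
      using S_subset V'_mem(3)[of u] by (intro exI[of _ "Inl u"] exI[of _ "Inr (partner u)"]) (auto simp: dot_verts_def)
  qed
qed

lemma neighbours_Inl: "neighbours D (Inl v) = Inl ` {u. {v, u} \<in> J} \<union> (if v \<in> S then {Inr (partner v)} else {})"
proof (rule set_eqI)
  fix z show "z \<in> neighbours D (Inl v) \<longleftrightarrow> z \<in> Inl ` {u. {v, u} \<in> J} \<union> (if v \<in> S then {Inr (partner v)} else {})"
    by (cases z) (simp_all only: neighbours_def mem_Collect_eq D_Inl D_cross, auto)
qed

lemma neighbours_Inr: "neighbours D (Inr w) = Inr ` {u. {w, u} \<in> J'} \<union> Inl ` {u \<in> S. w = partner u}"
proof (rule set_eqI)
  fix z show "z \<in> neighbours D (Inr w) \<longleftrightarrow> z \<in> Inr ` {u. {w, u} \<in> J'} \<union> Inl ` {u \<in> S. w = partner u}"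
    by (cases z) (simp_all only: neighbours_def mem_Collect_eq D_Inr D_cross', auto)
qed

text \<open>Every terminal loses the other end of its removed edge and gains its partner; every
  partner loses its hub and gains its terminal.\<close>

lemma cubic_dot:
  assumes "cubic V E" "cubic V' E'"
  shows "cubic DV D"
  unfolding cubic_def
proof (intro conjI ballI graph_dot)
  fix z assume z: "z \<in> DV"
  show "degree D z = 3"
  proof (cases z)
    case (Inl v)
    then have "v \<in> V" using z by (auto simp: dot_verts_def)
    then have c3: "card (neighbours E v) = 3"
      using assms(1) degree_eq_card_neighbours[OF G] unfolding cubic_def by metis
    have fin: "finite (neighbours E v)" by (rule finite_neighbours[OF G])
    have "card (neighbours D z) = 3"
    proof (cases "v \<in> S")
      case True
      define t where "t = (if v = a then b else if v = b then a else if v = c then d else c)"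
      have t: "{v, u} \<in> {{a, b}, {c, d}} \<longleftrightarrow> u = t" for u
        using True abcd by (auto simp: t_def doubleton_eq_iff)
      have "t \<in> neighbours E v"
        using t[of t] ab cd by (auto simp: neighbours_def)
      moreover have "{u. {v, u} \<in> J} = neighbours E v - {t}"
        using t by (auto simp: neighbours_def)
      ultimately have "card {u. {v, u} \<in> J} = 2" "finite {u. {v, u} \<in> J}"
        using c3 fin by simp_all
      then show ?thesis
        unfolding Inl neighbours_Inl using True by (subst card_Un_disjoint) (auto simp: card_image)
    next
      case False
      then have "{u. {v, u} \<in> J} = neighbours E v"
        by (auto simp: neighbours_def doubleton_eq_iff)
      then show ?thesis
        unfolding Inl neighbours_Inl using False c3 by (simp add: card_image)
    qed
    then show ?thesis using degree_eq_card_neighbours[OF graph_dot] by simp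
  next
    case (Inr w)
    then have w: "w \<in> V'" "w \<noteq> x" "w \<noteq> y" using z by (auto simp: dot_verts_def)
    then have c3: "card (neighbours E' w) = 3"
      using assms(2) degree_eq_card_neighbours[OF G'] unfolding cubic_def by metis
    have fin: "finite (neighbours E' w)" by (rule finite_neighbours[OF G'])
    have J': "{u. {w, u} \<in> J'} = neighbours E' w - {x, y}"
      using w by (auto simp: neighbours_def del_verts_edges_def)
    have nb: "x \<in> neighbours E' w \<longleftrightarrow> w \<in> {a', b'}" "y \<in> neighbours E' w \<longleftrightarrow> w \<in> {c', d'}"
      using w nbr_x[of w] nbr_y[of w] by (simp_all add: neighbours_def insert_commute)
    have "card (neighbours D z) = 3"
    proof (cases "\<exists>u\<in>S. w = partner u")
      case True
      then obtain u where u: "u \<in> S" "w = partner u" by blast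
      then have "{u \<in> S. w = partner u} = {u}" using partner_inj by blast
      moreover have "neighbours E' w - {x, y} = neighbours E' w - {hub u}" "hub u \<in> neighbours E' w"
        using nb u abcd' by auto
      then have "card {u. {w, u} \<in> J'} = 2" "finite {u. {w, u} \<in> J'}"
        unfolding J' using c3 fin by simp_all
      ultimately show ?thesis
        unfolding Inr neighbours_Inr by (subst card_Un_disjoint) (auto simp: card_image)
    next
      case False
      then have empty: "{u \<in> S. w = partner u} = {}" by blast
      have "w \<notin> {a', b', c', d'}" using False by auto
      then have same: "neighbours E' w - {x, y} = neighbours E' w" using nb by auto
      show ?thesis
        unfolding Inr neighbours_Inr J' empty same using c3 by (simp add: card_image)
    qed
    then show ?thesis using degree_eq_card_neighbours[OF graph_dot] by simp
  qed
qed

end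

section \<open>Leading two arcs to a disc\<close>

text \<open>The hitting times form a compact set and so have a least element. All earlier points lie
  outside the ball, and by continuity the point reached cannot be interior.\<close>

lemma first_hit:
  fixes P :: "real \<Rightarrow> 'a::metric_space"
  assumes "path P" "P 0 \<notin> cball w \<rho>" "s \<in> {0..1}" "P s \<in> cball w \<rho>"
  obtains t where "0 < t" "t \<le> s" "dist w (P t) = \<rho>" "\<And>r. 0 \<le> r \<Longrightarrow> r < t \<Longrightarrow> P r \<notin> cball w \<rho>"
proof -
  have cont: "continuous_on {0..s} P"
    using assms(1,3) by (auto simp: path_def intro: continuous_on_subset)
  have "closed ({0..s} \<inter> P -` cball w \<rho>)"
    using cont by (intro continuous_closed_preimage) auto
  then have "compact ({0..s} \<inter> P -` cball w \<rho>)"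
    by (metis compact_Icc compact_Int_closed Int_absorb Int_assoc)
  moreover have "s \<in> {0..s} \<inter> P -` cball w \<rho>"
    using assms by auto
  ultimately obtain t where t: "t \<in> {0..s} \<inter> P -` cball w \<rho>"
    and least: "\<And>r. r \<in> {0..s} \<inter> P -` cball w \<rho> \<Longrightarrow> t \<le> r"
    using compact_attains_inf by (metis empty_iff)
  have out: "P r \<notin> cball w \<rho>" if "0 \<le> r" "r < t" for r
    using least[of r] that t by force
  have "0 < t"
    using t assms(2) by (cases "t = 0") auto
  have "P ` closure {0..<t} \<subseteq> - ball w \<rho>"
  proof (rule image_closure_subset)
    show "continuous_on (closure {0..<t}) P"
      using \<open>0 < t\<close> t cont by (auto intro: continuous_on_subset)
    show "P ` {0..<t} \<subseteq> - ball w \<rho>"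
      using out by fastforce
  qed auto
  then have "P t \<notin> ball w \<rho>"
    using \<open>0 < t\<close> by (simp add: image_subset_iff)
  then have "dist w (P t) = \<rho>"
    using t by auto
  then show ?thesis
    using that[of t] \<open>0 < t\<close> t out by auto
qed

lemma norm_scaleR_sgn: "norm x *\<^sub>R sgn x = (x :: 'a::real_normed_vector)"
  by (cases "x = 0") (auto simp: sgn_div_norm)

text \<open>With \<open>n = norm A\<close> and \<open>c = w \<bullet> sgn A\<close>, the squared
  distances differ by \<open>(n - 1) * (n + 1 - 2 * c)\<close>, and \<open>c\<close> is at most 1.
  Hence radial projection to the circle does not leave a ball about \<open>w\<close>.\<close>

lemma dist_sgn_le:
  fixes A w :: "'a::real_inner"
  assumes "norm w = 1" "1 \<le> norm A"
  shows "dist w (sgn A) \<le> dist w A"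
proof -
  define n where "n = norm A"
  define c where "c = w \<bullet> sgn A"
  have n: "1 \<le> n" "A = n *\<^sub>R sgn A"
    using assms(2) by (simp_all add: n_def norm_scaleR_sgn)
  have u: "norm (sgn A) = 1"
    using assms(2) by (auto simp: norm_sgn)
  have "c \<le> 1"
    using norm_cauchy_schwarz[of w "sgn A"] u assms(1) by (simp add: c_def)
  have "(norm (w - n *\<^sub>R sgn A))\<^sup>2 = 1 - 2 * n * c + n\<^sup>2"
    using u assms(1) by (simp add: power2_norm_eq_inner inner_diff inner_commute c_def norm_eq_1) (simp add: power2_eq_square)
  moreover have "(norm (w - sgn A))\<^sup>2 = 2 - 2 * c"
    using u assms(1) by (simp add: power2_norm_eq_inner inner_diff inner_commute c_def norm_eq_1)
  moreover have "0 \<le> (n - 1) * (n + 1 - 2 * c)"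
    using n(1) \<open>c \<le> 1\<close> by simp
  ultimately have "(norm (w - sgn A))\<^sup>2 \<le> (norm (w - A))\<^sup>2"
    using n(2) by (simp add: algebra_simps power2_eq_square)
  then show ?thesis
    by (simp add: dist_norm)
qed

text \<open>Along one ray, equal distances from \<open>w\<close> give
  \<open>(n - m) * (n + m - 2 * c) = 0\<close>; the second factor vanishes only for
  \<open>n = m = 1\<close>. Used to see that two legs projected from equal distance end in different
  points.\<close>

lemma sgn_sphere_unique:
  fixes A B w :: "'a::real_inner"
  assumes "norm w = 1" "1 \<le> norm A" "1 \<le> norm B" "dist w A = dist w B" "sgn A = sgn B"
  shows "A = B"
proof -
  define n m where "n = norm A" and "m = norm B"
  define c where "c = w \<bullet> sgn A"
  have n: "1 \<le> n" "A = n *\<^sub>R sgn A" and m: "1 \<le> m" "B = m *\<^sub>R sgn A"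
    using assms(2,3) by (simp_all add: n_def m_def norm_scaleR_sgn) (simp add: assms(5) norm_scaleR_sgn)
  have u: "norm (sgn A) = 1"
    using assms(2) by (auto simp: norm_sgn)
  have "c \<le> 1"
    using norm_cauchy_schwarz[of w "sgn A"] u assms(1) by (simp add: c_def)
  have *: "(norm (w - k *\<^sub>R sgn A))\<^sup>2 = 1 - 2 * k * c + k\<^sup>2" for k
    using u assms(1) by (simp add: power2_norm_eq_inner inner_diff inner_commute c_def norm_eq_1) (simp add: power2_eq_square)
  have "norm (w - n *\<^sub>R sgn A) = norm (w - m *\<^sub>R sgn A)"
    using assms(4) n(2) m(2) by (simp add: dist_norm)
  then have "(n - m) * (n + m - 2 * c) = 0"
    using *[of n] *[of m] by (simp add: algebra_simps power2_eq_square)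
  then have "n = m"
    using \<open>c \<le> 1\<close> n(1) m(1) by auto
  then show ?thesis
    using n(2) m(2) by metis
qed

lemma closed_segment_sgn:
  fixes A :: "'a::real_normed_vector"
  assumes "1 \<le> norm A" "z \<in> closed_segment A (sgn A)"
  obtains k where "1 \<le> k" "z = k *\<^sub>R sgn A" "norm z = k" "sgn z = sgn A"
proof -
  obtain u where u: "0 \<le> u" "u \<le> 1" "z = (1 - u) *\<^sub>R A + u *\<^sub>R sgn A"
    using assms(2) by (auto simp: in_segment)
  define k where "k = (1 - u) * norm A + u"
  have A: "A = norm A *\<^sub>R sgn A"
    by (simp add: norm_scaleR_sgn)
  have "z = (1 - u) *\<^sub>R norm A *\<^sub>R sgn A + u *\<^sub>R sgn A"
    using u(3) A by simp
  then have z: "z = k *\<^sub>R sgn A"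
    by (simp add: k_def scaleR_add_left)
  have "0 \<le> (1 - u) * (norm A - 1)"
    using u assms by simp
  then have k: "1 \<le> k"
    by (simp add: k_def algebra_simps)
  have nz: "norm (sgn A) = 1"
    using assms(1) by (auto simp: norm_sgn)
  show ?thesis
  proof
    show "norm z = k" using z k nz by simp
    have "sgn z = sgn k *\<^sub>R sgn (sgn A)"
      by (simp add: z sgn_scaleR)
    then show "sgn z = sgn A"
      using k nz by (simp add: sgn_div_norm[of "sgn A"])
  qed (use z k in auto)
qed

text \<open>The arc is followed until it first comes within \<rho> of \<open>w\<close> and then left
  along the radius. The radial piece stays in the ball about \<open>w\<close>, which the part of the
  arc before time \<open>t\<close> avoids, so the two pieces meet only at
  \<open>Q t\<close>.\<close>

lemma arc_radial_end:
  fixes Q :: "real \<Rightarrow> complex"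
  assumes Q: "arc Q" "path_image Q \<inter> cball 0 1 = {w}" and w: "norm w = 1"
    and \<rho>: "0 < \<rho>" "\<rho> < dist w (pathstart Q)" and s: "s \<in> {0..1}" "Q s = w"
  obtains t g where "0 < t" "t < s" "dist w (Q t) = \<rho>" "1 \<le> norm (Q t)"
    "\<And>r. 0 \<le> r \<Longrightarrow> r < t \<Longrightarrow> Q r \<notin> cball w \<rho>"
    "arc g" "pathstart g = pathstart Q" "pathfinish g = sgn (Q t)"
    "path_image g = Q ` {0..t} \<union> closed_segment (Q t) (sgn (Q t))"
    "closed_segment (Q t) (sgn (Q t)) \<subseteq> cball w \<rho>"
    "path_image g \<inter> cball 0 1 = {sgn (Q t)}"
proof -
  obtain t where t: "0 < t" "t \<le> s" "dist w (Q t) = \<rho>" 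
    and out: "\<And>r. 0 \<le> r \<Longrightarrow> r < t \<Longrightarrow> Q r \<notin> cball w \<rho>"
    using first_hit[of Q w \<rho> s] assms by (auto simp: arc_imp_path pathstart_def)
  have "t < s"
    using t s(2) \<rho>(1) by (cases "t = s") auto
  have t01: "t \<in> {0..1}"
    using t s by auto
  have big: "1 < norm (Q r)" if "r \<in> {0..1}" "r \<noteq> s" for r
  proof (rule ccontr)
    assume "\<not> 1 < norm (Q r)"
    then have "Q r = w"
      using Q(2) that by (auto simp: path_image_def)
    then show False
      using Q(1) s that by (auto simp: arc_def inj_on_def)
  qed
  have nt: "1 < norm (Q t)"
    using big t01 \<open>t < s\<close> by auto
  have seg: "closed_segment (Q t) (sgn (Q t)) \<subseteq> cball w \<rho>"
    using dist_sgn_le[OF w, of "Q t"] nt t(3) by (intro closed_segment_subset) auto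
  define g where "g = subpath 0 t Q +++ linepath (Q t) (sgn (Q t))"
  have im: "path_image (subpath 0 t Q) = Q ` {0..t}"
    using t by (simp add: path_image_subpath)
  have pim: "path_image g = Q ` {0..t} \<union> closed_segment (Q t) (sgn (Q t))"
    unfolding g_def by (subst path_image_join) (auto simp: im)
  have "norm (sgn (Q t)) = 1"
    using nt by (auto simp: norm_sgn)
  have "arc g"
    unfolding g_def
  proof (rule arc_join)
    show "arc (subpath 0 t Q)"
      using Q(1) t t01 by (intro arc_subpath_arc) auto
    show "arc (linepath (Q t) (sgn (Q t)))"
      using nt \<open>norm (sgn (Q t)) = 1\<close> by (metis arc_linepath less_irrefl)
    show "path_image (subpath 0 t Q) \<inter> path_image (linepath (Q t) (sgn (Q t)))
      \<subseteq> {pathstart (linepath (Q t) (sgn (Q t)))}"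
    proof
      fix z assume z: "z \<in> path_image (subpath 0 t Q) \<inter> path_image (linepath (Q t) (sgn (Q t)))"
      have "z \<in> cball w \<rho>"
        using z seg by auto
      moreover obtain r where "r \<in> {0..t}" "z = Q r"
        using z unfolding im by blast
      ultimately have r: "0 \<le> r" "r \<le> t" "z = Q r" "z \<in> cball w \<rho>"
        by auto
      then have "r = t"
        using out[of r] by force
      then show "z \<in> {pathstart (linepath (Q t) (sgn (Q t)))}"
        using r by simp
    qed
  qed simp
  moreover have "path_image g \<inter> cball 0 1 = {sgn (Q t)}"
  proof -
    have "z = sgn (Q t)" if "z \<in> path_image g" "z \<in> cball 0 1" for z
    proof -
      have "norm z \<le> 1"
        using that(2) by simp
      have "z \<notin> Q ` {0..t}"
        using big \<open>norm z \<le> 1\<close> \<open>t < s\<close> s(1) by force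
      then have "z \<in> closed_segment (Q t) (sgn (Q t))"
        using that pim by auto
      then obtain k where "1 \<le> k" "z = k *\<^sub>R sgn (Q t)" "norm z = k"
        using closed_segment_sgn[of "Q t" z] nt by auto
      then show ?thesis
        using \<open>norm z \<le> 1\<close> by auto
    qed
    moreover have "sgn (Q t) \<in> path_image g"
      using pim by auto
    moreover have "sgn (Q t) \<in> cball 0 1"
      using \<open>norm (sgn (Q t)) = 1\<close> by (metis mem_cball_0 order_refl)
    ultimately show ?thesis
      by blast
  qed
  moreover have "pathstart g = pathstart Q" "pathfinish g = sgn (Q t)"
    by (auto simp: g_def pathstart_def subpath_def joinpaths_def linepath_def pathfinish_def)
  ultimately show ?thesis
    using that[of t g] t \<open>t < s\<close> out pim seg nt by simp
qed

text \<open>If the arc meets the disc in \<open>w\<close> alone, a cut at \<open>w\<close> would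
  give both legs the same end. Each side is therefore stopped at distance \<rho> from
  \<open>w\<close> and projected radially.\<close>

lemma arc_touching_disc_split:
  fixes P :: "real \<Rightarrow> complex"
  assumes P: "arc P" "path_image P \<inter> cball 0 1 = {w}" and w: "norm w = 1"
    and ends: "pathstart P \<noteq> w" "pathfinish P \<noteq> w" and "0 < \<epsilon>"
  obtains g h where "arc g" "arc h" "pathstart g = pathstart P" "pathstart h = pathfinish P"
    "path_image g \<subseteq> path_image P \<union> cball w \<epsilon>" "path_image h \<subseteq> path_image P \<union> cball w \<epsilon>"
    "path_image g \<inter> path_image h = {}"
    "path_image g \<inter> cball 0 1 = {pathfinish g}" "path_image h \<inter> cball 0 1 = {pathfinish h}"
    "norm (pathfinish g) = 1" "norm (pathfinish h) = 1"
    "pathfinish g \<in> cball w \<epsilon>" "pathfinish h \<in> cball w \<epsilon>"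
proof -
  have pos: "0 < dist w (pathstart P)" "0 < dist w (pathfinish P)"
    using ends by auto
  define m where "m = min \<epsilon> (min (dist w (pathstart P)) (dist w (pathfinish P)))"
  have m: "0 < m" "m \<le> \<epsilon>" "m \<le> dist w (pathstart P)" "m \<le> dist w (pathfinish P)"
    using pos \<open>0 < \<epsilon>\<close> unfolding m_def by auto
  \<comment> \<open>Half of \<open>m\<close> makes \<rho> strictly smaller than the distances from
    \<open>w\<close> to the ends of \<open>P\<close>, so both ends start outside the ball.\<close>
  define \<rho> where "\<rho> = m / 2"
  have \<rho>: "0 < \<rho>" "\<rho> \<le> \<epsilon>" "\<rho> < dist w (pathstart P)" "\<rho> < dist w (pathfinish P)"
    using m unfolding \<rho>_def by linarith+
  have "w \<in> path_image P \<inter> cball 0 1"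
    unfolding P(2) by simp
  then obtain s where s: "s \<in> {0..1}" "P s = w"
    by (auto simp: path_image_def)
  obtain t g where g: "0 < t" "t < s" "dist w (P t) = \<rho>" "1 \<le> norm (P t)"
    "\<And>r. 0 \<le> r \<Longrightarrow> r < t \<Longrightarrow> P r \<notin> cball w \<rho>"
    "arc g" "pathstart g = pathstart P" "pathfinish g = sgn (P t)"
    "path_image g = P ` {0..t} \<union> closed_segment (P t) (sgn (P t))"
    "closed_segment (P t) (sgn (P t)) \<subseteq> cball w \<rho>"
    "path_image g \<inter> cball 0 1 = {sgn (P t)}"
    by (rule arc_radial_end[OF P w \<rho>(1,3) s]) blast
  \<comment> \<open>The second leg is the same construction on the reversed arc, where
    \<open>w\<close> has parameter \<open>1 - s\<close>.\<close>
  define R where "R = reversepath P"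
  have R: "arc R" "path_image R \<inter> cball 0 1 = {w}" "\<rho> < dist w (pathstart R)" "1 - s \<in> {0..1}" "R (1 - s) = w"
    using P \<rho> s unfolding R_def
    by (simp_all add: arc_reversepath) (simp add: reversepath_def)
  obtain u h where h: "0 < u" "u < 1 - s" "dist w (R u) = \<rho>" "1 \<le> norm (R u)"
    "\<And>r. 0 \<le> r \<Longrightarrow> r < u \<Longrightarrow> R r \<notin> cball w \<rho>"
    "arc h" "pathstart h = pathstart R" "pathfinish h = sgn (R u)"
    "path_image h = R ` {0..u} \<union> closed_segment (R u) (sgn (R u))"
    "closed_segment (R u) (sgn (R u)) \<subseteq> cball w \<rho>"
    "path_image h \<inter> cball 0 1 = {sgn (R u)}"
    by (rule arc_radial_end[OF R(1,2) w \<rho>(1) R(3-5)]) blast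
  have neq: "P r \<noteq> R r'" if "r \<in> {0..t}" "r' \<in> {0..u}" for r r'
  proof
    assume "P r = R r'"
    then have "P r = P (1 - r')" by (simp add: R_def reversepath_def)
    then have "r = 1 - r'"
      using P(1) that g(1,2) h(1,2) s by (auto simp: arc_def inj_on_def)
    then show False
      using that g(2) h(2) by auto
  qed
  have sgn_neq: "sgn (P t) \<noteq> sgn (R u)"
  proof
    assume "sgn (P t) = sgn (R u)"
    then have "P t = R u"
      using sgn_sphere_unique[OF w, of "P t" "R u"] g(3,4) h(3,4) by simp
    then show False
      using neq[of t u] g(1) h(1) by simp
  qed
  \<comment> \<open>A piece ending at its first hitting time has only its last point in the
    ball.\<close>
  have only: "Q r = Q v" if "0 \<le> r" "r \<le> v" "\<And>r. 0 \<le> r \<Longrightarrow> r < v \<Longrightarrow> Q r \<notin> cball w \<rho>"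
    "Q r \<in> cball w \<rho>" for Q :: "real \<Rightarrow> complex" and r v
    using that by force
  \<comment> \<open>A radial segment lies on one ray, so a common point of two segments forces equal
    projections.\<close>
  have sg: "sgn z = sgn A" if "1 \<le> norm A" "z \<in> closed_segment A (sgn A)" for z A :: complex
    using closed_segment_sgn[OF that] by metis
  have "path_image g \<inter> path_image h = {}"
  proof (rule ccontr)
    assume "path_image g \<inter> path_image h \<noteq> {}"
    then obtain z where z: "z \<in> path_image g" "z \<in> path_image h" by auto
    from z(1) g(9) consider (1) r where "r \<in> {0..t}" "z = P r" | (2) "z \<in> closed_segment (P t) (sgn (P t))" by auto
    then show False
    proof cases
      case 1
      from z(2) h(9) consider (a) r' where "r' \<in> {0..u}" "z = R r'" | (b) "z \<in> closed_segment (R u) (sgn (R u))" by auto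
      then show ?thesis
      proof cases
        case a then show ?thesis using 1 neq by auto
      next
        case b
        then have "P r = P t" using 1 only[of r t P] g(5) h(10) by auto
        then have "sgn (P t) = sgn (R u)" using sg[OF h(4) b] 1 by simp
        then show ?thesis using sgn_neq by simp
      qed
    next
      case 2
      from z(2) h(9) consider (a) r' where "r' \<in> {0..u}" "z = R r'" | (b) "z \<in> closed_segment (R u) (sgn (R u))" by auto
      then show ?thesis
      proof cases
        case a
        then have "R r' = R u" using 2 only[of r' u R] h(5) g(10) by auto
        then show ?thesis using sg[OF g(4) 2] a sgn_neq by simp
      next
        case b
        then show ?thesis using sg[OF g(4) 2] sg[OF h(4) b] sgn_neq by simp
      qed
    qed
  qed
  moreover have "path_image g \<subseteq> path_image P \<union> cball w \<epsilon>"
    using g(1,2,9,10) s \<rho>(2) by (fastforce simp: path_image_def)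
  moreover have "path_image h \<subseteq> path_image P \<union> cball w \<epsilon>"
  proof -
    have "R ` {0..u} \<subseteq> path_image R"
      using h(1,2) s by (auto simp: path_image_def)
    then show ?thesis
      using h(9,10) \<rho>(2) by (auto simp: R_def) 
  qed
  moreover have "pathstart h = pathfinish P"
    using h by (simp add: R_def)
  moreover have "norm (sgn (P t)) = 1" "norm (sgn (R u)) = 1"
    using g(4) h(4) by (auto simp: norm_sgn)
  moreover have "sgn (P t) \<in> cball w \<epsilon>" "sgn (R u) \<in> cball w \<epsilon>"
    using g(10) h(10) \<rho>(2) by auto
  ultimately show ?thesis
    using that[of g h] g h by auto
qed

text \<open>The arc is cut at its first and last visits to the disc; a single point of contact goes
  to \<open>arc_touching_disc_split\<close>. The ball about \<open>w\<close> accounts for the second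
  situation, where the legs may leave \<open>P\<close>.\<close>

lemma arc_disc_ends:
  fixes P :: "real \<Rightarrow> complex"
  assumes P: "arc P" "pathstart P \<notin> cball 0 1" "pathfinish P \<notin> cball 0 1"
    and meet: "path_image P \<inter> cball 0 1 \<noteq> {}" and "0 < \<epsilon>"
  obtains g h w where "arc g" "arc h" "pathstart g = pathstart P" "pathstart h = pathfinish P"
    "w \<in> path_image P \<inter> cball 0 1"
    "path_image g \<subseteq> path_image P \<union> cball w \<epsilon>" "path_image h \<subseteq> path_image P \<union> cball w \<epsilon>"
    "path_image g \<inter> path_image h = {}"
    "path_image g \<inter> cball 0 1 = {pathfinish g}" "path_image h \<inter> cball 0 1 = {pathfinish h}"
    "norm (pathfinish g) = 1" "norm (pathfinish h) = 1"
    "path_image P \<inter> cball 0 1 = {w} \<Longrightarrow> pathfinish g \<in> cball w \<epsilon> \<and> pathfinish h \<in> cball w \<epsilon>"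
proof -
  obtain r where r: "r \<in> {0..1}" "P r \<in> cball 0 1"
    using meet unfolding path_image_def by blast
  have P0: "P 0 \<notin> cball 0 1"
    using P(2) by (simp add: pathstart_def)
  obtain s where s: "0 < s" "s \<le> r" "dist 0 (P s) = 1" "\<And>r. 0 \<le> r \<Longrightarrow> r < s \<Longrightarrow> P r \<notin> cball 0 1"
    using first_hit[OF arc_imp_path[OF P(1)] P0 r] by blast
  define R where "R = reversepath P"
  have R: "arc R" "R 0 \<notin> cball 0 1" "1 - r \<in> {0..1}" "R (1 - r) \<in> cball 0 1"
    using P r unfolding R_def
    by (simp_all add: arc_reversepath) (simp_all add: reversepath_def pathfinish_def)
  obtain u where u: "0 < u" "u \<le> 1 - r" "dist 0 (R u) = 1" "\<And>r. 0 \<le> r \<Longrightarrow> r < u \<Longrightarrow> R r \<notin> cball 0 1"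
    using first_hit[OF arc_imp_path[OF R(1)] R(2-4)] by blast
  have Rim: "path_image R = path_image P"
    by (simp add: R_def)
  show ?thesis
  proof (cases "path_image P \<inter> cball 0 1 = {P s}")
    case True
    have n: "norm (P s) = 1" "pathstart P \<noteq> P s" "pathfinish P \<noteq> P s"
      using s(3) P(2,3) by auto
    show ?thesis
    proof (rule arc_touching_disc_split[OF P(1) True n \<open>0 < \<epsilon>\<close>])
      fix g h
      assume "arc g" "arc h" "pathstart g = pathstart P" "pathstart h = pathfinish P"
        "path_image g \<subseteq> path_image P \<union> cball (P s) \<epsilon>" "path_image h \<subseteq> path_image P \<union> cball (P s) \<epsilon>"
        "path_image g \<inter> path_image h = {}"
        "path_image g \<inter> cball 0 1 = {pathfinish g}" "path_image h \<inter> cball 0 1 = {pathfinish h}"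
        "norm (pathfinish g) = 1" "norm (pathfinish h) = 1"
        "pathfinish g \<in> cball (P s) \<epsilon>" "pathfinish h \<in> cball (P s) \<epsilon>"
      then show ?thesis
        using that[of g h "P s"] True by simp
    qed
  next
    case False
    have s01: "s \<in> {0..1}" "u \<in> {0..1}" "1 - u \<in> {0..1}"
      using s u r by auto
    \<comment> \<open>Coinciding first and last visits would make \<open>P s\<close> the only point
      in the disc.\<close>
    have "s \<noteq> 1 - u"
    proof
      assume su: "s = 1 - u"
      have "v = P s" if v: "v \<in> path_image P \<inter> cball 0 1" for v
      proof -
        obtain t where t: "t \<in> {0..1}" "v = P t"
          using v by (auto simp: path_image_def)
        have "\<not> t < s"
          using s(4)[of t] t v by auto
        moreover have "\<not> 1 - t < u"
          using u(4)[of "1 - t"] t v by (auto simp: R_def reversepath_def)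
        ultimately have "t = s"
          using su by linarith
        then show ?thesis
          using t by simp
      qed
      moreover have "P s \<in> path_image P \<inter> cball 0 1"
        using s s01 by (auto simp: path_image_def)
      ultimately show False
        using False by blast
    qed
    then have "s < 1 - u"
      using s u by auto
    define g where "g = subpath 0 s P"
    define h where "h = subpath 0 u R"
    have ends: "pathstart g = pathstart P" "pathfinish g = P s" "pathstart h = pathfinish P" "pathfinish h = R u"
      by (simp_all add: g_def h_def) (simp_all add: R_def reversepath_def pathstart_def pathfinish_def)
    have gim: "path_image g = P ` {0..s}" and him: "path_image h = R ` {0..u}"
      using s u by (simp_all add: g_def h_def path_image_subpath)
    have "arc g" "arc h"
      using s(1) u(1) s01 P(1) R(1) by (auto simp: g_def h_def intro!: arc_subpath_arc)
    have g1: "path_image g \<inter> cball 0 1 = {pathfinish g}"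
    proof -
      have "v = P s" if v: "v \<in> path_image g" "v \<in> cball 0 1" for v
      proof -
        obtain t where "0 \<le> t" "t \<le> s" "v = P t"
          using v(1) unfolding gim by auto
        then show ?thesis
          using s(4)[of t] v(2) by force
      qed
      moreover have "P s \<in> path_image g" "P s \<in> cball 0 1"
        using s unfolding gim by auto
      ultimately show ?thesis
        unfolding ends by blast
    qed
    have h1: "path_image h \<inter> cball 0 1 = {pathfinish h}"
    proof -
      have "v = R u" if v: "v \<in> path_image h" "v \<in> cball 0 1" for v
      proof -
        obtain t where "0 \<le> t" "t \<le> u" "v = R t"
          using v(1) unfolding him by auto
        then show ?thesis
          using u(4)[of t] v(2) by force
      qed
      moreover have "R u \<in> path_image h" "R u \<in> cball 0 1"
        using u unfolding him by auto
      ultimately show ?thesis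
        unfolding ends by blast
    qed
    have "path_image g \<inter> path_image h = {}"
    proof (rule ccontr)
      assume "path_image g \<inter> path_image h \<noteq> {}"
      then obtain t t' where t: "0 \<le> t" "t \<le> s" "0 \<le> t'" "t' \<le> u" "P t = P (1 - t')"
        unfolding gim him R_def reversepath_def by auto
      then have "t = 1 - t'"
        using P(1) s01 by (auto simp: arc_def inj_on_def)
      then show False
        using t \<open>s < 1 - u\<close> by auto
    qed
    moreover have "path_image g \<subseteq> path_image P" "path_image h \<subseteq> path_image P"
      using s01 unfolding gim him Rim[symmetric] 
       apply (auto simp: path_image_def R_def) apply (metis Rim R_def path_image_def atLeastAtMost_iff imageI order_trans)
      done
    moreover have "P s \<in> path_image P \<inter> cball 0 1"
      using s s01 by (auto simp: path_image_def)
    moreover have "norm (pathfinish g) = 1" "norm (pathfinish h) = 1"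
      using s u ends by auto
    ultimately show ?thesis
      using that[of g h "P s"] \<open>arc g\<close> \<open>arc h\<close> g1 h1 ends False
      by (metis le_supI1)
  qed
qed

section \<open>Legs from a drawing to the unit circle\<close>

text \<open>\<open>K\<close> is the drawing without the arcs that are cut, and \<open>q\<close>
  gives vertex positions. The ends are recorded as real angles instead of points so that they can be
  compared by \<open><\<close>.\<close>

definition circle_legs :: 
  "complex set \<Rightarrow> ('v \<Rightarrow> complex) \<Rightarrow> 'v set \<Rightarrow> ('v \<Rightarrow> real \<Rightarrow> complex) \<Rightarrow> ('v \<Rightarrow> real) \<Rightarrow> bool" where
  "circle_legs K q S g \<theta> \<longleftrightarrow>
     (\<forall>v\<in>S. arc (g v) \<and> pathstart (g v) = q v \<and> pathfinish (g v) = cis (\<theta> v) \<and>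
        path_image (g v) \<inter> K = {q v} \<and> path_image (g v) \<inter> cball 0 1 = {cis (\<theta> v)}) \<and>
     (\<forall>u\<in>S. \<forall>v\<in>S. u \<noteq> v \<longrightarrow> path_image (g u) \<inter> path_image (g v) = {})"

lemma angle_small:
  assumes "norm z = 1" "0 < \<alpha>" "\<alpha> < pi" "cos \<alpha> \<le> Re z"
  obtains \<theta> where "z = cis \<theta>" "\<bar>\<theta>\<bar> \<le> \<alpha>"
proof
  have z: "z = cis (Arg z)"
    using assms(1) by (metis cis_Arg norm_zero zero_neq_one sgn_div_norm div_by_1 scaleR_one inverse_1)
  show "z = cis (Arg z)" by (fact z)
  have "cos \<alpha> \<le> cos \<bar>Arg z\<bar>"
    using assms(4) z by (metis cis.sel(1) cos_abs_real)
  then show "\<bar>Arg z\<bar> \<le> \<alpha>"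
    using assms(2,3) Arg_bounded[of z] by (subst (asm) cos_mono_le_eq) auto
qed

text \<open>The branch \<open>Arg2pi\<close> here and \<open>Arg\<close> in
  \<open>angle_small\<close> put all angles between \<open>-\<alpha>\<close> and
  \<open>2 * pi - \<alpha>\<close>, with those of the arc about \<open>1\<close> coming
  first.\<close>

lemma angle_large:
  assumes "norm z = 1" "0 < \<alpha>" "\<alpha> < pi" "Re z < cos \<alpha>"
  obtains \<theta> where "z = cis \<theta>" "\<alpha> < \<theta>" "\<theta> < 2 * pi - \<alpha>"
proof
  define \<theta> where "\<theta> = Arg2pi z"
  show z: "z = cis \<theta>"
    using assms(1) Arg2pi_eq[of z] by (simp add: cis_conv_exp \<theta>_def)
  have t: "0 \<le> \<theta>" "\<theta> < 2 * pi"
    using Arg2pi[of z] by (auto simp: \<theta>_def)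
  have c: "cos \<theta> < cos \<alpha>"
    using assms(4) z by (metis cis.sel(1))
  show "\<alpha> < \<theta>"
  proof (rule ccontr)
    assume "\<not> \<alpha> < \<theta>"
    then have "cos \<alpha> \<le> cos \<theta>"
      using t assms by (intro cos_monotone_0_pi_le) auto
    with c show False by simp
  qed
  show "\<theta> < 2 * pi - \<alpha>"
  proof (rule ccontr)
    assume "\<not> \<theta> < 2 * pi - \<alpha>"
    then have "cos \<alpha> \<le> cos (2 * pi - \<theta>)"
      using t assms by (intro cos_monotone_0_pi_le) auto
    with c show False by (simp add: cos_2pi_minus)
  qed
qed

lemma Re_dist_1:
  assumes "norm z = 1"
  shows "(dist 1 z)\<^sup>2 = 2 - 2 * Re z"
proof -
  have "(Re z)\<^sup>2 + (Im z)\<^sup>2 = 1"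
    using assms by (metis cmod_power2 one_power2)
  moreover have "(dist 1 z)\<^sup>2 = (1 - Re z)\<^sup>2 + (Im z)\<^sup>2"
    by (simp add: dist_norm cmod_power2)
  ultimately show ?thesis
    by (simp add: power2_eq_square algebra_simps)
qed

text \<open>The legs of \<open>P\<close> end close to the contact point \<open>1\<close>, and
  everything close to \<open>Q\<close> is farther from it. The threshold angle \<alpha> turns this
  comparison of distances into the order of the angles.\<close>

lemma circle_legs_unit_disc:
  fixes q :: "'v \<Rightarrow> complex"
  assumes K: "compact K" "K \<inter> cball 0 1 = {}"
    and P: "arc P" "pathstart P = q a" "pathfinish P = q b" "path_image P \<inter> K = {q a, q b}"
    and Q: "arc Q" "pathstart Q = q c" "pathfinish Q = q d" "path_image Q \<inter> K = {q c, q d}"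
    and PQ: "path_image P \<inter> path_image Q = {}"
    and disc: "path_image P \<inter> cball 0 1 = {1}" "path_image Q \<inter> cball 0 1 \<noteq> {}"
    and abcd: "distinct [a, b, c, d]"
  obtains g \<theta> where "circle_legs K q {a, b, c, d} g \<theta>"
    "\<And>u v. u \<in> {a, b} \<Longrightarrow> v \<in> {c, d} \<Longrightarrow> \<theta> u < \<theta> v"
    "\<And>u v. u \<in> {a, b, c, d} \<Longrightarrow> v \<in> {a, b, c, d} \<Longrightarrow> \<theta> u - \<theta> v < 2 * pi"
proof -
  have cP: "compact (path_image P)" "compact (path_image Q)"
    using P Q by (simp_all add: arc_imp_path compact_path_image)
  obtain d1 where d1: "0 < d1" "\<And>z w. z \<in> path_image P \<Longrightarrow> w \<in> path_image Q \<Longrightarrow> d1 \<le> dist z w"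
    using separate_compact_closed[of "path_image P" "path_image Q"] cP PQ compact_imp_closed by metis
  have "(cball 0 1 :: complex set) \<inter> K = {}" using K(2) by blast
  then obtain d2 where d2: "0 < d2" "\<And>z w. z \<in> cball (0::complex) 1 \<Longrightarrow> w \<in> K \<Longrightarrow> d2 \<le> dist z w"
    using separate_compact_closed[of "cball (0::complex) 1" K] K compact_imp_closed by (metis compact_cball)
  \<comment> \<open>The factor 1/4 gives \<open>2 * \<epsilon> < d1\<close>, so neighbourhoods of
    \<open>P\<close> and \<open>Q\<close> stay apart, \<open>\<epsilon> < d2\<close>, so balls about
    points of the disc avoid \<open>K\<close>, and \<open>\<epsilon> < 1\<close> for the
    \<open>arccos\<close> below.\<close>
  define \<epsilon> where "\<epsilon> = min 1 (min d1 d2) / 4"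
  have \<epsilon>: "0 < \<epsilon>" "\<epsilon> < d2" "2 * \<epsilon> < d1" "\<epsilon> < 1"
    using d1(1) d2(1) by (auto simp: \<epsilon>_def min_def)
  have qK: "q a \<in> K" "q b \<in> K" "q c \<in> K" "q d \<in> K"
    using P(4) Q(4) by auto
  then have out: "pathstart P \<notin> cball 0 1" "pathfinish P \<notin> cball 0 1" "pathstart Q \<notin> cball 0 1" "pathfinish Q \<notin> cball 0 1"
    unfolding P Q using K(2) by blast+
  have "path_image P \<inter> cball 0 1 \<noteq> {}" using disc by simp
  then obtain ga gb w where ab: "arc ga" "arc gb" "pathstart ga = pathstart P" "pathstart gb = pathfinish P"
    "w \<in> path_image P \<inter> cball 0 1"
    "path_image ga \<subseteq> path_image P \<union> cball w \<epsilon>" "path_image gb \<subseteq> path_image P \<union> cball w \<epsilon>"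
    "path_image ga \<inter> path_image gb = {}"
    "path_image ga \<inter> cball 0 1 = {pathfinish ga}" "path_image gb \<inter> cball 0 1 = {pathfinish gb}"
    "norm (pathfinish ga) = 1" "norm (pathfinish gb) = 1"
    "path_image P \<inter> cball 0 1 = {w} \<Longrightarrow> pathfinish ga \<in> cball w \<epsilon> \<and> pathfinish gb \<in> cball w \<epsilon>"
    by (rule arc_disc_ends[OF P(1) out(1,2) _ \<epsilon>(1)]) blast
  have "w = 1"
    using ab(5) unfolding disc by simp
  obtain gc gd w' where cd: "arc gc" "arc gd" "pathstart gc = pathstart Q" "pathstart gd = pathfinish Q"
    "w' \<in> path_image Q \<inter> cball 0 1"
    "path_image gc \<subseteq> path_image Q \<union> cball w' \<epsilon>" "path_image gd \<subseteq> path_image Q \<union> cball w' \<epsilon>"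
    "path_image gc \<inter> path_image gd = {}"
    "path_image gc \<inter> cball 0 1 = {pathfinish gc}" "path_image gd \<inter> cball 0 1 = {pathfinish gd}"
    "norm (pathfinish gc) = 1" "norm (pathfinish gd) = 1"
    by (rule arc_disc_ends[OF Q(1) out(3,4) disc(2) \<epsilon>(1)]) blast
  have far: "v \<notin> path_image Q \<union> cball w' \<epsilon>" if v: "v \<in> path_image P \<union> cball w \<epsilon>" for v
  proof
    assume "v \<in> path_image Q \<union> cball w' \<epsilon>"
    then obtain y where y: "y \<in> path_image Q" "dist v y \<le> \<epsilon>"
      using cd(5) \<epsilon>(1) by (metis IntD1 Un_iff dist_commute dist_self less_imp_le mem_cball)
    obtain x where x: "x \<in> path_image P" "dist v x \<le> \<epsilon>"
      using v ab(5) \<epsilon>(1) by (metis IntD1 Un_iff dist_commute dist_self less_imp_le mem_cball)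
    have "d1 \<le> dist x y" by (rule d1(2)[OF x(1) y(1)])
    also have "\<dots> \<le> dist v x + dist v y" by (metis dist_commute dist_triangle)
    finally show False using x(2) y(2) \<epsilon>(3) by linarith
  qed
  have KP: "v \<in> path_image P" if "v \<in> K" "v \<in> path_image P \<union> cball w \<epsilon>" for v
    using that d2(2)[of w v] ab(5) \<epsilon>(2) by force
  have KQ: "v \<in> path_image Q" if "v \<in> K" "v \<in> path_image Q \<union> cball w' \<epsilon>" for v
    using that d2(2)[of w' v] cd(5) \<epsilon>(2) by force
  have st: "pathstart ga = q a" "pathstart gb = q b" "pathstart gc = q c" "pathstart gd = q d"
    using ab cd P Q by auto
  have self: "q a \<in> path_image ga" "q b \<in> path_image gb" "q c \<in> path_image gc" "q d \<in> path_image gd"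
    using st pathstart_in_path_image by metis+
  \<comment> \<open>A leg \<open>X\<close> can meet \<open>K\<close> only where its arc does, at two
    vertices; the wrong one \<open>y\<close> is excluded because it lies on the companion
    leg.\<close>
  have meetK: "X \<inter> K = {x}"
    if x: "x \<in> X" and y: "y \<notin> X" and XA: "X \<subseteq> A"
      and AP: "\<And>v. v \<in> K \<Longrightarrow> v \<in> A \<Longrightarrow> v \<in> P" and PK: "P \<inter> K = {x, y}" for X A P x y
  proof (intro equalityI subsetI)
    fix v assume v: "v \<in> X \<inter> K"
    then have "v \<in> P \<inter> K"
      using XA AP[of v] by auto
    then show "v \<in> {x}"
      unfolding PK using v y by auto
  next
    have "x \<in> P \<inter> K"
      unfolding PK by simp
    then show "v \<in> X \<inter> K" if "v \<in> {x}" for v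
      using that x by simp
  qed
  have other: "q b \<notin> path_image ga" "q a \<notin> path_image gb" "q d \<notin> path_image gc" "q c \<notin> path_image gd"
    using self ab(8) cd(8) by blast+
  have Ka: "path_image ga \<inter> K = {q a}"
    by (rule meetK[OF self(1) other(1) ab(6) KP P(4)])
  have Kb: "path_image gb \<inter> K = {q b}"
    by (rule meetK[OF self(2) other(2) ab(7) KP]) (use P(4) in \<open>simp_all add: insert_commute\<close>)
  have Kc: "path_image gc \<inter> K = {q c}"
    by (rule meetK[OF self(3) other(3) cd(6) KQ Q(4)])
  have Kd: "path_image gd \<inter> K = {q d}"
    by (rule meetK[OF self(4) other(4) cd(7) KQ]) (use Q(4) in \<open>simp_all add: insert_commute\<close>)
  \<comment> \<open>The angle whose chord from \<open>1\<close> has length \<epsilon>, since a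
    squared chord is \<open>2 - 2 * cos \<alpha>\<close>.\<close>
  define \<alpha> where "\<alpha> = arccos (1 - \<epsilon>\<^sup>2 / 2)"
  have e2: "0 < \<epsilon>\<^sup>2" "\<epsilon>\<^sup>2 < 1"
    using \<epsilon>(1,4) by (auto simp: power_less_one_iff abs_square_less_1)
  have \<alpha>: "0 < \<alpha>" "\<alpha> < pi" "cos \<alpha> = 1 - \<epsilon>\<^sup>2 / 2"
    using arccos_lt_bounded[of "1 - \<epsilon>\<^sup>2 / 2"] e2 by (auto simp: \<alpha>_def)
  have near: "cos \<alpha> \<le> Re z" if "norm z = 1" "z \<in> cball w \<epsilon>" for z
  proof -
    have "(dist 1 z)\<^sup>2 \<le> \<epsilon>\<^sup>2"
      using that \<open>w = 1\<close> by (intro power_mono) auto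
    then show ?thesis
      using \<alpha>(3) Re_dist_1[OF that(1)] by linarith
  qed
  have notnear: "Re z < cos \<alpha>" if "norm z = 1" "z \<in> path_image Q \<union> cball w' \<epsilon>" for z
  proof -
    have "z \<notin> cball w \<epsilon>" using far that(2) by blast
    then have "\<epsilon>\<^sup>2 < (dist 1 z)\<^sup>2"
      using \<open>w = 1\<close> \<epsilon>(1) by (intro power_strict_mono) auto
    then show ?thesis
      using \<alpha>(3) Re_dist_1[OF that(1)] by linarith
  qed
  have fin: "pathfinish ga \<in> cball w \<epsilon>" "pathfinish gb \<in> cball w \<epsilon>"
    using ab(13) disc(1) \<open>w = 1\<close> by auto
  have fin': "pathfinish gc \<in> path_image Q \<union> cball w' \<epsilon>" "pathfinish gd \<in> path_image Q \<union> cball w' \<epsilon>"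
    using cd(6,7) pathfinish_in_path_image by blast+
  obtain ta where ta: "pathfinish ga = cis ta" "\<bar>ta\<bar> \<le> \<alpha>"
    using angle_small[OF ab(11) \<alpha>(1,2) near[OF ab(11) fin(1)]] by metis
  obtain tb where tb: "pathfinish gb = cis tb" "\<bar>tb\<bar> \<le> \<alpha>"
    using angle_small[OF ab(12) \<alpha>(1,2) near[OF ab(12) fin(2)]] by metis
  obtain tc where tc: "pathfinish gc = cis tc" "\<alpha> < tc" "tc < 2 * pi - \<alpha>"
    using angle_large[OF cd(11) \<alpha>(1,2) notnear[OF cd(11) fin'(1)]] by metis
  obtain td where td: "pathfinish gd = cis td" "\<alpha> < td" "td < 2 * pi - \<alpha>"
    using angle_large[OF cd(12) \<alpha>(1,2) notnear[OF cd(12) fin'(2)]] by metis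
  define g where "g = (\<lambda>v. if v = a then ga else if v = b then gb else if v = c then gc else gd)"
  define \<theta> where "\<theta> = (\<lambda>v. if v = a then ta else if v = b then tb else if v = c then tc else td)"
  have g: "g a = ga" "g b = gb" "g c = gc" "g d = gd" and \<theta>: "\<theta> a = ta" "\<theta> b = tb" "\<theta> c = tc" "\<theta> d = td"
    using abcd by (auto simp: g_def \<theta>_def)
  have cross: "path_image f \<inter> path_image h = {}" if "f \<in> {ga, gb}" "h \<in> {gc, gd}" for f h
    using that far ab(6,7) cd(6,7) by blast
  show ?thesis
  proof
    show "circle_legs K q {a, b, c, d} g \<theta>"
      unfolding circle_legs_def
      using ab(1,2,8-10) cd(1,2,8-10) st Ka Kb Kc Kd ta(1) tb(1) tc(1) td(1) 
        cross[of ga gc] cross[of ga gd] cross[of gb gc] cross[of gb gd]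
      by (simp add: g \<theta> Int_commute)
    show "\<theta> u < \<theta> v" if "u \<in> {a, b}" "v \<in> {c, d}" for u v
      using that ta(2) tb(2) tc(2) td(2) by (auto simp: \<theta>)
    show "\<theta> u - \<theta> v < 2 * pi" if "u \<in> {a, b, c, d}" "v \<in> {a, b, c, d}" for u v
      using that ta(2) tb(2) tc(2,3) td(2,3) \<alpha>(1,2) by (auto simp: \<theta>)
  qed
qed

lemma arc_compose:
  assumes "arc P" "continuous_on (path_image P) f" "inj_on f (path_image P)"
  shows "arc (f \<circ> P)"
  using assms unfolding arc_def path_image_def
  by (auto simp only: path_def intro!: continuous_on_compose comp_inj_on)

section \<open>Moving the second arc next to the first\<close>

text \<open>By the parallelogram law, the antipode of \<open>m - k\<close> is the only point of the
  ball as far from \<open>m - k\<close> as the diameter. If \<open>m + k\<close> is a nearest point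
  of a set to \<open>m - k\<close>, the ball thus meets the set there only.\<close>

lemma cball_diameter_tangent:
  fixes m k v :: "'a::real_inner"
  assumes "v \<in> cball m (norm k)" "2 * norm k \<le> dist (m - k) v"
  shows "v = m + k"
proof -
  define h where "h = v - m"
  have h: "norm h \<le> norm k" "2 * norm k \<le> norm (h + k)"
    using assms by (simp_all add: h_def dist_norm norm_minus_commute algebra_simps)
  have "(norm (h + k))\<^sup>2 + (norm (h - k))\<^sup>2 = 2 * (norm h)\<^sup>2 + 2 * (norm k)\<^sup>2"
    by (simp add: power2_norm_eq_inner inner_add inner_diff inner_commute)
  moreover have "(norm h)\<^sup>2 \<le> (norm k)\<^sup>2"
    using h(1) by (intro power_mono) auto
  moreover have "(2 * norm k)\<^sup>2 \<le> (norm (h + k))\<^sup>2"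
    using h(2) by (intro power_mono) auto
  ultimately have "(norm (h - k))\<^sup>2 \<le> 0"
    by (simp add: power2_eq_square)
  then have "h = k" by simp
  then show ?thesis by (simp add: h_def algebra_simps)
qed

text \<open>The second arc is dragged inside \<open>W\<close> next to \<open>x\<close>; the disc has the dragged point and its
  nearest point on the first arc as opposite boundary points.\<close>

lemma arc_drag_to_disc:
  fixes P Q :: "real \<Rightarrow> complex"
  assumes K: "closed K" and P: "arc P" and Q: "arc Q" "pathstart Q \<in> K" "pathfinish Q \<in> K"
    and PQ: "path_image P \<inter> path_image Q = {}"
    and W: "open W" "connected W" "W \<inter> K = {}" "W \<inter> path_image P = {}"
    and y: "y \<in> W" "y \<in> path_image Q" and x: "x \<in> path_image P" "x \<notin> K" "x \<in> closure W"
  obtains Q' m k where "arc Q'" "pathstart Q' = pathstart Q" "pathfinish Q' = pathfinish Q"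
    "path_image Q' \<inter> K = path_image Q \<inter> K" "path_image P \<inter> path_image Q' = {}"
    "k \<noteq> 0" "K \<inter> cball m (norm k) = {}" "path_image P \<inter> cball m (norm k) = {m + k}"
    "path_image Q' \<inter> cball m (norm k) \<noteq> {}"
proof -
  have "open (- K)" "x \<in> - K"
    using K x by auto
  \<comment> \<open>\<eta> keeps the future disc off \<open>K\<close>: the points of the disc are
    within \<open>\<eta> / 2\<close> of \<open>z\<close>, and \<open>z\<close> is within
    \<open>\<eta> / 2\<close> of \<open>x\<close>.\<close>
  then obtain \<eta> where \<eta>: "0 < \<eta>" "cball x \<eta> \<subseteq> - K"
    by (meson open_contains_cball)
  obtain z where z: "z \<in> W" "dist z x < \<eta> / 2"
    using x(3) \<eta>(1) by (metis closure_approachable half_gt_zero)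
  have "W \<noteq> {}" using y by auto
  then have aff: "affine hull W = UNIV"
    using W(1) affine_hull_open by blast
  have ope: "openin (top_of_set (affine hull W)) W"
    using W(1) by (simp add: aff open_openin[symmetric])
  \<comment> \<open>\<open>f\<close> is the identity outside \<open>W\<close>, so it fixes
    \<open>K\<close> and the first arc pointwise while carrying \<open>y\<close> to
    \<open>z\<close>.\<close>
  then obtain f f' where f: "homeomorphism UNIV UNIV f f'" "f y = z" "{x. \<not> (f x = x \<and> f' x = x)} \<subseteq> W"
    using homeomorphism_moving_point[OF ope subset_UNIV _ W(2) y(1) z(1)] unfolding aff by blast
  have fix1: "f u = u" if "u \<notin> W" for u
    using f(3) that by auto
  have injf: "inj f"
    using f(1) by (metis homeomorphism_apply1 injI UNIV_I)
  have contf: "continuous_on UNIV f"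
    using f(1) by (simp add: homeomorphism_def)
  have fW: "f u \<notin> W \<Longrightarrow> f u = u" for u
    using fix1[of "f u"] injf by (simp add: inj_eq)
  define Q' where "Q' = f \<circ> Q"
  have Q'im: "path_image Q' = f ` path_image Q"
    by (simp add: Q'_def path_image_compose)
  have "arc Q'"
    unfolding Q'_def using Q(1) contf injf
    by (intro arc_compose) (auto intro: continuous_on_subset inj_on_subset)
  have ends: "pathstart Q' = pathstart Q" "pathfinish Q' = pathfinish Q"
    using fix1[of "Q 0"] fix1[of "Q 1"] Q(2,3) W(3) by (auto simp: Q'_def pathstart_def pathfinish_def)
  have fixK: "(u \<in> f ` path_image Q) = (u \<in> path_image Q)" if "u \<notin> W" for u
  proof
    assume "u \<in> f ` path_image Q"
    then obtain v where "v \<in> path_image Q" "u = f v" by auto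
    then show "u \<in> path_image Q"
      using fW[of v] that by simp
  next
    assume "u \<in> path_image Q"
    then show "u \<in> f ` path_image Q"
      using fix1[OF that] by (metis imageI)
  qed
  have Q'K: "path_image Q' \<inter> K = path_image Q \<inter> K"
    unfolding Q'im using fixK W(3) by blast
  have PQ': "path_image P \<inter> path_image Q' = {}"
    unfolding Q'im using fixK W(4) PQ by blast
  have "closed (path_image P)" "path_image P \<noteq> {}"
    using P by (simp_all add: arc_imp_path closed_path_image)
  then obtain p where p: "p \<in> path_image P" "\<And>u. u \<in> path_image P \<Longrightarrow> dist z p \<le> dist z u"
    using distance_attains_inf by metis
  have "z \<noteq> p"
    using z(1) p(1) W(4) by auto
  define m where "m = (1/2) *\<^sub>R (p + z)"
  define k where "k = (1/2) *\<^sub>R (p - z)"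
  have mk: "m + k = p" "m - k = z"
    by (simp_all add: m_def k_def flip: scaleR_add_right scaleR_diff_right)
  have k2: "2 * norm k = dist z p"
    by (simp add: k_def dist_norm norm_minus_commute)
  have "k \<noteq> 0"
    using \<open>z \<noteq> p\<close> by (simp add: k_def)
  have zp: "dist z p < \<eta> / 2"
    using p(2)[OF x(1)] z(2) by simp
  have inz: "dist z u \<le> dist z p" if "u \<in> cball m (norm k)" for u
  proof -
    have "dist z m = norm k" unfolding mk(2)[symmetric] by (simp add: dist_norm)
    then show ?thesis using that dist_triangle[of z u m] k2 by simp
  qed
  have "K \<inter> cball m (norm k) = {}"
  proof -
    have "u \<notin> K" if "u \<in> cball m (norm k)" for u
    proof -
      have "dist x u < \<eta>"
        using inz[OF that] zp z(2) dist_triangle[of x u z] by (simp add: dist_commute)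
      then have "u \<in> cball x \<eta>" by simp
      then show ?thesis using \<eta>(2) by blast
    qed
    then show ?thesis by blast
  qed
  moreover have "path_image P \<inter> cball m (norm k) = {m + k}"
  proof (intro equalityI subsetI)
    fix u assume "u \<in> path_image P \<inter> cball m (norm k)"
    then show "u \<in> {m + k}"
      using cball_diameter_tangent[of u m k] p(2)[of u] k2 mk by auto
  next
    fix u assume "u \<in> {m + k}"
    then show "u \<in> path_image P \<inter> cball m (norm k)"
      using p(1) mk(1) by (auto simp: dist_norm)
  qed
  moreover have "z \<in> path_image Q' \<inter> cball m (norm k)"
  proof -
    have "z \<in> path_image Q'" unfolding Q'im using f(2) y(2) by blast
    moreover have "z \<in> cball m (norm k)" unfolding mk(2)[symmetric] by (simp add: dist_norm)
    ultimately show ?thesis by blast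
  qed
  ultimately show ?thesis
    using that[of Q' k m] \<open>arc Q'\<close> ends Q'K PQ' \<open>k \<noteq> 0\<close> by blast
qed

text \<open>\<open>W\<close> is the room for moving the second arc: it contains the point
  \<open>y\<close> of that arc and comes arbitrarily close to the point \<open>x\<close> of the
  first.\<close>

lemma circle_legs_exist:
  fixes q :: "'v \<Rightarrow> complex"
  assumes K: "compact K"
    and P: "arc P" "pathstart P = q a" "pathfinish P = q b" "path_image P \<inter> K = {q a, q b}"
    and Q: "arc Q" "pathstart Q = q c" "pathfinish Q = q d" "path_image Q \<inter> K = {q c, q d}"
    and PQ: "path_image P \<inter> path_image Q = {}"
    and W: "open W" "connected W" "W \<inter> K = {}" "W \<inter> path_image P = {}"
    and y: "y \<in> W" "y \<in> path_image Q" and x: "x \<in> path_image P" "x \<notin> K" "x \<in> closure W"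
    and abcd: "distinct [a, b, c, d]"
  obtains T g \<theta> where "inj T" "continuous_on UNIV T" "T ` K \<inter> cball 0 1 = {}"
    "circle_legs (T ` K) (T \<circ> q) {a, b, c, d} g \<theta>"
    "\<And>u v. u \<in> {a, b} \<Longrightarrow> v \<in> {c, d} \<Longrightarrow> \<theta> u < \<theta> v"
    "\<And>u v. u \<in> {a, b, c, d} \<Longrightarrow> v \<in> {a, b, c, d} \<Longrightarrow> \<theta> u - \<theta> v < 2 * pi"
proof -
  have "pathstart Q \<in> K" "pathfinish Q \<in> K"
    using Q by auto
  then obtain Q' m k where Q': "arc Q'" "pathstart Q' = pathstart Q" "pathfinish Q' = pathfinish Q"
    "path_image Q' \<inter> K = path_image Q \<inter> K" "path_image P \<inter> path_image Q' = {}"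
    and disc: "k \<noteq> 0" "K \<inter> cball m (norm k) = {}" "path_image P \<inter> cball m (norm k) = {m + k}"
      "path_image Q' \<inter> cball m (norm k) \<noteq> {}"
    using arc_drag_to_disc[OF compact_imp_closed[OF K] P(1) Q(1) _ _ PQ W y x] by metis
  \<comment> \<open>Complex division by \<open>k\<close> scales and rotates: the disc becomes the
    unit disc and the contact point \<open>m + k\<close> becomes \<open>1\<close>.\<close>
  define T where "T = (\<lambda>z. (z - m) / k)"
  have T: "inj T" "continuous_on UNIV T"
    using disc(1) by (auto simp: T_def inj_def intro!: continuous_intros)
  have Tball: "T z \<in> cball 0 1 \<longleftrightarrow> z \<in> cball m (norm k)" for z
    using disc(1) by (simp add: T_def norm_divide dist_norm norm_minus_commute divide_le_eq)
  then have Tcb: "T ` A \<inter> cball 0 1 = T ` (A \<inter> cball m (norm k))" for A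
    by blast
  have Tint: "T ` A \<inter> T ` B = T ` (A \<inter> B)" for A B
    by (rule image_Int[OF T(1), symmetric])
  have arcT: "arc (T \<circ> R)" if "arc R" for R
    using that T by (intro arc_compose) (auto intro: continuous_on_subset inj_on_subset)
  have "T (m + k) = 1"
    using disc(1) by (simp add: T_def)
  show ?thesis
  proof (rule circle_legs_unit_disc[of "T ` K" "T \<circ> P" "T \<circ> q" a b "T \<circ> Q'" c d])
    show "compact (T ` K)"
      using K T(2) by (metis compact_continuous_image continuous_on_subset subset_UNIV)
    show "T ` K \<inter> cball 0 1 = {}"
      using disc(2) by (simp add: Tcb)
    show "path_image (T \<circ> P) \<inter> cball 0 1 = {1}"
      using \<open>T (m + k) = 1\<close> by (simp add: path_image_compose Tcb disc(3))
    show "path_image (T \<circ> Q') \<inter> cball 0 1 \<noteq> {}"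
      using disc(4) by (simp add: path_image_compose Tcb)
    show "path_image (T \<circ> P) \<inter> path_image (T \<circ> Q') = {}"
      by (simp add: path_image_compose Tint Q'(5))
    show "path_image (T \<circ> P) \<inter> T ` K = {(T \<circ> q) a, (T \<circ> q) b}"
      by (simp add: path_image_compose Tint P(4))
    show "path_image (T \<circ> Q') \<inter> T ` K = {(T \<circ> q) c, (T \<circ> q) d}"
      by (simp add: path_image_compose Tint Q(4) Q'(4))
  next
    fix g \<theta>
    assume *: "circle_legs (T ` K) (T \<circ> q) {a, b, c, d} g \<theta>"
      "\<And>u v. u \<in> {a, b} \<Longrightarrow> v \<in> {c, d} \<Longrightarrow> \<theta> u < \<theta> v"
      "\<And>u v. u \<in> {a, b, c, d} \<Longrightarrow> v \<in> {a, b, c, d} \<Longrightarrow> \<theta> u - \<theta> v < 2 * pi"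
    have "T ` K \<inter> cball 0 1 = {}"
      using disc(2) by (simp add: Tcb)
    then show thesis
      using that[OF T _ *] by blast
  qed (use P Q Q' arcT abcd in \<open>simp_all add: pathstart_compose pathfinish_compose\<close>)
qed

lemma cis_eq_near:
  assumes "cis s = cis t" "\<bar>s - t\<bar> < 2 * pi"
  shows "s = t"
proof -
  have "cis (s - t) = 1"
    using assms(1) by (simp add: cis_divide[symmetric])
  then have "cos (s - t) = 1"
    by (metis cis.sel(1) one_complex.sel(1))
  then obtain n :: int where "s - t = of_int n * 2 * pi"
    by (auto simp: cos_one_2pi_int)
  then have "\<bar>of_int n\<bar> * (2 * pi) < 1 * (2 * pi)"
    using assms(2) by (simp add: abs_mult)
  then have "\<bar>of_int n :: real\<bar> < 1"
    by (simp only: mult_less_cancel_right) auto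
  then have "n = 0" by linarith
  then show ?thesis
    using \<open>s - t = of_int n * 2 * pi\<close> by simp
qed

section \<open>Gluing two plane drawings along a circle\<close>

lemma graph_edge_subset: "graph V E \<Longrightarrow> e \<in> E \<Longrightarrow> e \<subseteq> V"
  unfolding graph_def by fastforce

lemma graph_edge_nonempty: "graph V E \<Longrightarrow> e \<in> E \<Longrightarrow> e \<noteq> {}"
  unfolding graph_def by fastforce

lemma graph_subset: "graph V E \<Longrightarrow> E0 \<subseteq> E \<Longrightarrow> graph V E0"
  unfolding graph_def by blast

lemma graph_finite_edges: "graph V E \<Longrightarrow> finite E"
  by (metis finite_Pow_iff finite_subset graph_def graph_edge_subset PowI subsetI)

lemma plane_embedding_edge:
  assumes "plane_embedding V E pos \<gamma>" "e \<in> E"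
  shows "\<exists>u v. e = {u, v} \<and> arc (\<gamma> e) \<and> pathstart (\<gamma> e) = pos u \<and> pathfinish (\<gamma> e) = pos v"
    and "path_image (\<gamma> e) \<inter> pos ` V = pos ` e" and "arc (\<gamma> e)"
proof -
  note * = assms(1)[unfolded plane_embedding_def, THEN conjunct2, THEN conjunct1, rule_format, OF assms(2)]
  obtain u v where uv: "e = {u, v}" "arc (\<gamma> e)" "pathstart (\<gamma> e) = pos u" "pathfinish (\<gamma> e) = pos v"
    "path_image (\<gamma> e) \<inter> pos ` V = {pos u, pos v}"
    using * by (elim exE conjE)
  from uv(1-4) show "\<exists>u v. e = {u, v} \<and> arc (\<gamma> e) \<and> pathstart (\<gamma> e) = pos u \<and> pathfinish (\<gamma> e) = pos v"
    by blast
  show "path_image (\<gamma> e) \<inter> pos ` V = pos ` e"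
    using uv(5) unfolding uv(1) by simp
  show "arc (\<gamma> e)" by (fact uv(2))
qed

lemma plane_embedding_crossing:
  "plane_embedding V E pos \<gamma> \<Longrightarrow> e1 \<in> E \<Longrightarrow> e2 \<in> E \<Longrightarrow> e1 \<noteq> e2 \<Longrightarrow>
     path_image (\<gamma> e1) \<inter> path_image (\<gamma> e2) = pos ` (e1 \<inter> e2)"
  unfolding plane_embedding_def by (elim conjE) (rule ballE; simp)

lemma plane_embedding_inj: "plane_embedding V E pos \<gamma> \<Longrightarrow> inj_on pos V"
  unfolding plane_embedding_def by blast

lemma plane_embeddingI:
  assumes "inj_on pos V"
    and "\<And>e. e \<in> E \<Longrightarrow> \<exists>u v. e = {u, v} \<and> arc (\<gamma> e) \<and> pathstart (\<gamma> e) = pos u \<and> pathfinish (\<gamma> e) = pos v"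
    and "\<And>e. e \<in> E \<Longrightarrow> path_image (\<gamma> e) \<inter> pos ` V = pos ` e"
    and "\<And>e1 e2. e1 \<in> E \<Longrightarrow> e2 \<in> E \<Longrightarrow> e1 \<noteq> e2 \<Longrightarrow>
      path_image (\<gamma> e1) \<inter> path_image (\<gamma> e2) = pos ` (e1 \<inter> e2)"
  shows "plane_embedding V E pos \<gamma>"
  unfolding plane_embedding_def
proof (intro conjI ballI impI)
  fix e assume e: "e \<in> E"
  then obtain u v where uv: "e = {u, v}" "arc (\<gamma> e)" "pathstart (\<gamma> e) = pos u" "pathfinish (\<gamma> e) = pos v"
    using assms(2) by blast
  moreover have "path_image (\<gamma> e) \<inter> pos ` V = {pos u, pos v}"
    using assms(3)[OF e] uv(1) by simp
  ultimately show "\<exists>u v. e = {u, v} \<and> arc (\<gamma> e) \<and> pathstart (\<gamma> e) = pos u \<and>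
    pathfinish (\<gamma> e) = pos v \<and> path_image (\<gamma> e) \<inter> pos ` V = {pos u, pos v}"
    by blast
qed (fact assms(1), rule assms(4))

lemma plane_embedding_subgraph:
  assumes emb: "plane_embedding V E pos \<gamma>" and "V0 \<subseteq> V" "E0 \<subseteq> E" "\<And>e. e \<in> E0 \<Longrightarrow> e \<subseteq> V0"
  shows "plane_embedding V0 E0 pos \<gamma>"
proof (rule plane_embeddingI)
  show "inj_on pos V0"
    by (rule inj_on_subset[OF plane_embedding_inj[OF emb] assms(2)])
next
  fix e assume "e \<in> E0"
  then have e: "e \<in> E" "e \<subseteq> V0" using assms by auto
  show "\<exists>u v. e = {u, v} \<and> arc (\<gamma> e) \<and> pathstart (\<gamma> e) = pos u \<and> pathfinish (\<gamma> e) = pos v"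
    by (rule plane_embedding_edge(1)[OF emb e(1)])
  have "path_image (\<gamma> e) \<inter> pos ` V = pos ` e"
    by (rule plane_embedding_edge(2)[OF emb e(1)])
  then show "path_image (\<gamma> e) \<inter> pos ` V0 = pos ` e"
    using e(2) assms(2) by blast
next
  fix e1 e2 assume "e1 \<in> E0" "e2 \<in> E0" "e1 \<noteq> e2"
  then show "path_image (\<gamma> e1) \<inter> path_image (\<gamma> e2) = pos ` (e1 \<inter> e2)"
    using plane_embedding_crossing[OF emb] assms(3) by blast
qed

lemma edge_path_in_drawing: "e \<in> E \<Longrightarrow> path_image (\<gamma> e) \<subseteq> drawing V E pos \<gamma>"
  and vertices_in_drawing: "pos ` V \<subseteq> drawing V E pos \<gamma>"
  unfolding drawing_def by auto

lemma compact_drawing: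
  assumes "plane_embedding V E pos \<gamma>" "graph V E"
  shows "compact (drawing V E pos \<gamma>)"
  unfolding drawing_def
proof (rule compact_Un)
  show "compact (pos ` V)"
    using assms(2) by (auto simp: graph_def finite_imp_compact)
  show "compact (\<Union>e\<in>E. path_image (\<gamma> e))"
    using graph_finite_edges[OF assms(2)] plane_embedding_edge(3)[OF assms(1)]
    by (auto intro!: compact_UN compact_path_image arc_imp_path)
qed

text \<open>The map needs to be continuous and injective only on a set \<open>X\<close> containing
  the drawing, as \<open>invert_half\<close> is treated on \<open>- {0}\<close>.\<close>

lemma plane_embedding_image:
  assumes emb: "plane_embedding V E pos \<gamma>" and G: "graph V E"
    and f: "continuous_on X f" "inj_on f X" "drawing V E pos \<gamma> \<subseteq> X"
  shows "plane_embedding V E (f \<circ> pos) (\<lambda>e. f \<circ> \<gamma> e)"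
    "drawing V E (f \<circ> pos) (\<lambda>e. f \<circ> \<gamma> e) = f ` drawing V E pos \<gamma>"
proof -
  have X: "pos ` V \<subseteq> X" "\<And>e. e \<in> E \<Longrightarrow> path_image (\<gamma> e) \<subseteq> X"
    using f(3) unfolding drawing_def by auto
  show "plane_embedding V E (f \<circ> pos) (\<lambda>e. f \<circ> \<gamma> e)"
  proof (rule plane_embeddingI)
    show "inj_on (f \<circ> pos) V"
      using plane_embedding_inj[OF emb] inj_on_subset[OF f(2) X(1)] by (rule comp_inj_on)
  next
    fix e assume e: "e \<in> E"
    obtain u v where uv: "e = {u, v}" "arc (\<gamma> e)" "pathstart (\<gamma> e) = pos u" "pathfinish (\<gamma> e) = pos v"
      using plane_embedding_edge(1)[OF emb e] by blast
    have "arc (f \<circ> \<gamma> e)"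
      using uv(2) f X(2)[OF e] by (intro arc_compose) (auto intro: continuous_on_subset inj_on_subset)
    then show "\<exists>u v. e = {u, v} \<and> arc (f \<circ> \<gamma> e) \<and> pathstart (f \<circ> \<gamma> e) = (f \<circ> pos) u \<and> pathfinish (f \<circ> \<gamma> e) = (f \<circ> pos) v"
      using uv by (intro exI[of _ u] exI[of _ v]) (simp add: pathstart_compose pathfinish_compose)
    show "path_image (f \<circ> \<gamma> e) \<inter> (f \<circ> pos) ` V = (f \<circ> pos) ` e"
      using inj_on_image_Int[OF f(2) X(2)[OF e] X(1)] plane_embedding_edge(2)[OF emb e]
      by (simp only: path_image_compose image_comp[of f pos, symmetric])
  next
    fix e1 e2 assume e: "e1 \<in> E" "e2 \<in> E" "e1 \<noteq> e2"
    then show "path_image (f \<circ> \<gamma> e1) \<inter> path_image (f \<circ> \<gamma> e2) = (f \<circ> pos) ` (e1 \<inter> e2)"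
      using inj_on_image_Int[OF f(2) X(2)[OF e(1)] X(2)[OF e(2)]] plane_embedding_crossing[OF emb e]
      by (simp only: path_image_compose image_comp[of f pos, symmetric])
  qed
  show "drawing V E (f \<circ> pos) (\<lambda>e. f \<circ> \<gamma> e) = f ` drawing V E pos \<gamma>"
    by (simp add: drawing_def path_image_compose image_Un image_UN image_comp)
qed

section \<open>Inversion and spirals across the annulus\<close>

text \<open>Inversion in the circle of radius \<open>1 / sqrt 2\<close>. The conjugate makes it keep
  arguments, so the unit circle goes to radius 1/2 with all angles unchanged.\<close>

definition invert_half :: "complex \<Rightarrow> complex" where
  "invert_half z = inverse (2 * cnj z)"

lemma norm_invert_half: "norm (invert_half z) = inverse (2 * norm z)"
  by (simp add: invert_half_def norm_inverse norm_mult)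

lemma invert_half_cis: "invert_half (cis t) = cis t / 2"
  by (simp add: invert_half_def cis_cnj cis_mult field_simps)

lemma invert_half_cont_inj:
  "continuous_on (- {0}) invert_half" "inj_on invert_half (- {0})"
  unfolding invert_half_def by (auto intro!: continuous_intros inj_onI)

definition spiral :: "real \<Rightarrow> real \<Rightarrow> real \<Rightarrow> complex" where
  "spiral s t = (\<lambda>r. of_real (1 - r / 2) * cis ((1 - r) * s + r * t))"

lemma norm_spiral: "r \<le> 1 \<Longrightarrow> norm (spiral s t r) = 1 - r / 2"
  unfolding spiral_def norm_mult norm_of_real norm_cis by simp

lemma arc_spiral: "arc (spiral s t)"
  unfolding arc_def
proof
  show "path (spiral s t)"
    unfolding path_def spiral_def by (auto intro!: continuous_intros)
  show "inj_on (spiral s t) {0..1}"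
  proof (rule inj_onI)
    fix r r' assume r: "r \<in> {0..1}" "r' \<in> {0..1}" "spiral s t r = spiral s t r'"
    have "norm (spiral s t r) = 1 - r / 2" "norm (spiral s t r') = 1 - r' / 2"
      using r(1,2) by (simp_all add: norm_spiral)
    then show "r = r'"
      unfolding r(3) by linarith
  qed
qed

lemma spiral_ends: "pathstart (spiral s t) = cis s" "pathfinish (spiral s t) = cis t / 2"
  by (simp_all add: spiral_def pathstart_def pathfinish_def)

text \<open>Equal moduli force equal parameters. At a common parameter the angles differ by a convex
  combination of \<open>s' - s\<close> and \<open>t' - t\<close>, which lies strictly between 0 and
  \<open>2 * pi\<close>.\<close>

lemma spiral_disjoint:
  assumes "s < s'" "t < t'" "s' - s < 2 * pi" "t' - t < 2 * pi"
  shows "path_image (spiral s t) \<inter> path_image (spiral s' t') = {}"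
proof (rule ccontr)
  assume "path_image (spiral s t) \<inter> path_image (spiral s' t') \<noteq> {}"
  then obtain r r' where r: "r \<in> {0..1}" "r' \<in> {0..1}" "spiral s t r = spiral s' t' r'"
    unfolding path_image_def by blast
  have "norm (spiral s t r) = 1 - r / 2" "norm (spiral s' t' r') = 1 - r' / 2"
    using r(1,2) by (simp_all add: norm_spiral)
  then have "r' = r"
    unfolding r(3) by linarith
  then have eq: "cis ((1 - r) * s + r * t) = cis ((1 - r) * s' + r * t')"
  proof -
    have "of_real (1 - r / 2) \<noteq> (0::complex)"
      unfolding of_real_eq_0_iff using r(1) by simp
    then show ?thesis
      using r(3) unfolding \<open>r' = r\<close> spiral_def by (simp only: mult_cancel_left) simp
  qed
  define D where "D = (1 - r) * (s' - s) + r * (t' - t)"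
  have D: "((1 - r) * s' + r * t') - ((1 - r) * s + r * t) = D"
    by (simp add: D_def algebra_simps)
  define lo hi where "lo = min (s' - s) (t' - t)" and "hi = max (s' - s) (t' - t)"
  have "(1 - r) * lo + r * lo \<le> D" "D \<le> (1 - r) * hi + r * hi"
    unfolding D_def using r(1) by (auto intro!: add_mono mult_left_mono simp: lo_def hi_def)
  then have "lo \<le> D" "D \<le> hi" by (simp_all add: algebra_simps)
  moreover have "0 < lo" "hi < 2 * pi"
    using assms by (auto simp: lo_def hi_def)
  ultimately have D0: "0 < D" "D < 2 * pi" by auto
  then have "(1 - r) * s' + r * t' = (1 - r) * s + r * t"
    using D by (intro cis_eq_near eq[symmetric]) simp
  then show False
    using D D0 by simp
qed

text \<open>The clauses \<open>order\<close> are what \<open>spiral_disjoint\<close> needs for each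
  pair of legs: the same order of angles on both circles, within less than a full turn.\<close>

locale two_drawings =
  fixes V :: "'a set" and E pos \<gamma> and V' :: "'b set" and E' pos' \<gamma>'
    and S :: "'a set" and \<pi> :: "'a \<Rightarrow> 'b" and g \<theta> g' \<phi>
  assumes emb: "plane_embedding V E pos \<gamma>" "graph V E" "drawing V E pos \<gamma> \<inter> cball 0 1 = {}"
    and emb': "plane_embedding V' E' pos' \<gamma>'" "graph V' E'" "drawing V' E' pos' \<gamma>' \<inter> cball 0 1 = {}"
    and S: "S \<subseteq> V" "\<pi> ` S \<subseteq> V'" "inj_on \<pi> S"
    and legs: "circle_legs (drawing V E pos \<gamma>) pos S g \<theta>"
    and legs': "circle_legs (drawing V' E' pos' \<gamma>') (pos' \<circ> \<pi>) S g' \<phi>"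
    and order: "\<And>u v. u \<in> S \<Longrightarrow> v \<in> S \<Longrightarrow> \<theta> u < \<theta> v \<longleftrightarrow> \<phi> u < \<phi> v"
      "\<And>u v. u \<in> S \<Longrightarrow> v \<in> S \<Longrightarrow> \<theta> u - \<theta> v < 2 * pi"
      "\<And>u v. u \<in> S \<Longrightarrow> v \<in> S \<Longrightarrow> \<phi> u - \<phi> v < 2 * pi"
begin

definition "leg v = g v +++ spiral (\<theta> v) (\<phi> v) +++ reversepath (invert_half \<circ> g' v)"

lemma g:
  assumes "v \<in> S"
  shows "arc (g v)" "pathstart (g v) = pos v" "pathfinish (g v) = cis (\<theta> v)"
    "path_image (g v) \<inter> drawing V E pos \<gamma> = {pos v}"
    "path_image (g v) \<inter> cball 0 1 = {cis (\<theta> v)}"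
  using legs assms unfolding circle_legs_def by auto

lemma g':
  assumes "v \<in> S"
  shows "arc (g' v)" "pathstart (g' v) = pos' (\<pi> v)" "pathfinish (g' v) = cis (\<phi> v)"
    "path_image (g' v) \<inter> drawing V' E' pos' \<gamma>' = {pos' (\<pi> v)}"
    "path_image (g' v) \<inter> cball 0 1 = {cis (\<phi> v)}"
  using legs' assms unfolding circle_legs_def by auto

lemma g_norm:
  assumes "v \<in> S" "z \<in> path_image (g v)"
  shows "1 \<le> norm z" "norm z \<le> 1 \<Longrightarrow> z = cis (\<theta> v)"
proof -
  have *: "z = cis (\<theta> v)" if "norm z \<le> 1"
  proof -
    have "z \<in> path_image (g v) \<inter> cball 0 1" using assms(2) that by simp
    then show ?thesis unfolding g(5)[OF assms(1)] by simp
  qed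
  show "1 \<le> norm z" using * by (cases "norm z \<le> 1") auto
  show "norm z \<le> 1 \<Longrightarrow> z = cis (\<theta> v)" by (fact *)
qed

lemma g'_norm:
  assumes "v \<in> S" "z \<in> path_image (g' v)"
  shows "1 \<le> norm z" "norm z \<le> 1 \<Longrightarrow> z = cis (\<phi> v)"
proof -
  have *: "z = cis (\<phi> v)" if "norm z \<le> 1"
  proof -
    have "z \<in> path_image (g' v) \<inter> cball 0 1" using assms(2) that by simp
    then show ?thesis unfolding g'(5)[OF assms(1)] by simp
  qed
  show "1 \<le> norm z" using * by (cases "norm z \<le> 1") auto
  show "norm z \<le> 1 \<Longrightarrow> z = cis (\<phi> v)" by (fact *)
qed

definition "inner_leg v = invert_half ` path_image (g' v)"

lemma inner_leg_norm:
  assumes "v \<in> S" "z \<in> inner_leg v"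
  shows "norm z \<le> 1/2" "1/2 \<le> norm z \<Longrightarrow> z = cis (\<phi> v) / 2"
proof -
  obtain w where w: "w \<in> path_image (g' v)" "z = invert_half w"
    using assms(2) by (auto simp: inner_leg_def)
  note n = g'_norm[OF assms(1) w(1)]
  show "norm z \<le> 1/2"
    using n(1) w(2) le_imp_inverse_le[of 2 "2 * norm w"] by (simp add: norm_invert_half)
  show "z = cis (\<phi> v) / 2" if "1/2 \<le> norm z"
  proof -
    have "norm w \<le> 1"
    proof (rule ccontr)
      assume "\<not> norm w \<le> 1"
      then have "inverse (2 * norm w) < inverse 2"
        by (intro less_imp_inverse_less) auto
      then show False using that by (simp add: w(2) norm_invert_half)
    qed
    then show ?thesis using n(2) w(2) invert_half_cis by simp
  qed
qed

lemma spiral_norm: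
  assumes "z \<in> path_image (spiral s t)"
  shows "norm z \<le> 1" "1/2 \<le> norm z" "1 \<le> norm z \<Longrightarrow> z = cis s" "norm z \<le> 1/2 \<Longrightarrow> z = cis t / 2"
proof -
  obtain r where r: "0 \<le> r" "r \<le> 1" "z = spiral s t r"
    using assms by (auto simp: path_image_def)
  show "norm z \<le> 1" "1/2 \<le> norm z" using r norm_spiral[of r s t] by auto
  show "z = cis s" if "1 \<le> norm z"
  proof -
    have "r = 0" using that r norm_spiral[of r s t] by auto
    then show ?thesis using r(3) by (simp add: spiral_def)
  qed
  show "z = cis t / 2" if "norm z \<le> 1/2"
  proof -
    have "r = 1" using that r norm_spiral[of r s t] by auto
    then show ?thesis using r(3) by (simp add: spiral_def)
  qed
qed

lemma inner_leg_arc: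
  assumes "v \<in> S"
  shows "arc (invert_half \<circ> g' v)" "path_image (invert_half \<circ> g' v) = inner_leg v"
    "pathstart (invert_half \<circ> g' v) = invert_half (pos' (\<pi> v))"
    "pathfinish (invert_half \<circ> g' v) = cis (\<phi> v) / 2"
proof -
  have "path_image (g' v) \<subseteq> - {0}"
    using g'_norm[OF assms] by force
  then show "arc (invert_half \<circ> g' v)"
    using g'(1)[OF assms] invert_half_cont_inj
    by (intro arc_compose) (auto intro: continuous_on_subset inj_on_subset)
  show "path_image (invert_half \<circ> g' v) = inner_leg v"
    by (simp add: path_image_compose inner_leg_def)
qed (simp_all add: pathstart_compose pathfinish_compose g'[OF assms] invert_half_cis)

lemma leg:
  assumes "v \<in> S"
  shows "arc (leg v)" "pathstart (leg v) = pos v" "pathfinish (leg v) = invert_half (pos' (\<pi> v))"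
    "path_image (leg v) = path_image (g v) \<union> (path_image (spiral (\<theta> v) (\<phi> v)) \<union> inner_leg v)"
proof -
  let ?s = "spiral (\<theta> v) (\<phi> v)" and ?i = "reversepath (invert_half \<circ> g' v)"
  have st: "pathfinish ?s = pathstart ?i" "pathfinish (g v) = pathstart (?s +++ ?i)"
    by (simp_all add: inner_leg_arc[OF assms] g[OF assms] spiral_ends)
  have im: "path_image (?s +++ ?i) = path_image ?s \<union> inner_leg v"
    using st(1) by (simp add: path_image_join inner_leg_arc[OF assms])
  have "arc (?s +++ ?i)"
  proof (rule arc_join[OF arc_spiral _ st(1)])
    show "arc ?i" using inner_leg_arc[OF assms] by (simp add: arc_reversepath)
    show "path_image ?s \<inter> path_image ?i \<subseteq> {pathstart ?i}"
      using spiral_norm(2)[of _ "\<theta> v" "\<phi> v"] inner_leg_norm(2)[OF assms]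
      by (auto simp: inner_leg_arc[OF assms])
  qed
  then show "arc (leg v)"
    unfolding leg_def
  proof (rule arc_join[OF g(1)[OF assms] _ st(2)])
    show "path_image (g v) \<inter> path_image (?s +++ ?i) \<subseteq> {pathstart (?s +++ ?i)}"
    proof
      fix z assume z: "z \<in> path_image (g v) \<inter> path_image (?s +++ ?i)"
      then have "norm z \<le> 1"
        using inner_leg_norm(1)[OF assms, of z] spiral_norm(1)[of z "\<theta> v" "\<phi> v"] im by auto
      then show "z \<in> {pathstart (?s +++ ?i)}"
        using g_norm(2)[OF assms, of z] z by (simp add: spiral_ends)
    qed
  qed
  show "path_image (leg v) = path_image (g v) \<union> (path_image ?s \<union> inner_leg v)"
    unfolding leg_def using path_image_join[OF st(2)] im by simp
qed (simp_all add: leg_def g[OF assms] inner_leg_arc[OF assms])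

text \<open>The three pieces of a leg lie outside the unit disc, in the closed annulus and in the
  disc of radius 1/2, and overlap in the junctions only. So the modulus of a point tells which piece
  contains it, and disjointness can be checked zone by zone.\<close>

lemma leg_zones:
  assumes "v \<in> S" "z \<in> path_image (leg v)"
  shows "1 \<le> norm z \<Longrightarrow> z \<in> path_image (g v)" "norm z \<le> 1/2 \<Longrightarrow> z \<in> inner_leg v"
    "1/2 < norm z \<Longrightarrow> norm z < 1 \<Longrightarrow> z \<in> path_image (spiral (\<theta> v) (\<phi> v))"
proof -
  have cs: "cis (\<theta> v) \<in> path_image (g v)" "cis (\<phi> v) / 2 \<in> inner_leg v"
    using g(3) inner_leg_arc(2,4) assms(1) pathfinish_in_path_image by metis+
  note * = assms(2)[unfolded leg(4)[OF assms(1)]]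
  show "z \<in> path_image (g v)" if "1 \<le> norm z"
  proof -
    have "\<not> norm z \<le> 1/2" using that by simp
    then show ?thesis
      using * inner_leg_norm(1)[OF assms(1), of z] spiral_norm(3)[of z "\<theta> v" "\<phi> v"] that cs(1) by (metis Un_iff)
  qed
  show "z \<in> inner_leg v" if "norm z \<le> 1/2"
  proof -
    have "\<not> 1 \<le> norm z" using that by simp
    then show ?thesis
      using * g_norm(1)[OF assms(1), of z] spiral_norm(4)[of z "\<theta> v" "\<phi> v"] that cs(2) by (metis Un_iff)
  qed
  show "z \<in> path_image (spiral (\<theta> v) (\<phi> v))" if "1/2 < norm z" "norm z < 1"
    using * g_norm(1)[OF assms(1), of z] inner_leg_norm(1)[OF assms(1), of z] that by auto
qed

lemma g'_nonzero: "v \<in> S \<Longrightarrow> path_image (g' v) \<subseteq> - {0}"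
  using g'_norm(1)[of v 0] by auto

lemma drawing'_nonzero: "drawing V' E' pos' \<gamma>' \<subseteq> - {0}"
proof -
  have "0 \<notin> drawing V' E' pos' \<gamma>'"
    using emb'(3) by (metis IntI centre_in_cball emptyE zero_le_one)
  then show ?thesis by blast
qed

lemma leg_disjoint:
  assumes uv: "u \<in> S" "v \<in> S" "u \<noteq> v"
  shows "path_image (leg u) \<inter> path_image (leg v) = {}"
proof (rule ccontr)
  assume "path_image (leg u) \<inter> path_image (leg v) \<noteq> {}"
  then obtain z where z: "z \<in> path_image (leg u)" "z \<in> path_image (leg v)" by blast
  have gg: "path_image (g u) \<inter> path_image (g v) = {}" "path_image (g' u) \<inter> path_image (g' v) = {}"
    using legs legs' uv by (simp_all add: circle_legs_def)
  have "inner_leg u \<inter> inner_leg v = {}"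
    unfolding inner_leg_def using inj_on_image_Int[OF invert_half_cont_inj(2) g'_nonzero[OF uv(1)] g'_nonzero[OF uv(2)]] gg(2)
    by simp
  moreover have "path_image (spiral (\<theta> u) (\<phi> u)) \<inter> path_image (spiral (\<theta> v) (\<phi> v)) = {}"
  proof -
    have "\<theta> u \<noteq> \<theta> v"
    proof
      assume "\<theta> u = \<theta> v"
      then have "pathfinish (g u) = pathfinish (g v)" using g(3) uv by simp
      then show False using gg(1) pathfinish_in_path_image[of "g u"] pathfinish_in_path_image[of "g v"] by auto
    qed
    moreover have "\<phi> u \<noteq> \<phi> v"
    proof
      assume "\<phi> u = \<phi> v"
      then have "pathfinish (g' u) = pathfinish (g' v)" using g'(3) uv by simp
      then show False using gg(2) pathfinish_in_path_image[of "g' u"] pathfinish_in_path_image[of "g' v"] by auto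
    qed
    ultimately consider "\<theta> u < \<theta> v" "\<phi> u < \<phi> v" | "\<theta> v < \<theta> u" "\<phi> v < \<phi> u"
      using order(1) uv by (metis linorder_neqE_linordered_idom)
    then show ?thesis
      using spiral_disjoint order(2,3) uv by cases (blast, metis Int_commute)
  qed
  moreover consider "1 \<le> norm z" | "norm z \<le> 1/2" | "1/2 < norm z" "norm z < 1" by linarith
  ultimately show False
    using leg_zones[OF uv(1) z(1)] leg_zones[OF uv(2) z(2)] gg(1) by cases blast+
qed

definition "posI = case_sum pos (invert_half \<circ> pos')"
text \<open>An edge is recognised by the summands it meets, a mixed one by its left end. The empty
  set lies in both ranges, which is why \<open>curve_simps\<close> asks for a nonempty right
  edge.\<close>

definition "curve e = (if e \<subseteq> range Inl then \<gamma> (Inl -` e) else if e \<subseteq> range Inr then invert_half \<circ> \<gamma>' (Inr -` e)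
   else leg (the_elem (Inl -` e)))"

lemma curve_simps:
  "curve (Inl ` e) = \<gamma> e" "e' \<noteq> {} \<Longrightarrow> curve (Inr ` e') = invert_half \<circ> \<gamma>' e'" "curve {Inl v, Inr w} = leg v"
proof -
  have "(Inl :: 'a \<Rightarrow> 'a + 'b) -` Inl ` e = e" "(Inl ` e :: ('a + 'b) set) \<subseteq> range Inl"
    by (simp_all add: inj_vimage_image_eq image_mono)
  then show "curve (Inl ` e) = \<gamma> e"
    by (simp add: curve_def)
  show "curve (Inr ` e') = invert_half \<circ> \<gamma>' e'" if "e' \<noteq> {}"
  proof -
    have "(Inr :: 'b \<Rightarrow> 'a + 'b) -` Inr ` e' = e'" "(Inr ` e' :: ('a + 'b) set) \<subseteq> range Inr"
      by (simp_all add: inj_vimage_image_eq image_mono)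
    moreover have "\<not> (Inr ` e' :: ('a + 'b) set) \<subseteq> range Inl"
      using that by blast
    ultimately show ?thesis
      by (simp add: curve_def)
  qed
  have "Inl -` {Inl v, Inr w} = {v}"
    by blast
  moreover have "\<not> {Inl v, Inr w} \<subseteq> range Inl" "\<not> {Inl v, Inr w} \<subseteq> range Inr"
    by blast+
  ultimately show "curve {Inl v, Inr w} = leg v"
    by (simp add: curve_def)
qed

text \<open>The outer drawing has moduli above 1 and the inverted one below 1/2, so they are
  disjoint, and a leg meets each of them only through its own outer or inner piece.\<close>

lemma planar_union:
  "planar (Inl ` V \<union> Inr ` V') (image Inl ` E \<union> image Inr ` E' \<union> (\<lambda>v. {Inl v, Inr (\<pi> v)}) ` S)"
proof -
  let ?K = "drawing V E pos \<gamma>" and ?L = "invert_half ` drawing V' E' pos' \<gamma>'"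
  let ?V = "Inl ` V \<union> Inr ` V'" and ?E = "image Inl ` E \<union> image Inr ` E' \<union> (\<lambda>v. {Inl v, Inr (\<pi> v)}) ` S"
  note emb2 = plane_embedding_image[OF emb'(1,2) invert_half_cont_inj drawing'_nonzero]
  have K1: "1 < norm z" if "z \<in> ?K" for z
  proof -
    have "z \<notin> cball 0 1" using emb(3) that by blast
    then show ?thesis by simp
  qed
  have L1: "norm z < 1/2" if "z \<in> ?L" for z
  proof -
    obtain w where w: "w \<in> drawing V' E' pos' \<gamma>'" "z = invert_half w" using \<open>z \<in> ?L\<close> by blast
    then have "w \<notin> cball 0 1" using emb'(3) by blast
    then have "1 < norm w" by simp
    then have "inverse (2 * norm w) < inverse 2" by (intro less_imp_inverse_less) auto
    then show ?thesis by (simp add: w(2) norm_invert_half)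
  qed
  have KL: "?K \<inter> ?L = {}"
  proof -
    have False if "z \<in> ?K" "z \<in> ?L" for z
      using K1[OF that(1)] L1[OF that(2)] by linarith
    then show ?thesis by blast
  qed
  have disjoint_sub: "A \<inter> B = {}" if "A \<subseteq> ?K" "B \<subseteq> ?L" for A B
    using that KL by blast
  have Int_sub: "A \<inter> B' = {x}" if AB: "A \<inter> B = {x}" and "B' \<subseteq> B" "x \<in> B'" for A B B' :: "complex set" and x
  proof -
    have "A \<inter> B' = (A \<inter> B) \<inter> B'" using \<open>B' \<subseteq> B\<close> by blast
    then show ?thesis using \<open>x \<in> B'\<close> unfolding AB by simp
  qed
  \<comment> \<open>What an edge shares with a leg lies in the drawing \<open>B\<close>, where the
    leg has only its vertex \<open>p v\<close>. The claim is generic because it serves both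
    drawings.\<close>
  have edge_leg: "A \<inter> L = p ` (e \<inter> {v})"
    if "A \<subseteq> B" and LB: "L \<inter> B = {p v}" and A: "A \<inter> p ` X = p ` e" and X: "e \<subseteq> X" "v \<in> X" "inj_on p X"
    for A L B :: "complex set" and p :: "'c \<Rightarrow> complex" and X e v
  proof -
    have "A \<inter> L = A \<inter> (L \<inter> B)"
      using \<open>A \<subseteq> B\<close> by blast
    also have "\<dots> = (A \<inter> p ` X) \<inter> {p v}"
      unfolding LB using X(2) by blast
    also have "\<dots> = p ` e \<inter> p ` {v}"
      unfolding A by simp
    also have "\<dots> = p ` (e \<inter> {v})"
      using inj_on_image_Int[OF X(3,1), of "{v}"] X(2) by simp
    finally show ?thesis .
  qed
  have V: "pos ` V \<subseteq> ?K" "(invert_half \<circ> pos') ` V' \<subseteq> ?L"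
    using vertices_in_drawing[of pos V E \<gamma>] vertices_in_drawing[of "invert_half \<circ> pos'" V' E' "\<lambda>e. invert_half \<circ> \<gamma>' e"]
    unfolding emb2(2) by auto
  have posV: "posI ` ?V = pos ` V \<union> (invert_half \<circ> pos') ` V'"
    by (simp add: posI_def image_Un image_comp)
  have curK: "path_image (curve (Inl ` e)) \<subseteq> ?K" if "e \<in> E" for e
    using edge_path_in_drawing[OF that, of \<gamma> V pos] by (simp add: curve_simps)
  have ne': "e \<noteq> {}" if "e \<in> E'" for e using graph_edge_nonempty[OF emb'(2) that] .
  have curL: "path_image (curve (Inr ` e)) \<subseteq> ?L" if "e \<in> E'" for e
    using edge_path_in_drawing[OF that, of "\<lambda>e. invert_half \<circ> \<gamma>' e" V' "invert_half \<circ> pos'"]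
    unfolding emb2(2) by (simp add: curve_simps ne'[OF that])
  have legK: "path_image (leg v) \<inter> ?K = {pos v}" if v: "v \<in> S" for v
  proof -
    have "path_image (leg v) \<inter> ?K = path_image (g v) \<inter> ?K"
      using leg_zones(1)[OF v] K1 leg(4)[OF v] by (auto dest: less_imp_le)
    then show ?thesis using g(4)[OF v] by simp
  qed
  have legL: "path_image (leg v) \<inter> ?L = {invert_half (pos' (\<pi> v))}" if v: "v \<in> S" for v
  proof -
    have "path_image (leg v) \<inter> ?L = inner_leg v \<inter> ?L"
      using leg_zones(2)[OF v] L1 leg(4)[OF v] by (auto dest: less_imp_le)
    also have "\<dots> = invert_half ` (path_image (g' v) \<inter> drawing V' E' pos' \<gamma>')"
      unfolding inner_leg_def using inj_on_image_Int[OF invert_half_cont_inj(2) g'_nonzero[OF v] drawing'_nonzero] by simp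
    finally show ?thesis using g'(4)[OF v] by simp
  qed
  have edgeK: "path_image (\<gamma> e) \<inter> pos ` V = pos ` e" if "e \<in> E" for e
    by (rule plane_embedding_edge(2)[OF emb(1) that])
  have edgeL: "path_image (invert_half \<circ> \<gamma>' e) \<inter> (invert_half \<circ> pos') ` V' = (invert_half \<circ> pos') ` e" if "e \<in> E'" for e
    by (rule plane_embedding_edge(2)[OF emb2(1) that])
  have edge_cases: "(\<exists>e0\<in>E. e = Inl ` e0) \<or> (\<exists>e0\<in>E'. e = Inr ` e0) \<or> (\<exists>v\<in>S. e = {Inl v, Inr (\<pi> v)})"
    if "e \<in> ?E" for e
    using that by (simp only: Un_iff image_iff disj_assoc)
  have "plane_embedding ?V ?E posI curve"
  proof (rule plane_embeddingI)
    show "inj_on posI ?V"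
    proof (rule inj_onI)
      fix s t assume st: "s \<in> ?V" "t \<in> ?V" "posI s = posI t"
      have inj1: "inj_on pos V" "inj_on (invert_half \<circ> pos') V'"
        using plane_embedding_inj[OF emb(1)] plane_embedding_inj[OF emb2(1)] .
      have ne: "pos v \<noteq> (invert_half \<circ> pos') w" if "v \<in> V" "w \<in> V'" for v w
      proof -
        have "pos v \<in> ?K" "(invert_half \<circ> pos') w \<in> ?L"
          using V that by blast+
        then show ?thesis
          using KL by (metis disjoint_iff)
      qed
      show "s = t"
      proof (cases s)
        case s: (Inl v)
        show ?thesis
        proof (cases t)
          case (Inl w)
          then show ?thesis
            using st s inj_onD[OF inj1(1), of v w] by (auto simp: posI_def)
        next
          case (Inr w)
          then show ?thesis
            using st s ne[of v w] by (auto simp: posI_def)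
        qed
      next
        case s: (Inr v)
        show ?thesis
        proof (cases t)
          case (Inl w)
          have "posI t = pos w" "posI s = (invert_half \<circ> pos') v" "w \<in> V" "v \<in> V'"
            using st(1,2) s Inl by (auto simp: posI_def)
          then show ?thesis
            using st(3) ne[of w v] by simp
        next
          case (Inr w)
          then show ?thesis
            using st s inj_onD[OF inj1(2), of v w] by (auto simp: posI_def)
        qed
      qed
    qed
  next
    fix e assume e: "e \<in> ?E"
    consider (1) e0 where "e0 \<in> E" "e = Inl ` e0" | (2) e0 where "e0 \<in> E'" "e = Inr ` e0"
      | (3) v where "v \<in> S" "e = {Inl v, Inr (\<pi> v)}"
      using edge_cases[OF e] by metis
    then have "(\<exists>u v. e = {u, v} \<and> arc (curve e) \<and> pathstart (curve e) = posI u \<and> pathfinish (curve e) = posI v) \<and>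
      path_image (curve e) \<inter> posI ` ?V = posI ` e"
    proof cases
      case 1
      obtain u v where uv: "e0 = {u, v}" "arc (\<gamma> e0)" "pathstart (\<gamma> e0) = pos u" "pathfinish (\<gamma> e0) = pos v"
        using plane_embedding_edge(1)[OF emb(1) 1(1)] by (elim exE conjE)
      have "e = {Inl u, Inl v} \<and> arc (curve e) \<and> pathstart (curve e) = posI (Inl u) \<and> pathfinish (curve e) = posI (Inl v)"
        using uv(2-4) unfolding 1(2) curve_simps by (simp add: uv(1) posI_def)
      moreover have "path_image (curve e) \<inter> posI ` ?V = posI ` e"
      proof -
        have "path_image (\<gamma> e0) \<inter> (invert_half \<circ> pos') ` V' = {}"
          using disjoint_sub[OF curK[OF 1(1)] V(2)] by (simp only: curve_simps)
        then have "path_image (curve e) \<inter> posI ` ?V = path_image (\<gamma> e0) \<inter> pos ` V"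
          by (simp only: posV 1(2) curve_simps Int_Un_distrib Un_empty_right)
        also have "\<dots> = pos ` e0"
          by (rule edgeK[OF 1(1)])
        finally show ?thesis by (simp add: 1(2) posI_def image_comp)
      qed
      ultimately show ?thesis by blast
    next
      case 2
      obtain u v where uv: "e0 = {u, v}" "arc (invert_half \<circ> \<gamma>' e0)" "pathstart (invert_half \<circ> \<gamma>' e0) = (invert_half \<circ> pos') u"
        "pathfinish (invert_half \<circ> \<gamma>' e0) = (invert_half \<circ> pos') v"
        using plane_embedding_edge(1)[OF emb2(1) 2(1)] by (elim exE conjE)
      have "e = {Inr u, Inr v} \<and> arc (curve e) \<and> pathstart (curve e) = posI (Inr u) \<and> pathfinish (curve e) = posI (Inr v)"
        using uv(2-4) unfolding 2(2) curve_simps(2)[OF ne'[OF 2(1)]] by (simp add: uv(1) posI_def)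
      moreover have "path_image (curve e) \<inter> posI ` ?V = posI ` e"
      proof -
        have "path_image (invert_half \<circ> \<gamma>' e0) \<inter> pos ` V = {}"
          using disjoint_sub[OF V(1) curL[OF 2(1)]]
          by (simp only: curve_simps(2)[OF ne'[OF 2(1)]] Int_commute)
        then have "path_image (curve e) \<inter> posI ` ?V = path_image (invert_half \<circ> \<gamma>' e0) \<inter> (invert_half \<circ> pos') ` V'"
          by (simp only: posV 2(2) curve_simps(2)[OF ne'[OF 2(1)]] Int_Un_distrib Un_empty_left)
        also have "\<dots> = (invert_half \<circ> pos') ` e0"
          by (rule edgeL[OF 2(1)])
        finally show ?thesis by (simp add: 2(2) posI_def image_comp)
      qed
      ultimately show ?thesis by blast
    next
      case 3
      have mem: "pos v \<in> pos ` V" "invert_half (pos' (\<pi> v)) \<in> (invert_half \<circ> pos') ` V'"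
        using S 3(1) by auto
      have "path_image (curve e) \<inter> posI ` ?V = posI ` e"
      proof -
        have "path_image (leg v) \<inter> pos ` V = {pos v}"
          by (rule Int_sub[OF legK[OF 3(1)] V(1) mem(1)])
        moreover have "path_image (leg v) \<inter> (invert_half \<circ> pos') ` V' = {invert_half (pos' (\<pi> v))}"
          by (rule Int_sub[OF legL[OF 3(1)] V(2) mem(2)])
        ultimately show ?thesis
          unfolding posV 3(2) curve_simps Int_Un_distrib by (simp add: posI_def insert_commute)
      qed
      moreover have "e = {Inl v, Inr (\<pi> v)} \<and> arc (curve e) \<and> pathstart (curve e) = posI (Inl v) \<and> pathfinish (curve e) = posI (Inr (\<pi> v))"
        using leg[OF 3(1)] by (simp add: 3(2) curve_simps posI_def)
      ultimately show ?thesis by blast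
    qed
    then show "\<exists>u v. e = {u, v} \<and> arc (curve e) \<and> pathstart (curve e) = posI u \<and> pathfinish (curve e) = posI v"
      "path_image (curve e) \<inter> posI ` ?V = posI ` e" by blast+
  next
    have II: "path_image (curve (Inl ` e1)) \<inter> path_image (curve (Inl ` e2)) = posI ` (Inl ` e1 \<inter> Inl ` e2)"
      if "e1 \<in> E" "e2 \<in> E" "e1 \<noteq> e2" for e1 e2
      using plane_embedding_crossing[OF emb(1) that]
      by (simp add: curve_simps image_Int[symmetric] posI_def image_comp)
    have RR: "path_image (curve (Inr ` e1)) \<inter> path_image (curve (Inr ` e2)) = posI ` (Inr ` e1 \<inter> Inr ` e2)"
      if "e1 \<in> E'" "e2 \<in> E'" "e1 \<noteq> e2" for e1 e2
      using plane_embedding_crossing[OF emb2(1) that]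
      by (simp add: curve_simps ne' that image_Int[symmetric] posI_def image_comp)
    have IR: "path_image (curve (Inl ` e1)) \<inter> path_image (curve (Inr ` e2)) = posI ` (Inl ` e1 \<inter> Inr ` e2)"
      if "e1 \<in> E" "e2 \<in> E'" for e1 e2
    proof -
      have "path_image (curve (Inl ` e1)) \<inter> path_image (curve (Inr ` e2)) = {}"
        by (rule disjoint_sub[OF curK[OF that(1)] curL[OF that(2)]])
      moreover have "Inl ` e1 \<inter> Inr ` e2 = {}" by auto
      ultimately show ?thesis by simp
    qed
    have IC: "path_image (curve (Inl ` e)) \<inter> path_image (curve {Inl v, Inr (\<pi> v)}) = posI ` (Inl ` e \<inter> {Inl v, Inr (\<pi> v)})"
      if e: "e \<in> E" and v: "v \<in> S" for e v
    proof -
      have "path_image (\<gamma> e) \<inter> path_image (leg v) = pos ` (e \<inter> {v})"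
        by (rule edge_leg[OF curK[OF e, unfolded curve_simps] legK[OF v] edgeK[OF e] graph_edge_subset[OF emb(2) e]
              subsetD[OF S(1) v] plane_embedding_inj[OF emb(1)]])
      moreover have "Inl ` e \<inter> {Inl v, Inr (\<pi> v)} = Inl ` (e \<inter> {v})" by auto
      ultimately show ?thesis by (simp add: curve_simps posI_def image_comp)
    qed
    have RC: "path_image (curve (Inr ` e)) \<inter> path_image (curve {Inl v, Inr (\<pi> v)}) = posI ` (Inr ` e \<inter> {Inl v, Inr (\<pi> v)})"
      if e: "e \<in> E'" and v: "v \<in> S" for e v
    proof -
      let ?p = "invert_half \<circ> pos'"
      have pv: "\<pi> v \<in> V'" using S(2) v by blast
      have "path_image (invert_half \<circ> \<gamma>' e) \<inter> path_image (leg v) = ?p ` (e \<inter> {\<pi> v})"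
        by (rule edge_leg[OF curL[OF e, unfolded curve_simps(2)[OF ne'[OF e]]] _ edgeL[OF e] graph_edge_subset[OF emb'(2) e]
              pv plane_embedding_inj[OF emb2(1)]]) (use legL[OF v] in simp)
      moreover have "Inr ` e \<inter> {Inl v, Inr (\<pi> v)} = Inr ` (e \<inter> {\<pi> v})" by auto
      ultimately show ?thesis by (simp add: curve_simps ne'[OF e] posI_def image_comp)
    qed
    have CC: "path_image (curve {Inl u, Inr (\<pi> u)}) \<inter> path_image (curve {Inl v, Inr (\<pi> v)}) = posI ` ({Inl u, Inr (\<pi> u)} \<inter> {Inl v, Inr (\<pi> v)})"
      if uv: "u \<in> S" "v \<in> S" "u \<noteq> v" for u v
    proof -
      have "\<pi> u \<noteq> \<pi> v" using S(3) uv by (auto simp: inj_on_def)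
      then show ?thesis using leg_disjoint[OF uv] uv(3) by (simp add: curve_simps)
    qed
    fix e1 e2 assume e: "e1 \<in> ?E" "e2 \<in> ?E" "e1 \<noteq> e2"
    consider (1) e where "e \<in> E" "e1 = Inl ` e" | (2) e where "e \<in> E'" "e1 = Inr ` e"
      | (3) v where "v \<in> S" "e1 = {Inl v, Inr (\<pi> v)}"
      using edge_cases[OF e(1)] by metis
    note c1 = this
    consider (1) e where "e \<in> E" "e2 = Inl ` e" | (2) e where "e \<in> E'" "e2 = Inr ` e"
      | (3) v where "v \<in> S" "e2 = {Inl v, Inr (\<pi> v)}"
      using edge_cases[OF e(2)] by metis
    note c2 = this
    show "path_image (curve e1) \<inter> path_image (curve e2) = posI ` (e1 \<inter> e2)"
      using c1
    proof cases
      case f: (1 f)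
      from c2 show ?thesis
      proof cases
        case h: (1 h)
        then have ne: "f \<noteq> h" using f e(3) by blast
        show ?thesis using II[OF f(1) h(1) ne] unfolding f(2) h(2) .
      next
        case h: (2 h)
        show ?thesis using IR[OF f(1) h(1)] unfolding f(2) h(2) .
      next
        case w: (3 w)
        show ?thesis using IC[OF f(1) w(1)] unfolding f(2) w(2) .
      qed
    next
      case f: (2 f)
      from c2 show ?thesis
      proof cases
        case h: (1 h)
        show ?thesis using IR[OF h(1) f(1)] unfolding f(2) h(2) by (simp only: Int_commute)
      next
        case h: (2 h)
        then have ne: "f \<noteq> h" using f e(3) by blast
        show ?thesis using RR[OF f(1) h(1) ne] unfolding f(2) h(2) .
      next
        case w: (3 w)
        show ?thesis using RC[OF f(1) w(1)] unfolding f(2) w(2) .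
      qed
    next
      case v: (3 v)
      from c2 show ?thesis
      proof cases
        case h: (1 h)
        show ?thesis using IC[OF h(1) v(1)] unfolding v(2) h(2) by (simp only: Int_commute)
      next
        case h: (2 h)
        show ?thesis using RC[OF h(1) v(1)] unfolding v(2) h(2) by (simp only: Int_commute)
      next
        case w: (3 w)
        then have ne: "v \<noteq> w" using v e(3) by blast
        show ?thesis using CC[OF v(1) w(1) ne] unfolding v(2) w(2) .
      qed
    qed
  qed
  then show ?thesis unfolding planar_def by blast
qed

end

text \<open>The angles are real numbers in an interval of length less than \<open>2 * pi\<close>, so that their linear order
  represents the cyclic order of the ends of the legs.\<close>

definition four_legged :: "'v set \<Rightarrow> 'v set set \<Rightarrow> 'v \<Rightarrow> 'v \<Rightarrow> 'v \<Rightarrow> 'v \<Rightarrow> bool" where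
  "four_legged V E a b c d \<longleftrightarrow> (\<exists>pos \<gamma> g \<theta>. plane_embedding V E pos \<gamma> \<and>
     drawing V E pos \<gamma> \<inter> cball 0 1 = {} \<and> circle_legs (drawing V E pos \<gamma>) pos {a, b, c, d} g \<theta> \<and>
     (\<forall>u\<in>{a, b}. \<forall>v\<in>{c, d}. \<theta> u < \<theta> v) \<and>
     (\<forall>u\<in>{a, b, c, d}. \<forall>v\<in>{a, b, c, d}. \<theta> u - \<theta> v < 2 * pi))"

section \<open>Matching the leg orders of two drawings\<close>

lemma four_leggedI:
  assumes emb: "plane_embedding V E pos \<gamma>" and G: "graph V E"
    and P: "arc P" "pathstart P = pos a" "pathfinish P = pos b" "path_image P \<inter> drawing V E pos \<gamma> = {pos a, pos b}"
    and Q: "arc Q" "pathstart Q = pos c" "pathfinish Q = pos d" "path_image Q \<inter> drawing V E pos \<gamma> = {pos c, pos d}"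
    and PQ: "path_image P \<inter> path_image Q = {}"
    and W: "open W" "connected W" "W \<inter> drawing V E pos \<gamma> = {}" "W \<inter> path_image P = {}"
    and y: "y \<in> W" "y \<in> path_image Q" and x: "x \<in> path_image P" "x \<notin> drawing V E pos \<gamma>" "x \<in> closure W"
    and abcd: "distinct [a, b, c, d]"
  shows "four_legged V E a b c d"
proof (rule circle_legs_exist[OF compact_drawing[OF emb G] P Q PQ W y x abcd])
  fix T g \<theta>
  assume T: "inj T" "continuous_on UNIV T" "T ` drawing V E pos \<gamma> \<inter> cball 0 1 = {}"
    and legs: "circle_legs (T ` drawing V E pos \<gamma>) (T \<circ> pos) {a, b, c, d} g \<theta>"
    and ord: "\<And>u v. u \<in> {a, b} \<Longrightarrow> v \<in> {c, d} \<Longrightarrow> \<theta> u < \<theta> v"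
      "\<And>u v. u \<in> {a, b, c, d} \<Longrightarrow> v \<in> {a, b, c, d} \<Longrightarrow> \<theta> u - \<theta> v < 2 * pi"
  note im = plane_embedding_image[OF emb G T(2,1) subset_UNIV]
  show ?thesis
    unfolding four_legged_def
    by (rule exI[of _ "T \<circ> pos"], rule exI[of _ "\<lambda>e. T \<circ> \<gamma> e"], rule exI[of _ g], rule exI[of _ \<theta>])
      (intro conjI ballI im(1) ord T(3)[folded im(2)] legs[folded im(2)])
qed

lemma circle_legs_angles_neq:
  assumes "circle_legs K q S g \<theta>" "u \<in> S" "v \<in> S" "u \<noteq> v"
  shows "\<theta> u \<noteq> \<theta> v"
proof
  assume "\<theta> u = \<theta> v"
  then have "pathfinish (g u) = pathfinish (g v)"
    using assms unfolding circle_legs_def by simp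
  moreover have "path_image (g u) \<inter> path_image (g v) = {}"
    using assms unfolding circle_legs_def by simp
  ultimately show False
    using pathfinish_in_path_image[of "g u"] pathfinish_in_path_image[of "g v"] by auto
qed

text \<open>In both drawings the first pair of angles precedes the second, so only the orders within
  the pairs can disagree. Exchanging \<open>a'\<close> with \<open>b'\<close>, or \<open>c'\<close>
  with \<open>d'\<close>, repairs each independently.\<close>

lemma planar_four_legged:
  assumes H: "graph V E" "four_legged V E a b c d" and H': "graph V' E'" "four_legged V' E' a' b' c' d'"
    and S: "{a, b, c, d} \<subseteq> V" "distinct [a, b, c, d]" and S': "{a', b', c', d'} \<subseteq> V'" "distinct [a', b', c', d']"
  shows "\<exists>a'' b'' c'' d''. {a'', b''} = {a', b'} \<and> {c'', d''} = {c', d'} \<and>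
    planar (Inl ` V \<union> Inr ` V') (image Inl ` E \<union> image Inr ` E' \<union>
      {{Inl a, Inr a''}, {Inl b, Inr b''}, {Inl c, Inr c''}, {Inl d, Inr d''}})"
proof -
  obtain pos \<gamma> g \<theta> where 1: "plane_embedding V E pos \<gamma>"
     "drawing V E pos \<gamma> \<inter> cball 0 1 = {}" "circle_legs (drawing V E pos \<gamma>) pos {a, b, c, d} g \<theta>"
     "\<forall>u\<in>{a, b}. \<forall>v\<in>{c, d}. \<theta> u < \<theta> v"
     "\<forall>u\<in>{a, b, c, d}. \<forall>v\<in>{a, b, c, d}. \<theta> u - \<theta> v < 2 * pi"
    using H(2) unfolding four_legged_def by (elim exE conjE)
  obtain pos' \<gamma>' g' \<phi> where 2: "plane_embedding V' E' pos' \<gamma>'"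
     "drawing V' E' pos' \<gamma>' \<inter> cball 0 1 = {}" "circle_legs (drawing V' E' pos' \<gamma>') pos' {a', b', c', d'} g' \<phi>"
     "\<forall>u\<in>{a', b'}. \<forall>v\<in>{c', d'}. \<phi> u < \<phi> v"
     "\<forall>u\<in>{a', b', c', d'}. \<forall>v\<in>{a', b', c', d'}. \<phi> u - \<phi> v < 2 * pi"
    using H'(2) unfolding four_legged_def by (elim exE conjE)
  have ne: "\<theta> a \<noteq> \<theta> b" "\<theta> c \<noteq> \<theta> d" "\<phi> a' \<noteq> \<phi> b'" "\<phi> c' \<noteq> \<phi> d'"
    using circle_legs_angles_neq[OF 1(3)] circle_legs_angles_neq[OF 2(3)] S(2) S'(2) by auto
  have swap: "\<exists>u'' v''. {u'', v''} = {u', v'} \<and> (p \<longleftrightarrow> \<phi> u'' < \<phi> v'')" if "\<phi> u' \<noteq> \<phi> v'" for u' v' p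
  proof (cases "p \<longleftrightarrow> \<phi> u' < \<phi> v'")
    case True then show ?thesis by blast
  next
    case False
    then have "p \<longleftrightarrow> \<phi> v' < \<phi> u'" using that by auto
    then show ?thesis by (intro exI[of _ v'] exI[of _ u']) (simp add: insert_commute)
  qed
  obtain a'' b'' where ab: "{a'', b''} = {a', b'}" "\<theta> a < \<theta> b \<longleftrightarrow> \<phi> a'' < \<phi> b''"
    using swap[OF ne(3)] by metis
  obtain c'' d'' where cd: "{c'', d''} = {c', d'}" "\<theta> c < \<theta> d \<longleftrightarrow> \<phi> c'' < \<phi> d''"
    using swap[OF ne(4)] by metis
  have set4: "{a', b', c', d'} = {a'', b'', c'', d''}"
    using ab(1) cd(1) by (metis Un_insert_left sup_bot_left)
  have dist: "distinct [a'', b'', c'', d'']"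
    using ab(1) cd(1) S'(2) by (auto simp: doubleton_eq_iff)
  have ne'': "\<phi> a'' \<noteq> \<phi> b''" "\<phi> c'' \<noteq> \<phi> d''"
    using ab(1) cd(1) ne(3,4) by (auto simp: doubleton_eq_iff)
  define \<pi> where "\<pi> = (\<lambda>v. if v = a then a'' else if v = b then b'' else if v = c then c'' else d'')"
  have \<pi>: "\<pi> a = a''" "\<pi> b = b''" "\<pi> c = c''" "\<pi> d = d''"
    using S(2) by (auto simp: \<pi>_def)
  have img: "\<pi> ` {a, b, c, d} = {a', b', c', d'}"
    unfolding set4 by (simp add: \<pi>)
  have inj: "inj_on \<pi> {a, b, c, d}"
    using dist by (auto simp: inj_on_def \<pi>)
  have lt1: "\<theta> a < \<theta> c" "\<theta> a < \<theta> d" "\<theta> b < \<theta> c" "\<theta> b < \<theta> d" using 1(4) by auto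
  have "\<forall>u\<in>{a'', b''}. \<forall>v\<in>{c'', d''}. \<phi> u < \<phi> v" using 2(4) unfolding ab(1) cd(1) .
  then have lt2: "\<phi> a'' < \<phi> c''" "\<phi> a'' < \<phi> d''" "\<phi> b'' < \<phi> c''" "\<phi> b'' < \<phi> d''" by auto
  have "two_drawings V E pos \<gamma> V' E' pos' \<gamma>' {a, b, c, d} \<pi> g \<theta> (g' \<circ> \<pi>) (\<phi> \<circ> \<pi>)"
  proof
    show "\<pi> ` {a, b, c, d} \<subseteq> V'" unfolding img by (fact S'(1))
    show "circle_legs (drawing V' E' pos' \<gamma>') (pos' \<circ> \<pi>) {a, b, c, d} (g' \<circ> \<pi>) (\<phi> \<circ> \<pi>)"
      unfolding circle_legs_def
    proof (intro conjI ballI impI)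
      fix v assume "v \<in> {a, b, c, d}"
      then have v: "\<pi> v \<in> {a', b', c', d'}" unfolding img[symmetric] by (rule imageI)
      note * = bspec[OF conjunct1[OF 2(3)[unfolded circle_legs_def]] v]
      show "arc ((g' \<circ> \<pi>) v)" "pathstart ((g' \<circ> \<pi>) v) = (pos' \<circ> \<pi>) v" "pathfinish ((g' \<circ> \<pi>) v) = cis ((\<phi> \<circ> \<pi>) v)"
        "path_image ((g' \<circ> \<pi>) v) \<inter> drawing V' E' pos' \<gamma>' = {(pos' \<circ> \<pi>) v}"
        "path_image ((g' \<circ> \<pi>) v) \<inter> cball 0 1 = {cis ((\<phi> \<circ> \<pi>) v)}"
        using * by simp_all
    next
      fix u v assume uv: "u \<in> {a, b, c, d}" "v \<in> {a, b, c, d}" "u \<noteq> v"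
      have "\<pi> u \<in> {a', b', c', d'}" "\<pi> v \<in> {a', b', c', d'}"
        unfolding img[symmetric] using imageI[OF uv(1), of \<pi>] imageI[OF uv(2), of \<pi>] by simp_all
      moreover have "\<pi> u \<noteq> \<pi> v"
        using inj uv by (meson inj_onD)
      ultimately show "path_image ((g' \<circ> \<pi>) u) \<inter> path_image ((g' \<circ> \<pi>) v) = {}"
        unfolding comp_def by (rule 2(3)[unfolded circle_legs_def, THEN conjunct2, rule_format])
    qed
    show "\<theta> u < \<theta> v \<longleftrightarrow> (\<phi> \<circ> \<pi>) u < (\<phi> \<circ> \<pi>) v" if "u \<in> {a, b, c, d}" "v \<in> {a, b, c, d}" for u v
    proof -
      \<comment> \<open>The angles within a pair differ, so agreement of one comparison yields
        agreement of the reversed one.\<close>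
      have lt: "\<theta> b < \<theta> a \<longleftrightarrow> \<phi> b'' < \<phi> a''" "\<theta> d < \<theta> c \<longleftrightarrow> \<phi> d'' < \<phi> c''"
        using ab(2) cd(2) ne(1,2) ne'' by linarith+
      show ?thesis
        using that by (elim insertE emptyE; hypsubst; unfold comp_def \<pi>; use lt lt1 lt2 ab(2) cd(2) in linarith)
    qed
    show "\<theta> u - \<theta> v < 2 * pi" if "u \<in> {a, b, c, d}" "v \<in> {a, b, c, d}" for u v
      using 1(5) that by blast
    show "(\<phi> \<circ> \<pi>) u - (\<phi> \<circ> \<pi>) v < 2 * pi" if "u \<in> {a, b, c, d}" "v \<in> {a, b, c, d}" for u v
      unfolding comp_def
      by (rule bspec[OF bspec[OF 2(5)]]; unfold img[symmetric]; rule imageI; fact that)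
  qed (use 1 2 H H' S(1) inj in simp_all)
  then have pl: "planar (Inl ` V \<union> Inr ` V') (image Inl ` E \<union> image Inr ` E' \<union> (\<lambda>v. {Inl v, Inr (\<pi> v)}) ` {a, b, c, d})"
    by (rule two_drawings.planar_union)
  have img2: "(\<lambda>v. {Inl v, Inr (\<pi> v)}) ` {a, b, c, d} = {{Inl a, Inr a''}, {Inl b, Inr b''}, {Inl c, Inr c''}, {Inl d, Inr d''}}"
    by (simp add: \<pi>)
  show ?thesis
    by (rule exI[of _ a''], rule exI[of _ b''], rule exI[of _ c''], rule exI[of _ d''])
      (intro conjI ab(1) cd(1) pl[unfolded img2])
qed

section \<open>Legs from the edges of a plane drawing\<close>

lemma oriented_edge_arc:
  assumes emb: "plane_embedding V E pos \<gamma>" and "{u, v} \<in> E"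
  obtains P where "arc P" "pathstart P = pos u" "pathfinish P = pos v" "path_image P = path_image (\<gamma> {u, v})"
proof -
  obtain u' v' where uv: "{u, v} = {u', v'}" "arc (\<gamma> {u, v})" "pathstart (\<gamma> {u, v}) = pos u'" "pathfinish (\<gamma> {u, v}) = pos v'"
    using plane_embedding_edge(1)[OF assms] by (elim exE conjE)
  show ?thesis
  proof (cases "u' = u")
    case True
    then have "v' = v" using uv(1) by (simp add: doubleton_eq_iff) blast
    then show ?thesis using that[of "\<gamma> {u, v}"] uv(2-4) True by simp
  next
    case False
    then have "v' = u" "u' = v" using uv(1) by (simp_all add: doubleton_eq_iff)
    then show ?thesis using that[of "reversepath (\<gamma> {u, v})"] uv(2-4) by (simp add: arc_reversepath)
  qed
qed

text \<open>Ends of \<open>f\<close> may be missing from \<open>V0\<close>: this covers edges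
  removed alone as well as edges removed with an end, such as those at \<open>x\<close> and
  \<open>y\<close>.\<close>

lemma edge_meets_drawing:
  assumes emb: "plane_embedding V E pos \<gamma>" and f: "f \<in> E"
    and sub: "V0 \<subseteq> V" "E0 \<subseteq> E - {f}" "\<And>e. e \<in> E0 \<Longrightarrow> e \<subseteq> V0" and "f \<subseteq> V"
  shows "path_image (\<gamma> f) \<inter> drawing V0 E0 pos \<gamma> = pos ` (f \<inter> V0)"
proof (intro equalityI subsetI)
  fix z assume z: "z \<in> path_image (\<gamma> f) \<inter> drawing V0 E0 pos \<gamma>"
  then consider "z \<in> pos ` V0" | e where "e \<in> E0" "z \<in> path_image (\<gamma> e)"
    unfolding drawing_def by blast
  then show "z \<in> pos ` (f \<inter> V0)"
  proof cases
    case 1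
    then have "z \<in> path_image (\<gamma> f) \<inter> pos ` V"
      using z sub(1) by blast
    then have "z \<in> pos ` f \<inter> pos ` V0"
      using 1 unfolding plane_embedding_edge(2)[OF emb f] by blast
    then show ?thesis
      using inj_on_image_Int[OF plane_embedding_inj[OF emb] \<open>f \<subseteq> V\<close> sub(1)] by simp
  next
    case 2
    then have "e \<in> E" "f \<noteq> e" using sub(2) by auto
    then have "z \<in> pos ` (f \<inter> e)"
      using plane_embedding_crossing[OF emb f, of e] 2 z by blast
    then show ?thesis using sub(3)[OF 2(1)] by blast
  qed
next
  fix z assume z: "z \<in> pos ` (f \<inter> V0)"
  then have "z \<in> pos ` f" by blast
  then have "z \<in> path_image (\<gamma> f)"
    using plane_embedding_edge(2)[OF emb f] by blast
  then show "z \<in> path_image (\<gamma> f) \<inter> drawing V0 E0 pos \<gamma>"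
    using z vertices_in_drawing[of pos V0 E0 \<gamma>] by blast
qed

lemma arc_interior_point:
  assumes "arc P"
  obtains x where "x \<in> path_image P" "x \<noteq> pathstart P" "x \<noteq> pathfinish P"
proof
  have inj: "inj_on P {0..1}" using assms by (simp add: arc_def)
  show "P (1/2) \<in> path_image P" by (simp add: path_image_def)
  show "P (1/2) \<noteq> pathstart P" "P (1/2) \<noteq> pathfinish P"
    using inj_onD[OF inj, of "1/2" 0] inj_onD[OF inj, of "1/2" 1] by (auto simp: pathstart_def pathfinish_def)
qed

text \<open>\<open>W\<close> is the component, in the complement of the first arc and the remaining
  drawing, of an inner point of the second arc. That point is a boundary point of the common face
  \<open>F\<close>, so the open set \<open>W\<close> meets \<open>F\<close> and then contains it;
  hence inner points of the first arc are limits of \<open>W\<close>.\<close>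

lemma four_legged_common_face:
  assumes emb: "plane_embedding V E pos \<gamma>" and G: "graph V E"
    and ab: "{a, b} \<in> E" and cd: "{c, d} \<in> E" and abcd: "distinct [a, b, c, d]"
    and face: "on_common_face V E pos \<gamma> {a, b} {c, d}"
  shows "four_legged V (E - {{a, b}, {c, d}}) a b c d"
proof -
  let ?E = "E - {{a, b}, {c, d}}"
  let ?K = "drawing V ?E pos \<gamma>"
  have sub: "?E \<subseteq> E" "\<And>e. e \<in> ?E \<Longrightarrow> e \<subseteq> V" using graph_edge_subset[OF G] by auto
  have sub1: "?E \<subseteq> E - {{a, b}}" "?E \<subseteq> E - {{c, d}}" by blast+
  have emb0: "plane_embedding V ?E pos \<gamma>" and G0: "graph V ?E"
    using plane_embedding_subgraph[OF emb subset_refl sub] graph_subset[OF G sub(1)] by auto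
  have inV: "{a, b} \<subseteq> V" "{c, d} \<subseteq> V" using graph_edge_subset[OF G] ab cd by auto
  obtain P where P: "arc P" "pathstart P = pos a" "pathfinish P = pos b" "path_image P = path_image (\<gamma> {a, b})"
    by (rule oriented_edge_arc[OF emb ab])
  obtain Q where Q: "arc Q" "pathstart Q = pos c" "pathfinish Q = pos d" "path_image Q = path_image (\<gamma> {c, d})"
    by (rule oriented_edge_arc[OF emb cd])
  have PK: "path_image P \<inter> ?K = {pos a, pos b}"
    using edge_meets_drawing[OF emb ab subset_refl sub1(1) sub(2) inV(1)] Int_absorb2[OF inV(1)] by (simp add: P(4))
  have QK: "path_image Q \<inter> ?K = {pos c, pos d}"
    using edge_meets_drawing[OF emb cd subset_refl sub1(2) sub(2) inV(2)] Int_absorb2[OF inV(2)] by (simp add: Q(4))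
  have neq: "{a, b} \<noteq> {c, d}" "{a, b} \<inter> {c, d} = {}" using abcd by (auto simp: doubleton_eq_iff)
  have PQ: "path_image P \<inter> path_image Q = {}"
    using plane_embedding_crossing[OF emb ab cd neq(1)] neq(2) by (simp add: P Q)
  obtain F where F: "F \<in> components (- drawing V E pos \<gamma>)"
      "path_image P \<subseteq> frontier F" "path_image Q \<subseteq> frontier F"
    using face unfolding on_common_face_def faces_def P(4) Q(4) by blast
  obtain x where x: "x \<in> path_image P" "x \<noteq> pos a" "x \<noteq> pos b"
    using arc_interior_point[OF P(1)] P(2,3) by metis
  obtain y where y: "y \<in> path_image Q" "y \<noteq> pos c" "y \<noteq> pos d"
    using arc_interior_point[OF Q(1)] Q(2,3) by metis
  have xK: "x \<notin> ?K" using x PK by blast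
  have yK: "y \<notin> ?K" using y QK by blast
  have clo: "closed (?K \<union> path_image P)"
    using compact_drawing[OF emb0 G0] P(1) by (simp add: closed_Un compact_imp_closed closed_path_image arc_imp_path)
  define W where "W = connected_component_set (- (?K \<union> path_image P)) y"
  have yC: "y \<in> - (?K \<union> path_image P)" using yK y(1) PQ by blast
  then have yW: "y \<in> W" by (simp add: W_def)
  have W: "open W" "connected W" "W \<subseteq> - (?K \<union> path_image P)"
    unfolding W_def
    by (intro open_connected_component open_Compl clo, rule connected_connected_component, rule connected_component_subset)
  have FK: "F \<subseteq> - (?K \<union> path_image P)"
  proof -
    have "?K \<union> path_image P \<subseteq> drawing V E pos \<gamma>"
      using ab by (auto simp: drawing_def P(4))
    then show ?thesis using in_components_subset[OF F(1)] by blast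
  qed
  have "y \<in> closure F" using F(3) y(1) by (auto simp: frontier_def)
  then have "W \<inter> F \<noteq> {}"
    using W(1) yW open_Int_closure_eq_empty[OF W(1), of F] by blast
  then obtain z where z: "z \<in> W" "z \<in> F" by blast
  have "F \<subseteq> connected_component_set (- (?K \<union> path_image P)) z"
    by (rule connected_component_maximal[OF z(2) in_components_connected[OF F(1)] FK])
  then have "F \<subseteq> W"
    using z(1) unfolding W_def by (metis connected_component_eq)
  then have "x \<in> closure W"
    using F(2) x(1) closure_mono[of F W] by (auto simp: frontier_def)
  then show ?thesis
    using four_leggedI[OF emb0 G0 P(1-3) PK Q(1-3) QK PQ W(1,2) _ _ yW y(1) x(1) xK _ abcd] W(3) by blast
qed

text \<open>The deleted edge \<open>xy\<close> replaces a common face: apart from its end at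
  \<open>x\<close> it avoids the first arc and the remaining drawing, so it stays in the component
  \<open>W\<close> of \<open>y\<close> and leads up to \<open>x\<close>.\<close>

lemma four_legged_edge:
  assumes emb: "plane_embedding V E pos \<gamma>" and G: "graph V E"
    and xy: "{x, y} \<in> E" and x: "{a, x} \<in> E" "{x, b} \<in> E" and y: "{c, y} \<in> E" "{y, d} \<in> E"
    and dist: "distinct [a, b, c, d, x, y]"
  shows "four_legged (V - {x, y}) (del_verts_edges E {x, y}) a b c d"
proof -
  let ?E = "del_verts_edges E {x, y}" and ?V = "V - {x, y}"
  let ?K = "drawing ?V ?E pos \<gamma>"
  have sub: "?E \<subseteq> E" "\<And>e. e \<in> ?E \<Longrightarrow> e \<subseteq> ?V"
    using graph_edge_subset[OF G] unfolding del_verts_edges_def by blast+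
  have emb0: "plane_embedding ?V ?E pos \<gamma>"
    using plane_embedding_subgraph[OF emb _ sub] by blast
  have G0: "graph ?V ?E"
    using G unfolding graph_def del_verts_edges_def by fastforce
  have inV: "{a, x} \<subseteq> V" "{x, b} \<subseteq> V" "{c, y} \<subseteq> V" "{y, d} \<subseteq> V" "{x, y} \<subseteq> V"
    using graph_edge_subset[OF G] xy x y by auto
  have meet: "path_image (\<gamma> f) \<inter> ?K = pos ` (f \<inter> ?V)" if "f \<in> E" "f \<subseteq> V" "x \<in> f \<or> y \<in> f" for f
    by (rule edge_meets_drawing[OF emb that(1) _ _ sub(2) that(2)]) (use sub(1) that(3) in \<open>auto simp: del_verts_edges_def\<close>)
  have cross: "path_image (\<gamma> e) \<inter> path_image (\<gamma> f) = pos ` (e \<inter> f)" if "e \<in> E" "f \<in> E" "e \<noteq> f" for e f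
    by (rule plane_embedding_crossing[OF emb that])
  obtain Pa where Pa: "arc Pa" "pathstart Pa = pos a" "pathfinish Pa = pos x" "path_image Pa = path_image (\<gamma> {a, x})"
    by (rule oriented_edge_arc[OF emb x(1)])
  obtain Pb where Pb: "arc Pb" "pathstart Pb = pos x" "pathfinish Pb = pos b" "path_image Pb = path_image (\<gamma> {x, b})"
    by (rule oriented_edge_arc[OF emb x(2)])
  obtain Qc where Qc: "arc Qc" "pathstart Qc = pos c" "pathfinish Qc = pos y" "path_image Qc = path_image (\<gamma> {c, y})"
    by (rule oriented_edge_arc[OF emb y(1)])
  obtain Qd where Qd: "arc Qd" "pathstart Qd = pos y" "pathfinish Qd = pos d" "path_image Qd = path_image (\<gamma> {y, d})"
    by (rule oriented_edge_arc[OF emb y(2)])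
  obtain M where M: "arc M" "pathstart M = pos x" "pathfinish M = pos y" "path_image M = path_image (\<gamma> {x, y})"
    by (rule oriented_edge_arc[OF emb xy])
  have ints: "{a, x} \<inter> {x, b} = {x}" "{c, y} \<inter> {y, d} = {y}" "{a, x} \<inter> {c, y} = {}" "{a, x} \<inter> {y, d} = {}"
    "{x, b} \<inter> {c, y} = {}" "{x, b} \<inter> {y, d} = {}" "{x, y} \<inter> {a, x} = {x}" "{x, y} \<inter> {x, b} = {x}"
    "{a, x} \<inter> ?V = {a}" "{x, b} \<inter> ?V = {b}" "{c, y} \<inter> ?V = {c}" "{y, d} \<inter> ?V = {d}" "{x, y} \<inter> ?V = {}"
    using dist inV by auto
  have neqs: "{a, x} \<noteq> {x, b}" "{c, y} \<noteq> {y, d}" "{a, x} \<noteq> {c, y}" "{a, x} \<noteq> {y, d}" "{x, b} \<noteq> {c, y}" "{x, b} \<noteq> {y, d}"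
    "{x, y} \<noteq> {a, x}" "{x, y} \<noteq> {x, b}"
    using dist by (auto simp: doubleton_eq_iff)
  define P where "P = Pa +++ Pb"
  define Q where "Q = Qc +++ Qd"
  have P: "arc P" "pathstart P = pos a" "pathfinish P = pos b" "path_image P = path_image Pa \<union> path_image Pb"
    using Pa Pb cross[OF x neqs(1)] ints(1) unfolding P_def by (auto intro!: arc_join simp: path_image_join)
  have Q: "arc Q" "pathstart Q = pos c" "pathfinish Q = pos d" "path_image Q = path_image Qc \<union> path_image Qd"
    using Qc Qd cross[OF y neqs(2)] ints(2) unfolding Q_def by (auto intro!: arc_join simp: path_image_join)
  have PK: "path_image P \<inter> ?K = {pos a, pos b}"
    using meet[OF x(1) inV(1)] meet[OF x(2) inV(2)] unfolding ints by (simp add: P(4) Pa Pb Int_Un_distrib2 insert_commute)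
  have QK: "path_image Q \<inter> ?K = {pos c, pos d}"
    using meet[OF y(1) inV(3)] meet[OF y(2) inV(4)] unfolding ints by (simp add: Q(4) Qc Qd Int_Un_distrib2 insert_commute)
  have PQ: "path_image P \<inter> path_image Q = {}"
    using cross[OF x(1) y(1) neqs(3)] cross[OF x(1) y(2) neqs(4)] cross[OF x(2) y(1) neqs(5)] cross[OF x(2) y(2) neqs(6)]
    unfolding ints by (simp add: P(4) Q(4) Pa Pb Qc Qd Int_Un_distrib Int_Un_distrib2)
  have MP: "path_image M \<inter> path_image P = {pos x}"
    using cross[OF xy x(1) neqs(7)] cross[OF xy x(2) neqs(8)]
    unfolding ints by (simp add: P(4) M Pa Pb Int_Un_distrib)
  have MK: "path_image M \<inter> ?K = {}"
    using meet[OF xy inV(5)] unfolding ints by (simp add: M)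
  have clo: "closed (?K \<union> path_image P)"
    using compact_drawing[OF emb0 G0] P(1) by (simp add: closed_Un compact_imp_closed closed_path_image arc_imp_path)
  define W where "W = connected_component_set (- (?K \<union> path_image P)) (pos y)"
  have M01: "M 0 = pos x" "M 1 = pos y" using M by (simp_all add: pathstart_def pathfinish_def)
  have inj: "inj_on M {0..1}" and cont: "continuous_on {0..1} M" using M(1) by (auto simp: arc_def path_def)
  \<comment> \<open>Parameter 0 is left out because \<open>M 0\<close> lies on the first arc; it
    returns as a limit point of \<open>W\<close>.\<close>
  have half: "M ` {0<..1} \<subseteq> - (?K \<union> path_image P)"
  proof -
    have "M t \<notin> ?K \<union> path_image P" if "0 < t" "t \<le> 1" for t
    proof -
      have "M t \<in> path_image M" using that by (auto simp: path_image_def)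
      moreover have "M t \<noteq> pos x"
        using inj_onD[OF inj, of t 0] that M01 by auto
      ultimately show ?thesis using MP MK by blast
    qed
    then show ?thesis by auto
  qed
  have conn: "connected (M ` {0<..1})"
    by (rule connected_continuous_image[OF continuous_on_subset[OF cont]]) auto
  have yM: "pos y \<in> M ` {0<..1}"
    using M01(2) by (metis greaterThanAtMost_iff imageI order_refl zero_less_one)
  have MW: "M ` {0<..1} \<subseteq> W"
    unfolding W_def by (rule connected_component_maximal[OF yM conn half])
  have W: "open W" "connected W" "W \<subseteq> - (?K \<union> path_image P)"
    unfolding W_def
    by (intro open_connected_component open_Compl clo, rule connected_connected_component, rule connected_component_subset)
  have "M ` closure {0<..1} \<subseteq> closure W"
    by (rule image_closure_subset) (use cont MW closure_subset in \<open>auto simp: continuous_on_subset\<close>)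
  then have xW: "pos x \<in> closure W"
    using M01(1) by (simp add: image_subset_iff) (metis atLeastAtMost_iff order_refl zero_le_one)
  have "pos x \<in> path_image M"
    using M(2) pathstart_in_path_image by metis
  then have xK: "pos x \<notin> ?K" using MK by blast
  have xP: "pos x \<in> path_image P" using MP by blast
  have yQ: "pos y \<in> path_image Q" using Qc(3) Q(4) pathfinish_in_path_image[of Qc] by auto
  have "distinct [a, b, c, d]" using dist by auto
  then show ?thesis
    using four_leggedI[OF emb0 G0 P(1-3) PK Q(1-3) QK PQ W(1,2) _ _ _ yQ xP xK xW] W(3) MW yM by blast
qed

theorem theorem2p1:
  fixes V :: "'a set" and E :: "'a set set" and V' :: "'b set" and E' :: "'b set set"
    and a b c d :: 'a and x y a' b' c' d' :: 'b
  assumes H: "cubic V E" "card V \<ge> 6" "\<not> hamiltonian V E"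
    and H': "cubic V' E'" "card V' \<ge> 6" "hypohamiltonian V' E'"
    and ab: "{a, b} \<in> E" and cd: "{c, d} \<in> E" and indep: "{a, b} \<inter> {c, d} = {}"
    and goodJ: "good_pair V (E - {{a, b}, {c, d}}) a c" "good_pair V (E - {{a, b}, {c, d}}) a d"
      "good_pair V (E - {{a, b}, {c, d}}) b c" "good_pair V (E - {{a, b}, {c, d}}) b d"
      "good_pairs V (E - {{a, b}, {c, d}}) a b c d"
    and goodt: "\<forall>t\<in>V. good_pair (V - {t}) (del_verts_edges E {t} - {{a, b}, {c, d}}) a b \<or>
                       good_pair (V - {t}) (del_verts_edges E {t} - {{a, b}, {c, d}}) c d"
    and xy: "{x, y} \<in> E'"
    and nx: "neighbours E' x - {y} = {a', b'}" "a' \<noteq> b'"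
    and ny: "neighbours E' y - {x} = {c', d'}" "c' \<noteq> d'"
  shows "cubic (dot_verts V V' x y) (dot_edges E E' a b c d x y a' b' c' d') \<and>
         hypohamiltonian (dot_verts V V' x y) (dot_edges E E' a b c d x y a' b' c' d') \<and>
         ((planar V' E' \<and>
         (\<exists>pos \<gamma>. plane_embedding V E pos \<gamma> \<and> on_common_face V E pos \<gamma> {a, b} {c, d})) \<longrightarrow>
         (\<exists>a'' b'' c'' d''. neighbours E' x - {y} = {a'', b''} \<and> a'' \<noteq> b'' \<and>
            neighbours E' y - {x} = {c'', d''} \<and> c'' \<noteq> d'' \<and>
            planar (dot_verts V V' x y) (dot_edges E E' a b c d x y a'' b'' c'' d''))) \<and>
         girth (dot_verts V V' x y) (dot_edges E E' a b c d x y a' b' c' d') \<ge>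
         min (girth V E) (girth V' E')"
proof -
  have G: "graph V E" and G': "graph V' E'"
    using H(1) H'(1) by (auto simp: cubic_def)
  have ab_neq: "distinct [a, b, c, d]"
    using graph_no_loop[OF G] ab cd indep by auto
  have "{y, x} \<in> E'"
    using xy by (simp add: insert_commute)
  have nbr_x: "{x, v} \<in> E' \<longleftrightarrow> v \<in> {y, a', b'}" for v
  proof -
    have "{x, v} \<in> E' \<longleftrightarrow> v = y \<or> v \<in> neighbours E' x - {y}"
      using xy by (auto simp: neighbours_def)
    then show ?thesis unfolding nx(1) by simp
  qed
  have nbr_y: "{y, v} \<in> E' \<longleftrightarrow> v \<in> {x, c', d'}" for v
  proof -
    have "{y, v} \<in> E' \<longleftrightarrow> v = x \<or> v \<in> neighbours E' y - {x}"
      using \<open>{y, x} \<in> E'\<close> by (auto simp: neighbours_def)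
    then show ?thesis unfolding ny(1) by simp
  qed
  \<comment> \<open>A common neighbour of \<open>x\<close> and \<open>y\<close> would complete a
    triangle; excluding it separates \<open>a'\<close>, \<open>b'\<close> from \<open>c'\<close>,
    \<open>d'\<close>.\<close>
  have no_triangle: "t \<notin> {c', d'}" if "t \<in> {a', b'}" for t
  proof
    assume t: "t \<in> {c', d'}"
    obtain z where "{c', d'} = {t, z}"
      using t by blast
    then have "v \<in> {x, t, z}" if "{y, v} \<in> E'" for v
      using that nbr_y by blast
    moreover have "{x, t} \<in> E'"
      using \<open>t \<in> {a', b'}\<close> nbr_x by blast
    ultimately show False
      using hypohamiltonian_no_triangle[OF H'(3) G' xy] by blast
  qed
  have "x \<noteq> y"
    using graph_no_loop[OF G'] xy by auto
  moreover have "y \<notin> {a', b'}" "x \<notin> {c', d'}"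
    using nx(1) ny(1) by blast+
  moreover have "x \<notin> {a', b'}" "y \<notin> {c', d'}"
    using graph_no_loop[OF G'] nbr_x[of x] nbr_y[of y] by blast+
  ultimately have distinct': "distinct [a', b', c', d', x, y]"
    using no_triangle[of a'] no_triangle[of b'] nx(2) ny(2) by auto
  interpret dot_product V E V' E' a b c d x y a' b' c' d'
    by unfold_locales (fact G G' ab cd ab_neq nbr_x nbr_y distinct')+
  have fin: "finite (dot_verts V V' x y)"
    using graph_dot by (simp add: graph_def)
  have deleted: "\<exists>c0. is_cycle DV D c0 \<and> set c0 = DV - {z}" if "z \<in> DV" for z
  proof (cases z)
    case (Inl t)
    then have "t \<in> V" using that by (auto simp: dot_verts_def)
    then show ?thesis
      using delete_Inl[OF H'(3) _ bspec[OF goodt]] Inl by simp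
  next
    case (Inr t)
    then have "t \<in> V' - {x, y}" using that by (auto simp: dot_verts_def)
    then show ?thesis
      using delete_Inr[OF H'(3) _ goodJ] Inr by simp
  qed
  have "\<not> hamiltonian DV D"
    using not_hamiltonian H(2,3) H'(2,3) unfolding hypohamiltonian_def by simp
  then have "hypohamiltonian DV D"
    unfolding hypohamiltonian_def hamiltonian_del_vertex using deleted by blast
  moreover have "cubic DV D"
    by (rule cubic_dot[OF H(1) H'(1)])
  moreover have "min (girth V E) (girth V' E') \<le> girth DV D"
  proof -
    \<comment> \<open>The cycle demanded by \<open>girth_ge\<close> is the one that avoids
      \<open>Inl a\<close>.\<close>
    have "Inl a \<in> DV" using S_subset by (auto simp: dot_verts_def)
    then obtain c0 where "is_cycle DV D c0" using deleted by blast
    then show ?thesis using girth_ge[OF fin _ girth_bound] by blast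
  qed
  moreover have "\<exists>a'' b'' c'' d''. neighbours E' x - {y} = {a'', b''} \<and> a'' \<noteq> b'' \<and>
      neighbours E' y - {x} = {c'', d''} \<and> c'' \<noteq> d'' \<and>
      planar (dot_verts V V' x y) (dot_edges E E' a b c d x y a'' b'' c'' d'')"
    if "planar V' E'" and "\<exists>pos \<gamma>. plane_embedding V E pos \<gamma> \<and> on_common_face V E pos \<gamma> {a, b} {c, d}"
  proof -
    obtain pos \<gamma> where "plane_embedding V E pos \<gamma>" "on_common_face V E pos \<gamma> {a, b} {c, d}"
      using \<open>\<exists>pos \<gamma>. _ pos \<gamma>\<close> by (elim exE conjE)
    then have legs: "four_legged V J a b c d"
      using four_legged_common_face G ab cd ab_neq by metis
    obtain pos' \<gamma>' where emb': "plane_embedding V' E' pos' \<gamma>'"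
      using \<open>planar V' E'\<close> unfolding planar_def by (elim exE)
    have "{a', x} \<in> E'" "{x, b'} \<in> E'" "{c', y} \<in> E'" "{y, d'} \<in> E'"
      using nbr_x[of a'] nbr_x[of b'] nbr_y[of c'] nbr_y[of d'] by (simp_all add: insert_commute)
    then have legs': "four_legged (V' - {x, y}) J' a' b' c' d'"
      by (rule four_legged_edge[OF emb' G' xy _ _ _ _ distinct'])
    have GJ: "graph V J" by (rule graph_subset[OF G]) blast
    have GJ': "graph (V' - {x, y}) J'"
      using G' unfolding graph_def del_verts_edges_def by fastforce
    have sub': "{a', b', c', d'} \<subseteq> V' - {x, y}"
      using V'_mem(3)[of a] V'_mem(3)[of b] V'_mem(3)[of c] V'_mem(3)[of d] by simp
    have dist4: "distinct [a', b', c', d']"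
      using distinct' by simp
    obtain a'' b'' c'' d'' where abcd'': "{a'', b''} = {a', b'}" "{c'', d''} = {c', d'}"
      and planar: "planar (Inl ` V \<union> Inr ` (V' - {x, y})) (image Inl ` J \<union> image Inr ` J' \<union>
        {{Inl a, Inr a''}, {Inl b, Inr b''}, {Inl c, Inr c''}, {Inl d, Inr d''}})"
      using planar_four_legged[OF GJ legs GJ' legs' S_subset ab_neq sub' dist4] by (elim exE conjE)
    \<comment> \<open>Labels are exchanged only within \<open>{a', b'}\<close> and within
      \<open>{c', d'}\<close>, so the neighbour sets of \<open>x\<close> and \<open>y\<close> are
      unchanged.\<close>
    have "a'' \<noteq> b''" "c'' \<noteq> d''"
      using abcd'' nx(2) ny(2) by (auto simp: doubleton_eq_iff)
    moreover have "planar (dot_verts V V' x y) (dot_edges E E' a b c d x y a'' b'' c'' d'')"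
      using planar unfolding dot_verts_def dot_edges_def .
    ultimately show ?thesis
      unfolding nx(1) ny(1) using abcd'' by metis
  qed
  ultimately show ?thesis
    by (intro conjI impI) (blast, blast, metis, blast)
qed

end
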